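(* Let $G$ be a graph with $h_1(G)=1$ and let $n$ be the length of its unique cycle. Then exactly one of the following possibilities occurs: (1) $R(\overline G)$ is contractible; (2) $R(\overline G)$ is homotopy equivalent to a sphere; (3) $R(\overline G)$ is homotopy equivalent to a wedge of two spheres of the same dimension. Moreover, (3) happens only if for every tree tentacle $T$ of $G$ the ideal $\overline T$ is conical and $n\equiv 0\pmod 3$.
   Context: $h_1(G)=\kappa+|E|-|V|$ ($\kappa$ = number of components), so $G$ has a unique cycle $C$. For each vertex $v$ of $C$, the tree tentacles at $v$ are the trees obtained from each connected component $K$ of (the component of $v$ in $G$ with the edges of $C$ removed) minus $v$, by adding back $v$ and its edge to $K$; $v$ is a leaf of the tentacle. For a graph on vertex set $X$, $\overline G\subset\mathbb{Z}[X]$ is the ideal generated by the squares of the vertices and the products $uv$ over edges; $R(\overline G)$ is the independence complex. For a monomial ideal $I$ containing all squares of variables: $R(I)$ is the complex of monomials not in $I$; $(I:x)=\{m:xm\in I\}$; $R(I)$ is a cone with apex $a$ if $(I:a)=(I,a)$; $a$ dominates $b$ in $I$ if $R(I)$ is not a cone with apex $b$ but $R((I,a))$ is. A sequence $(a_1,\ldots,a_r)$ of variables with $I_i=(I:a_1\cdots a_{i-1})$ is a resolution if for all $i\in[r]$, $a_i\notin I_i$ and either $R(I_i)$ is a cone with apex $a_i$ or $a_i$ dominates some variable in $I_i$; it is spherical if no $R(I_i)$ ($i\in[r]$) is a cone with apex $a_i$. $I$ is conical if it admits a resolution which is not spherical. *)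

theory Defs
  imports "HOL-Analysis.Analysis" "HOL-Algebra.Ideal" "HOL-Library.Poly_Mapping"
begin

section \<open>Graphs\<close>

text \<open>A graph is given by its vertex set \<open>V\<close> and its set \<open>E\<close> of two-element edges.\<close>

definition finite_simple_graph :: "'a set \<Rightarrow> 'a set set \<Rightarrow> bool" where
  "finite_simple_graph V E \<longleftrightarrow> finite V \<and> (\<forall>e\<in>E. e \<subseteq> V \<and> card e = 2)"

definition component_of :: "'a set \<Rightarrow> 'a set set \<Rightarrow> 'a \<Rightarrow> 'a set" where
  "component_of V E v = {u \<in> V. (v, u) \<in> {(x, y). {x, y} \<in> E}\<^sup>*}"

definition components :: "'a set \<Rightarrow> 'a set set \<Rightarrow> 'a set set" where
  "components V E = component_of V E ` V"

definition h1 :: "'a set \<Rightarrow> 'a set set \<Rightarrow> int" where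
  "h1 V E = int (card (components V E)) + int (card E) - int (card V)"

definition induced_edges :: "'a set set \<Rightarrow> 'a set \<Rightarrow> 'a set set" where
  "induced_edges E U = {e \<in> E. e \<subseteq> U}"

text \<open>A cycle is identified with its set \<open>C\<close> of edges, so that rotating or reversing the
  list \<open>vs\<close> gives the same cycle; its vertex set is \<open>\<Union>C\<close> and its length is \<open>card C\<close>.\<close>

definition is_cycle :: "'a set set \<Rightarrow> 'a set set \<Rightarrow> bool" where
  "is_cycle E C \<longleftrightarrow> C \<subseteq> E \<and>
     (\<exists>vs. distinct vs \<and> 3 \<le> length vs \<and>
       C = {{vs ! i, vs ! (Suc i mod length vs)} | i. i < length vs})"

text \<open>Meaningful only for graphs with exactly one cycle, in particular when \<open>h1 V E = 1\<close>.\<close>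

definition the_cycle :: "'a set set \<Rightarrow> 'a set set" where
  "the_cycle E = (THE C. is_cycle E C)"

text \<open>\<open>tentacles_at V F v\<close>: here \<open>F\<close> is the set of edges of the graph that do not lie on the
  cycle, \<open>H\<close> is the component of \<open>v\<close> in \<open>(V, F)\<close>, and \<open>K\<close> ranges over the components of \<open>H\<close>
  with \<open>v\<close> deleted. The edges of the tentacle are those of \<open>K\<close> together with the edge joining
  \<open>v\<close> to \<open>K\<close>.\<close>

definition tentacles_at :: "'a set \<Rightarrow> 'a set set \<Rightarrow> 'a \<Rightarrow> ('a set \<times> 'a set set) set" where
  "tentacles_at V F v =
     (let H = component_of V F v in
      {(insert v K, induced_edges F (insert v K)) | K.
         K \<in> components (H - {v}) (induced_edges F (H - {v}))})"

definition tree_tentacles :: "'a set \<Rightarrow> 'a set set \<Rightarrow> ('a set \<times> 'a set set) set" where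
  "tree_tentacles V E = (\<Union>v\<in>\<Union>(the_cycle E). tentacles_at V (E - the_cycle E) v)"


section \<open>Monomial ideals\<close>

type_synonym 'a zpoly = "('a \<Rightarrow>\<^sub>0 nat) \<Rightarrow>\<^sub>0 int"

definition monomial :: "('a \<Rightarrow>\<^sub>0 nat) \<Rightarrow> 'a zpoly" where
  "monomial m = Poly_Mapping.single m 1"

definition var :: "'a \<Rightarrow> 'a zpoly" where
  "var x = monomial (Poly_Mapping.single x 1)"

text \<open>The polynomial ring \<open>\<int>[X]\<close> in the variables indexed by the set \<open>X\<close>.\<close>

definition zpoly_ring :: "'a set \<Rightarrow> 'a zpoly ring" where
  "zpoly_ring X =
     \<lparr>carrier = {p. \<forall>m\<in>Poly_Mapping.keys p. Poly_Mapping.keys m \<subseteq> X},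
      mult = (*), one = 1, zero = 0, add = (+)\<rparr>"

lemma cring_zpoly_ring: "cring (zpoly_ring X)"
proof (rule cringI)
  have add: "p + q \<in> carrier (zpoly_ring X)"
    if "p \<in> carrier (zpoly_ring X)" "q \<in> carrier (zpoly_ring X)" for p q
    using that keys_add[of p q] unfolding zpoly_ring_def by (simp, blast)
  have mult: "p * q \<in> carrier (zpoly_ring X)"
    if pq: "p \<in> carrier (zpoly_ring X)" "q \<in> carrier (zpoly_ring X)" for p q
  proof -
    have "Poly_Mapping.keys m \<subseteq> X" if m: "m \<in> Poly_Mapping.keys (p * q)" for m
    proof -
      obtain a b where ab: "m = a + b" "a \<in> Poly_Mapping.keys p" "b \<in> Poly_Mapping.keys q"
        using keys_mult[of p q] m by blast
      have "Poly_Mapping.keys a \<subseteq> X" "Poly_Mapping.keys b \<subseteq> X"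
        using pq ab(2,3) by (simp_all add: zpoly_ring_def)
      with keys_add[of a b] show ?thesis
        unfolding ab(1) by (meson Un_least subset_trans)
    qed
    then show ?thesis by (simp add: zpoly_ring_def)
  qed
  have neg: "- p \<in> carrier (zpoly_ring X)" if "p \<in> carrier (zpoly_ring X)" for p
    using that by (simp add: zpoly_ring_def)
  have zero: "0 \<in> carrier (zpoly_ring X)" and one: "1 \<in> carrier (zpoly_ring X)"
    by (simp_all add: zpoly_ring_def)
  have ops: "x \<oplus>\<^bsub>zpoly_ring X\<^esub> y = x + y" "x \<otimes>\<^bsub>zpoly_ring X\<^esub> y = x * y"
    "\<zero>\<^bsub>zpoly_ring X\<^esub> = 0" "\<one>\<^bsub>zpoly_ring X\<^esub> = 1" for x y
    by (simp_all add: zpoly_ring_def)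
  show "abelian_group (zpoly_ring X)"
  proof (rule abelian_groupI, unfold ops)
    show "\<exists>y\<in>carrier (zpoly_ring X). y + x = 0" if "x \<in> carrier (zpoly_ring X)" for x
      using neg[OF that] by (rule bexI[rotated]) (rule add.left_inverse)
  qed (use add zero in \<open>simp_all only: add.assoc add.commute add.left_commute add_0 add_0_right\<close>)
  show "comm_monoid (zpoly_ring X)"
    by (rule comm_monoidI, unfold ops)
      (use mult one in \<open>simp_all only: mult.assoc mult.commute mult.left_commute mult_1 mult_1_right\<close>)
  show "(x \<oplus>\<^bsub>zpoly_ring X\<^esub> y) \<otimes>\<^bsub>zpoly_ring X\<^esub> z
      = x \<otimes>\<^bsub>zpoly_ring X\<^esub> z \<oplus>\<^bsub>zpoly_ring X\<^esub> y \<otimes>\<^bsub>zpoly_ring X\<^esub> z" for x y z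
    unfolding ops by (rule distrib_right)
qed

text \<open>The ideal \<open>(I, a)\<close> of \<open>\<int>[X]\<close>.\<close>

definition ideal_plus :: "'a set \<Rightarrow> 'a zpoly set \<Rightarrow> 'a \<Rightarrow> 'a zpoly set" where
  "ideal_plus X I a = genideal (zpoly_ring X) (insert (var a) I)"

definition ideal_colon :: "'a set \<Rightarrow> 'a zpoly set \<Rightarrow> 'a zpoly \<Rightarrow> 'a zpoly set" where
  "ideal_colon X I p = {q \<in> carrier (zpoly_ring X). p * q \<in> I}"

definition graph_ideal :: "'a set \<Rightarrow> 'a set set \<Rightarrow> 'a zpoly set" where
  "graph_ideal V E = genideal (zpoly_ring V)
     ({(var v)\<^sup>2 | v. v \<in> V} \<union> {var u * var v | u v. {u, v} \<in> E})"

text \<open>For an ideal \<open>I\<close> containing the squares of all variables, a monomial outside \<open>I\<close> is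
  squarefree and is thus determined by the set of variables dividing it. The monomial \<open>1\<close> is the
  empty face.\<close>

definition R_complex :: "'a set \<Rightarrow> 'a zpoly set \<Rightarrow> 'a set set" where
  "R_complex X I = {Poly_Mapping.keys m | m. Poly_Mapping.keys m \<subseteq> X \<and> monomial m \<notin> I}"

text \<open>\<open>R(I)\<close> is a cone with apex \<open>a\<close>.\<close>

definition is_cone_apex :: "'a set \<Rightarrow> 'a zpoly set \<Rightarrow> 'a \<Rightarrow> bool" where
  "is_cone_apex X I a \<longleftrightarrow> ideal_colon X I (var a) = ideal_plus X I a"

definition dominates :: "'a set \<Rightarrow> 'a zpoly set \<Rightarrow> 'a \<Rightarrow> 'a \<Rightarrow> bool" where
  "dominates X I a b \<longleftrightarrow> \<not> is_cone_apex X I b \<and> is_cone_apex X (ideal_plus X I a) b"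

text \<open>Lists are indexed from \<open>0\<close>, so \<open>step_ideal X I as i\<close> is \<open>I\<^sub>i\<^sub>+\<^sub>1\<close> in the usual
  numbering \<open>I\<^sub>i = (I : a\<^sub>1 \<cdots> a\<^sub>i\<^sub>-\<^sub>1)\<close>.\<close>

definition step_ideal :: "'a set \<Rightarrow> 'a zpoly set \<Rightarrow> 'a list \<Rightarrow> nat \<Rightarrow> 'a zpoly set" where
  "step_ideal X I as i = ideal_colon X I (prod_list (map var (take i as)))"

definition is_resolution :: "'a set \<Rightarrow> 'a zpoly set \<Rightarrow> 'a list \<Rightarrow> bool" where
  "is_resolution X I as \<longleftrightarrow> set as \<subseteq> X \<and>
     (\<forall>i<length as.
        var (as ! i) \<notin> step_ideal X I as i \<and>
        (is_cone_apex X (step_ideal X I as i) (as ! i) \<or>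
         (\<exists>b\<in>X. dominates X (step_ideal X I as i) (as ! i) b)))"

definition is_spherical :: "'a set \<Rightarrow> 'a zpoly set \<Rightarrow> 'a list \<Rightarrow> bool" where
  "is_spherical X I as \<longleftrightarrow>
     (\<forall>i<length as. \<not> is_cone_apex X (step_ideal X I as i) (as ! i))"

definition conical :: "'a set \<Rightarrow> 'a zpoly set \<Rightarrow> bool" where
  "conical X I \<longleftrightarrow> (\<exists>as. is_resolution X I as \<and> \<not> is_spherical X I as)"


section \<open>Topology\<close>

text \<open>Geometric realization by barycentric coordinates. The subspace topology used here is the
  usual one for finite complexes, which are the only ones considered. The empty face contributes
  no point.\<close>

definition geometric_realization :: "'a set set \<Rightarrow> ('a \<Rightarrow> real) topology" where
  "geometric_realization K = subtopology (powertop_real UNIV)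
     {f. (\<forall>x. 0 \<le> f x) \<and> {x. f x \<noteq> 0} \<in> K \<and> (\<Sum>x | f x \<noteq> 0. f x) = 1}"

text \<open>The wedge of the pointed spaces \<open>(X, x0)\<close> and \<open>(Y, y0)\<close>, as the union of the two
  coordinate axes in \<open>X \<times> Y\<close>. For arbitrary spaces the canonical map from the quotient of the
  disjoint union by \<open>x0 \<sim> y0\<close> onto this subspace is a homeomorphism.\<close>

definition wedge :: "'a topology \<Rightarrow> 'a \<Rightarrow> 'b topology \<Rightarrow> 'b \<Rightarrow> ('a \<times> 'b) topology" where
  "wedge X x0 Y y0 = subtopology (prod_topology X Y) (topspace X \<times> {y0} \<union> {x0} \<times> topspace Y)"

definition sphere_basepoint :: "nat \<Rightarrow> real" where
  "sphere_basepoint = (\<lambda>i. if i = 0 then 1 else 0)"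

lemma sphere_basepoint_in_nsphere: "sphere_basepoint \<in> topspace (nsphere d)"
  unfolding sphere_basepoint_def by (rule in_topspace_nsphere)

definition homotopy_sphere_type :: "'a topology \<Rightarrow> bool" where
  "homotopy_sphere_type X \<longleftrightarrow> (\<exists>d. X homotopy_equivalent_space nsphere d)"

definition homotopy_double_sphere_type :: "'a topology \<Rightarrow> bool" where
  "homotopy_double_sphere_type X \<longleftrightarrow>
     (\<exists>d. X homotopy_equivalent_space
            wedge (nsphere d) sphere_basepoint (nsphere d) sphere_basepoint)"

definition exactly_one_of :: "bool \<Rightarrow> bool \<Rightarrow> bool \<Rightarrow> bool" where
  "exactly_one_of P Q R \<longleftrightarrow> (P \<or> Q \<or> R) \<and> \<not> (P \<and> Q) \<and> \<not> (P \<and> R) \<and> \<not> (Q \<and> R)"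

end

theory Submission
  imports Defs "HOL-Homology.Brouwer_Degree"
begin

text \<open>The complex of a graph ideal is the independence complex of the graph. If \<open>b\<close> is a leaf with neighbour \<open>a\<close>, all other
  neighbours of \<open>a\<close> can be folded onto \<open>b\<close>, which leaves the isolated edge \<open>ab\<close> next to the graph
  without the closed neighbourhood \<open>N[a]\<close>. Stripping leaves in this way ends in one of three situations.
  If there is an isolated vertex, the complex is a cone. If only isolated edges remain, it is the
  boundary of a cross polytope. Otherwise all degrees are at least two, and \<open>h\<^sub>1 = 1\<close> forces the rest
  to be the cycle, whose length can be lowered by three at the price of another isolated edge; the
  triangle together with \<open>k\<close> isolated edges is the union of three cones over a \<open>(k - 1)\<close>-sphere, that
  is, a wedge of two \<open>k\<close>-spheres. In the last case no step touches the cycle, so the steps lying in a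
  tentacle at \<open>v\<close> form a resolution of the tentacle that leaves \<open>v\<close> isolated at the end.\<close>

section \<open>Collapses and cones\<close>

text \<open>One process has to deliver two things: a homotopy type and, in the last case,
  resolutions of the tentacle ideals. This is why a stripping step removes all of
  \<open>N[a]\<close> and not merely \<open>a\<close> and \<open>b\<close>: passing from
  \<open>I\<close> to \<open>(I : a)\<close> is the same deletion, so one list of vertices serves
  both purposes. Each step is a suspension; instead of forming suspensions, the proof carries the
  isolated edges along as a matching \<open>N\<close>, so that all intermediate spaces remain
  independence complexes and every reduction step is an instance of one collapse. That the three
  outcomes exclude each other is a separate matter. It needs degrees of maps, because the wedge has
  to be told apart from the spheres of every dimension. Finally, a wedge depends on base points, so
  the homeomorphisms between cross polytopes and spheres must keep track of one vertex.\<close>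

definition realization_points :: "'a set set \<Rightarrow> ('a \<Rightarrow> real) set" where
  "realization_points K = {f. (\<forall>x. 0 \<le> f x) \<and> {x. f x \<noteq> 0} \<in> K \<and> (\<Sum>x | f x \<noteq> 0. f x) = 1}"

lemma geometric_realization_eq: "geometric_realization K = top_of_set (realization_points K)"
  by (simp add: geometric_realization_def realization_points_def euclidean_product_topology)

lemma sum_support_eq:
  fixes f :: "'a \<Rightarrow> real"
  assumes "finite A" "\<And>x. f x \<noteq> 0 \<Longrightarrow> x \<in> A"
  shows "(\<Sum>x | f x \<noteq> 0. f x) = sum f A"
  using assms by (intro sum.mono_neutral_left) auto

lemma continuous_on_Min_coordinates:
  fixes F :: "'b::topological_space \<Rightarrow> 'a \<Rightarrow> real"
  assumes "finite A" "A \<noteq> {}" "continuous_on S F"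
  shows "continuous_on S (\<lambda>p. Min (F p ` A))"
  using assms(1,2)
proof (induction rule: finite_ne_induct)
  case (singleton x)
  then show ?case
    using continuous_on_product_then_coordinatewise[OF assms(3)] by simp
next
  case (insert x A)
  have "continuous_on S (\<lambda>p. min (F p x) (Min (F p ` A)))"
    by (intro continuous_on_min insert continuous_on_product_then_coordinatewise[OF assms(3)])
  with insert show ?case by simp
qed

lemma homotopic_with_top_of_set:
  assumes "continuous_on ({0..1::real} \<times> S) (\<lambda>p. h (fst p) (snd p))"
    and "\<And>t x. t \<in> {0..1} \<Longrightarrow> x \<in> S \<Longrightarrow> h t x \<in> T"
    and "\<And>x. x \<in> S \<Longrightarrow> h 0 x = f x" "\<And>x. x \<in> S \<Longrightarrow> h 1 x = g x"
  shows "homotopic_with (\<lambda>x. True) (top_of_set S) (top_of_set T) f g"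
proof -
  have "homotopic_with (\<lambda>x. True) (top_of_set S) (top_of_set T) (h 0) (h 1)"
    unfolding homotopic_with_def
  proof (intro exI conjI)
    show "continuous_map (prod_topology (top_of_set {0..1}) (top_of_set S)) (top_of_set T)
        (\<lambda>p. h (fst p) (snd p))"
      using assms(1,2) by (auto simp: prod_topology_subtopology_eu)
  qed auto
  then show ?thesis
    by (rule homotopic_with_eq) (use assms(3,4) in \<open>simp_all\<close>)
qed

text \<open>The deformation moves mass from \<open>s\<close> to \<open>w\<close> until some vertex of \<open>s\<close> has none left.\<close>

proposition collapse_homotopy_equivalent:
  fixes K :: "'a set set"
  assumes down: "\<And>A B. A \<in> K \<Longrightarrow> B \<subseteq> A \<Longrightarrow> B \<in> K" and fin: "\<And>A. A \<in> K \<Longrightarrow> finite A"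
    and s: "finite s" "s \<noteq> {}" "w \<notin> s"
    and cone: "\<And>A. A \<in> K \<Longrightarrow> s \<subseteq> A \<Longrightarrow> insert w A \<in> K"
  shows "geometric_realization K homotopy_equivalent_space
    geometric_realization {A \<in> K. \<not> s \<subseteq> A}"
proof -
  let ?X = "realization_points K" and ?Y = "realization_points {A \<in> K. \<not> s \<subseteq> A}"
  define m where "m f = Min (f ` s)" for f :: "'a \<Rightarrow> real"
  \<comment> \<open>The factor \<open>card s\<close> returns to \<open>w\<close> exactly what the
    vertices of \<open>s\<close> lose. If \<open>s\<close> is not contained in the support of
    \<open>f\<close>, then \<open>m f = 0\<close> and the formula is the identity; a single
    expression thus covers all faces and its continuity is evident.\<close>
  define h where "h t f = (\<lambda>x. f x - t * m f * of_bool (x \<in> s) + t * card s * m f * of_bool (x = w))"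
    for t :: real and f
  have YX: "?Y \<subseteq> ?X" by (auto simp: realization_points_def)
  have m_le: "m f \<le> f x" if "x \<in> s" for f x
    using that s by (simp add: m_def)
  have m_in: "\<exists>x\<in>s. f x = m f" for f
    using Min_in[of "f ` s"] s by (fastforce simp: m_def)
  have m0: "0 \<le> m f" if "f \<in> ?X" for f
  proof -
    have "\<forall>x. 0 \<le> f x" using that by (simp add: realization_points_def)
    with m_in[of f] show ?thesis by metis
  qed
  have h_id: "h t f = f" if "m f = 0" for t f
    using that by (auto simp: h_def)
  have mY: "m f = 0" if f: "f \<in> ?Y" for f
  proof -
    obtain x where "x \<in> s" "f x = 0"
      using f by (auto simp: realization_points_def subset_iff)
    with m_le[of x f] m0[of f] YX f show ?thesis by auto
  qed
  have pos: "0 \<le> h t f x" if "f \<in> ?X" "t \<in> {0..1}" for t f x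
  proof -
    have "t * m f \<le> 1 * m f" using that m0[of f] by (intro mult_right_mono) auto
    then show ?thesis
      using m_le[of x f] m0[of f] that s(3) by (auto simp: h_def realization_points_def)
  qed
  have hX: "h t f \<in> ?X" if f: "f \<in> ?X" and t: "t \<in> {0..1}" for t f
  proof (cases "m f = 0")
    case True
    then show ?thesis using f h_id by simp
  next
    case False
    let ?S = "{x. f x \<noteq> 0}"
    have SK: "?S \<in> K" and S1: "sum f ?S = 1" using f by (auto simp: realization_points_def)
    have sS: "s \<subseteq> ?S" using m_le[of _ f] m0[OF f] False by force
    have K: "insert w ?S \<in> K" using cone[OF SK sS] .
    have supp: "{x. h t f x \<noteq> 0} \<subseteq> insert w ?S"
      using sS by (auto simp: h_def of_bool_def split: if_splits)
    have finS: "finite (insert w ?S)" using fin[OF K] .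
    have "(\<Sum>x | h t f x \<noteq> 0. h t f x) = sum (h t f) (insert w ?S)"
      using supp finS by (intro sum_support_eq) auto
    also have "\<dots> = sum f (insert w ?S) - (\<Sum>x\<in>insert w ?S. t * m f * of_bool (x \<in> s))
        + (\<Sum>x\<in>insert w ?S. t * card s * m f * of_bool (x = w))"
      by (simp only: h_def sum.distrib sum_subtractf)
    also have "sum f (insert w ?S) = 1"
      using finS S1 sum_support_eq[of "insert w ?S" f] by auto
    also have "(\<Sum>x\<in>insert w ?S. t * m f * of_bool (x \<in> s)) = t * m f * card s"
    proof -
      have "(\<Sum>x\<in>insert w ?S. of_bool (x \<in> s) :: real) = card s"
        using finS sS by (subst sum_of_bool_eq) (auto intro!: arg_cong[of _ _ card])
      then show ?thesis by (simp flip: sum_distrib_left)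
    qed
    also have "(\<Sum>x\<in>insert w ?S. t * card s * m f * of_bool (x = w)) = t * card s * m f"
      using finS by (simp add: of_bool_def if_distrib cong: if_cong)
    finally have "(\<Sum>x | h t f x \<noteq> 0. h t f x) = 1" by simp
    then show ?thesis
      using pos[OF f t] down[OF K supp] by (simp add: realization_points_def)
  qed
  have h1Y: "h 1 f \<in> ?Y" if f: "f \<in> ?X" for f
  proof -
    obtain x where x: "x \<in> s" "f x = m f" using m_in by blast
    then have "h 1 f x = 0" using s(3) by (auto simp: h_def)
    with hX[OF f, of 1] x(1) show ?thesis by (auto simp: realization_points_def)
  qed
  have cont: "continuous_on S (\<lambda>p. h (T p) (F p))"
    if "continuous_on S T" "continuous_on S F" for S :: "'c::topological_space set" and T F
    unfolding h_def m_def
    by (intro continuous_on_coordinatewise_then_product continuous_intros that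
        continuous_on_product_then_coordinatewise[OF that(2)] continuous_on_Min_coordinates s)
  have c1: "continuous_on ?X (h 1)"
    by (intro cont continuous_intros)
  show ?thesis
    unfolding geometric_realization_eq
  proof (rule deformation_retract_imp_homotopy_equivalent_space[where r = "h 1"])
    have "continuous_on ({0..1} \<times> ?X) (\<lambda>p. h (fst p) (snd p))"
      by (intro cont continuous_intros)
    then show "homotopic_with (\<lambda>x. True) (top_of_set ?X) (top_of_set ?X) (h 1) id"
      by (rule homotopic_with_symD[OF homotopic_with_top_of_set]) (use hX in \<open>auto simp: h_def\<close>)
    show "retraction_maps (top_of_set ?X) (top_of_set ?Y) (h 1) id"
      unfolding retraction_maps_def
      using c1 h1Y YX h_id mY by auto
  qed
qed

text \<open>The segment from a point to the vertex \<open>w\<close> stays in the closed simplex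
  spanned by \<open>w\<close> and the support of the point, which is a face by
  \<open>cone\<close>.\<close>

proposition cone_contractible:
  fixes K :: "'a set set"
  assumes down: "\<And>A B. A \<in> K \<Longrightarrow> B \<subseteq> A \<Longrightarrow> B \<in> K" and fin: "\<And>A. A \<in> K \<Longrightarrow> finite A"
    and cone: "\<And>A. A \<in> K \<Longrightarrow> insert w A \<in> K"
  shows "contractible_space (geometric_realization K)"
proof -
  let ?X = "realization_points K"
  define d where "d x = (of_bool (x = w) :: real)" for x
  define h where "h t f = (\<lambda>x. (1 - t) * f x + t * d x)" for t f
  have hX: "h t f \<in> ?X" if f: "f \<in> ?X" and t: "t \<in> {0..1}" for t f
  proof -
    let ?S = "{x. f x \<noteq> 0}"
    have SK: "?S \<in> K" and S1: "sum f ?S = 1" using f by (auto simp: realization_points_def)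
    have K: "insert w ?S \<in> K" using cone[OF SK] .
    have finS: "finite (insert w ?S)" using fin[OF K] .
    have supp: "{x. h t f x \<noteq> 0} \<subseteq> insert w ?S"
      by (auto simp: h_def d_def)
    have "(\<Sum>x | h t f x \<noteq> 0. h t f x) = sum (h t f) (insert w ?S)"
      using supp finS by (intro sum_support_eq) auto
    also have "\<dots> = (1 - t) * sum f (insert w ?S) + t * sum d (insert w ?S)"
      by (simp only: h_def sum.distrib sum_distrib_left)
    also have "sum f (insert w ?S) = 1"
      using finS S1 sum_support_eq[of "insert w ?S" f] by auto
    also have "sum d (insert w ?S) = 1"
      using finS by (simp add: d_def of_bool_def)
    finally have "(\<Sum>x | h t f x \<noteq> 0. h t f x) = 1" by simp
    moreover have "0 \<le> h t f x" for x
      using f t by (auto simp: h_def d_def realization_points_def)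
    ultimately show ?thesis
      using down[OF K supp] by (simp add: realization_points_def)
  qed
  have "homotopic_with (\<lambda>x. True) (top_of_set ?X) (top_of_set ?X) id (\<lambda>_. d)"
  proof (rule homotopic_with_top_of_set[where h = h])
    show "continuous_on ({0..1} \<times> ?X) (\<lambda>p. h (fst p) (snd p))"
      unfolding h_def
      by (intro continuous_on_coordinatewise_then_product continuous_intros
          continuous_on_product_then_coordinatewise[OF continuous_on_snd[OF continuous_on_id]])
  qed (use hX in \<open>auto simp: h_def fun_eq_iff\<close>)
  then show ?thesis
    unfolding geometric_realization_eq contractible_space_def by blast
qed

section \<open>Independence complexes and cross polytopes\<close>

text \<open>\<open>F\<close> may contain forbidden sets of any size. A singleton in \<open>F\<close>
  deletes a vertex, so that adding an edge and deleting a vertex are one operation on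
  \<open>F\<close>. Members of \<open>F\<close> outside \<open>W\<close> have no effect, so
  \<open>F\<close> can stay fixed while \<open>W\<close> shrinks.\<close>

definition indep_complex :: "'a set \<Rightarrow> 'a set set \<Rightarrow> 'a set set" where
  "indep_complex W F = {A. A \<subseteq> W \<and> (\<forall>e\<in>F. \<not> e \<subseteq> A)}"

text \<open>Conditions on the support become sign and vanishing conditions on single coordinates,
  and the sum runs over a fixed set; explicit maps between realizations are checked in this
  form.\<close>

lemma realization_points_indep_complex:
  assumes "finite W"
  shows "realization_points (indep_complex W F) =
    {f. (\<forall>x. 0 \<le> f x) \<and> (\<forall>x. x \<notin> W \<longrightarrow> f x = 0) \<and> sum f W = 1 \<and> (\<forall>e\<in>F. \<exists>x\<in>e. f x = 0)}"
proof -
  have 1: "{x. f x \<noteq> 0} \<subseteq> W \<longleftrightarrow> (\<forall>x. x \<notin> W \<longrightarrow> f x = 0)"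
    and 2: "(\<forall>e\<in>F. \<not> e \<subseteq> {x. f x \<noteq> 0}) \<longleftrightarrow> (\<forall>e\<in>F. \<exists>x\<in>e. f x = 0)" for f :: "'a \<Rightarrow> real"
    by blast+
  have 3: "(\<Sum>x | f x \<noteq> 0. f x) = sum f W" if "\<forall>x. x \<notin> W \<longrightarrow> f x = 0" for f :: "'a \<Rightarrow> real"
    using that assms by (intro sum_support_eq) auto
  show ?thesis
    unfolding realization_points_def indep_complex_def mem_Collect_eq 1 2
    by (intro Collect_cong) (metis 3)
qed

text \<open>The realization is the unit sphere of the \<open>\<ell>\<^sup>1\<close> norm, \<open>a i\<close> and \<open>b i\<close> being the positive and
  negative \<open>i\<close>-th unit vectors.\<close>

proposition cross_polytope_homeomorphic_nsphere:
  fixes a b :: "nat \<Rightarrow> 'a"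
  assumes inj: "inj_on a {..k}" "inj_on b {..k}" and ab: "\<And>i j. i \<le> k \<Longrightarrow> j \<le> k \<Longrightarrow> a i \<noteq> b j"
  defines "X \<equiv> geometric_realization
    (indep_complex (a ` {..k} \<union> b ` {..k}) ((\<lambda>i. {a i, b i}) ` {..k}))"
  shows "\<exists>f g. homeomorphic_maps X (nsphere k) f g \<and> f (\<lambda>x. of_bool (x = a 0)) = sphere_basepoint"
proof -
  let ?W = "a ` {..k} \<union> b ` {..k}"
  let ?P = "realization_points (indep_complex ?W ((\<lambda>i. {a i, b i}) ` {..k}))"
  let ?S = "{x :: nat \<Rightarrow> real. (\<Sum>i\<le>k. x i ^ 2) = 1 \<and> (\<forall>i>k. x i = 0)}"
  have XP: "X = top_of_set ?P" unfolding X_def by (rule geometric_realization_eq)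
  have NS: "nsphere k = top_of_set ?S"
    unfolding nsphere euclidean_product_topology ..
  have sumW: "sum f ?W = (\<Sum>i\<le>k. f (a i) + f (b i))" for f :: "'a \<Rightarrow> real"
  proof -
    have "sum f ?W = sum f (a ` {..k}) + sum f (b ` {..k})"
      using ab by (intro sum.union_disjoint) auto
    also have "sum f (a ` {..k}) = (\<Sum>i\<le>k. f (a i))" using inj(1) by (simp add: sum.reindex)
    also have "sum f (b ` {..k}) = (\<Sum>i\<le>k. f (b i))" using inj(2) by (simp add: sum.reindex)
    finally show ?thesis by (simp add: sum.distrib)
  qed
  have P: "f \<in> ?P \<longleftrightarrow> (\<forall>x. 0 \<le> f x) \<and> (\<forall>x. x \<notin> ?W \<longrightarrow> f x = 0) \<and>
      (\<Sum>i\<le>k. f (a i) + f (b i)) = 1 \<and> (\<forall>i\<le>k. f (a i) = 0 \<or> f (b i) = 0)" for f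
    by (subst realization_points_indep_complex) (simp, simp only: sumW, auto)
  \<comment> \<open>Of each pair \<open>a i\<close>, \<open>b i\<close> at most one coordinate is
    nonzero, so the pair is encoded by the signed number \<open>y f i\<close>. \<open>D\<close> is
    the Euclidean norm and \<open>L\<close> the \<ell>1 norm; \<open>F\<close> and \<open>G\<close>
    are the radial projections between the two unit spheres.\<close>
  define y where "y f i = (f (a i) - f (b i) :: real)" for f i
  define D where "D f = sqrt (\<Sum>j\<le>k. (y f j)\<^sup>2)" for f
  define L where "L x = (\<Sum>j\<le>k. \<bar>x j\<bar>)" for x :: "nat \<Rightarrow> real"
  define F where "F f = (\<lambda>i. if i \<le> k then y f i / D f else 0)" for f
  define G where "G x = (\<lambda>v. (\<Sum>i\<le>k. of_bool (v = a i) * max 0 (x i) + of_bool (v = b i) * max 0 (- x i)) / L x)"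
    for x :: "nat \<Rightarrow> real"
  have Ga: "G x (a i) = max 0 (x i) / L x" if "i \<le> k" for x i
  proof -
    have "(\<Sum>j\<le>k. of_bool (a i = a j) * max 0 (x j) + of_bool (a i = b j) * max 0 (- x j))
        = (\<Sum>j\<le>k. if j = i then max 0 (x j) else 0)"
      using that ab inj(1) by (intro sum.cong) (auto simp: inj_on_def)
    then show ?thesis using that by (simp add: G_def)
  qed
  have Gb: "G x (b i) = max 0 (- x i) / L x" if "i \<le> k" for x i
  proof -
    have "(\<Sum>j\<le>k. of_bool (b i = a j) * max 0 (x j) + of_bool (b i = b j) * max 0 (- x j))
        = (\<Sum>j\<le>k. if j = i then max 0 (- x j) else 0)"
      using that ab[of _ i, symmetric] inj(2) by (intro sum.cong) (auto simp: inj_on_def)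
    then show ?thesis using that by (simp add: G_def)
  qed
  have G0: "G x v = 0" if "v \<notin> ?W" for x v
  proof -
    have "(\<Sum>i\<le>k. of_bool (v = a i) * max 0 (x i) + of_bool (v = b i) * max 0 (- x i)) = (\<Sum>i\<le>k. 0)"
      using that by (intro sum.cong) auto
    then show ?thesis by (simp add: G_def)
  qed
  have Lpos: "L x > 0" if "x \<in> ?S" for x
  proof -
    have "\<not> (\<forall>i\<le>k. x i = 0)"
    proof
      assume "\<forall>i\<le>k. x i = 0"
      then have "(\<Sum>i\<le>k. (x i)\<^sup>2) = (\<Sum>i\<le>k. 0)" by (intro sum.cong) auto
      with that show False by simp
    qed
    then obtain i where "i \<le> k" "x i \<noteq> 0" by blast
    then show ?thesis unfolding L_def by (intro sum_pos2[of _ i]) auto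
  qed
  have absy: "\<bar>y f i\<bar> = f (a i) + f (b i)" if "f \<in> ?P" "i \<le> k" for f i
  proof -
    have "0 \<le> f (a i)" "0 \<le> f (b i)" "f (a i) = 0 \<or> f (b i) = 0" using that P by auto
    then show ?thesis by (auto simp: y_def)
  qed
  have Dpos: "D f > 0" if f: "f \<in> ?P" for f
  proof -
    have "(\<Sum>i\<le>k. \<bar>y f i\<bar>) = 1" using absy[OF f] f P by simp
    then have "\<not> (\<forall>i\<le>k. \<bar>y f i\<bar> = 0)"
      by (metis (no_types, lifting) atMost_iff sum.neutral zero_neq_one)
    then obtain i where "i \<le> k" "y f i \<noteq> 0" by auto
    then show ?thesis unfolding D_def real_sqrt_gt_0_iff by (intro sum_pos2[of _ i]) auto
  qed
  have FS: "F f \<in> ?S" if f: "f \<in> ?P" for f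
  proof -
    have "(\<Sum>i\<le>k. (F f i)\<^sup>2) = (\<Sum>i\<le>k. (y f i)\<^sup>2) / (D f)\<^sup>2"
      by (simp add: F_def power_divide sum_divide_distrib)
    also have "(D f)\<^sup>2 = (\<Sum>i\<le>k. (y f i)\<^sup>2)" by (simp add: D_def sum_nonneg)
    finally show ?thesis using Dpos[OF f] by (simp add: D_def F_def)
  qed
  have GP: "G x \<in> ?P" if x: "x \<in> ?S" for x
  proof -
    have "(\<Sum>i\<le>k. G x (a i) + G x (b i)) = (\<Sum>i\<le>k. \<bar>x i\<bar> / L x)"
      by (intro sum.cong) (auto simp: Ga Gb max_def)
    also have "\<dots> = 1" using Lpos[OF x] by (simp add: L_def flip: sum_divide_distrib)
    finally have "(\<Sum>i\<le>k. G x (a i) + G x (b i)) = 1" .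
    moreover have "0 \<le> G x v" for v
      using Lpos[OF x] unfolding G_def by (intro divide_nonneg_nonneg sum_nonneg) auto
    ultimately show ?thesis by (auto simp: P G0 Ga Gb max_def)
  qed
  have FG: "F (G x) = x" if x: "x \<in> ?S" for x
  proof -
    have yG: "y (G x) i = x i / L x" if "i \<le> k" for i
      using that by (auto simp: y_def Ga Gb max_def)
    have "(\<Sum>j\<le>k. (y (G x) j)\<^sup>2) = (\<Sum>j\<le>k. (x j)\<^sup>2) / (L x)\<^sup>2"
      by (simp add: yG power_divide flip: sum_divide_distrib)
    then have "D (G x) = 1 / L x"
      using x Lpos[OF x] by (simp add: D_def real_sqrt_divide)
    then show ?thesis
      using x Lpos[OF x] by (auto simp: F_def yG fun_eq_iff)
  qed
  have GF: "G (F f) = f" if f: "f \<in> ?P" for f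
  proof
    fix v
    have "L (F f) = (\<Sum>j\<le>k. \<bar>y f j\<bar>) / D f"
      using Dpos[OF f] by (simp add: L_def F_def sum_divide_distrib)
    also have "\<dots> = 1 / D f" using absy[OF f] f P by simp
    finally have L: "L (F f) = 1 / D f" .
    have fs: "0 \<le> f (a i)" "0 \<le> f (b i)" "f (a i) = 0 \<or> f (b i) = 0" if "i \<le> k" for i
      using that f P by auto
    have m: "max 0 (z / D f) / (1 / D f) = max 0 z" for z
      using Dpos[OF f] by (auto simp: max_def field_simps)
    consider i where "i \<le> k" "v = a i" | i where "i \<le> k" "v = b i" | "v \<notin> ?W" by blast
    then show "G (F f) v = f v"
    proof cases
      case 1
      then have "G (F f) v = max 0 (F f i) / (1 / D f)" by (simp only: Ga L)
      with 1(1) m have "G (F f) v = max 0 (y f i)" by (simp add: F_def)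
      with 1 fs[of i] show ?thesis by (auto simp: y_def)
    next
      case 2
      then have "G (F f) v = max 0 (- F f i) / (1 / D f)" by (simp only: Gb L)
      with 2(1) m[of "- y f i"] have "G (F f) v = max 0 (- y f i)" by (simp add: F_def)
      with 2 fs[of i] show ?thesis by (auto simp: y_def)
    next
      case 3
      with f show ?thesis by (simp add: G0 P)
    qed
  qed
  have co: "continuous_on S (\<lambda>f. f x)" for S :: "('c \<Rightarrow> real) set" and x
    by (rule continuous_on_product_then_coordinatewise) (rule continuous_on_id)
  have "continuous_on ?P F"
    unfolding F_def
  proof (intro continuous_on_coordinatewise_then_product)
    fix i
    have "continuous_on ?P D" "continuous_on ?P (\<lambda>f. y f i)"
      unfolding D_def y_def by (intro continuous_intros co)+
    moreover have "\<forall>f\<in>?P. D f \<noteq> 0"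
    proof
      fix f assume "f \<in> ?P"
      then have "D f > 0" by (rule Dpos)
      then show "D f \<noteq> 0" by simp
    qed
    ultimately show "continuous_on ?P (\<lambda>f. if i \<le> k then y f i / D f else 0)"
      by (cases "i \<le> k") (simp_all add: continuous_on_divide)
  qed
  moreover have "continuous_on ?S G"
    unfolding G_def
  proof (intro continuous_on_coordinatewise_then_product continuous_on_divide)
    show "continuous_on ?S L" unfolding L_def by (intro continuous_intros co)
    show "\<forall>x\<in>?S. L x \<noteq> 0"
    proof
      fix x assume "x \<in> ?S"
      then have "L x > 0" by (rule Lpos)
      then show "L x \<noteq> 0" by simp
    qed
  qed (intro continuous_intros co)
  ultimately have hm: "homeomorphic_maps X (nsphere k) F G"
    using FS GP FG GF unfolding homeomorphic_maps_def XP NS by auto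
  \<comment> \<open>The vertex \<open>a 0\<close> is the first unit vector, which has norm 1 for
    both norms and is therefore fixed by the projection.\<close>
  have "F (\<lambda>x. of_bool (x = a 0)) = sphere_basepoint"
  proof -
    let ?d = "\<lambda>x. of_bool (x = a 0) :: real"
    have y: "y ?d i = of_bool (i = 0)" if "i \<le> k" for i
      using that ab[of 0 i] inj(1) by (auto simp: y_def inj_on_def)
    have "D ?d = sqrt (\<Sum>j\<le>k. if j = 0 then 1 else 0)"
      unfolding D_def by (intro arg_cong[of _ _ sqrt] sum.cong) (auto simp: y)
    then have "D ?d = 1" by simp
    then show ?thesis by (auto simp: F_def y sphere_basepoint_def fun_eq_iff)
  qed
  with hm show ?thesis by blast
qed

section \<open>Wedges of two spheres\<close>

abbreviation double_sphere :: "nat \<Rightarrow> ((nat \<Rightarrow> real) \<times> (nat \<Rightarrow> real)) topology" where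
  "double_sphere d \<equiv> wedge (nsphere d) sphere_basepoint (nsphere d) sphere_basepoint"

lemma continuous_map_wedge_fst: "continuous_map (wedge X x0 Y y0) X fst"
  and continuous_map_wedge_snd: "continuous_map (wedge X x0 Y y0) Y snd"
  unfolding wedge_def
  by (simp_all add: continuous_map_from_subtopology continuous_map_fst continuous_map_snd)

lemma continuous_map_into_wedge:
  assumes "continuous_map Z X f" "continuous_map Z Y g"
    and "\<And>z. z \<in> topspace Z \<Longrightarrow> f z = x0 \<or> g z = y0"
  shows "continuous_map Z (wedge X x0 Y y0) (\<lambda>z. (f z, g z))"
proof -
  have "f z \<in> topspace X" "g z \<in> topspace Y" if "z \<in> topspace Z" for z
    using assms(1,2) that by (auto simp: continuous_map_def)
  with assms show ?thesis
    unfolding wedge_def continuous_map_in_subtopology by (fastforce simp: continuous_map_paired)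
qed

text \<open>The wedge retracts onto its first sphere, and contractibility passes to
  retracts.\<close>

lemma not_contractible_double_sphere: "\<not> contractible_space (double_sphere d)"
proof
  assume "contractible_space (double_sphere d)"
  moreover have "retraction_map (double_sphere d) (nsphere d) fst"
    unfolding retraction_map_def retraction_maps_def
    by (rule exI[of _ "\<lambda>x. (x, sphere_basepoint)"])
      (auto intro!: continuous_map_wedge_fst continuous_map_into_wedge
        simp: sphere_basepoint_in_nsphere)
  ultimately show False
    using contractible_space_retraction_map_image non_contractible_space_nsphere by blast
qed

text \<open>On reduced homology in degree \<open>d\<close> the map factors through the group of the
  \<open>e\<close>-sphere, which is trivial there. This covers the case in which a sphere supposedly
  equivalent to a wedge has a different dimension.\<close>

lemma Brouwer_degree2_through_other_dim:
  assumes "continuous_map (nsphere d) (nsphere e) f" "continuous_map (nsphere e) (nsphere d) g"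
    and "d \<noteq> e"
  shows "Brouwer_degree2 d (g \<circ> f) = 0"
proof (rule Brouwer_degree2_unique)
  show "continuous_map (nsphere d) (nsphere d) (g \<circ> f)"
    using assms continuous_map_compose by blast
next
  fix x assume x: "x \<in> carrier (reduced_homology_group (int d) (nsphere d))"
  let ?f = "hom_induced (int d) (nsphere d) {} (nsphere e) {} f"
  let ?g = "hom_induced (int d) (nsphere e) {} (nsphere d) {} g"
  have "trivial_group (reduced_homology_group (int d) (nsphere e))"
    using assms(3) by (simp add: trivial_reduced_homology_group_nsphere)
  moreover have "?f x \<in> carrier (reduced_homology_group (int d) (nsphere e))"
    using x by (rule hom_induced_reduced)
  ultimately have "?f x = \<one>\<^bsub>reduced_homology_group (int d) (nsphere e)\<^esub>"
    by (simp add: trivial_group_def)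
  then have "?g (?f x) = \<one>\<^bsub>reduced_homology_group (int d) (nsphere d)\<^esub>"
    using hom_one[OF hom_induced_reduced_hom[of "int d" "nsphere e" "nsphere d" g]]
    by simp
  moreover have "hom_induced (int d) (nsphere d) {} (nsphere d) {} (g \<circ> f) x = ?g (?f x)"
    using hom_induced_compose[OF assms(1) _ assms(2), of "{}" "{}" "{}" "int d"] by simp
  ultimately show "hom_induced (int d) (nsphere d) {} (nsphere d) {} (g \<circ> f) x
      = x [^]\<^bsub>reduced_homology_group (int d) (nsphere d)\<^esub> (0::int)"
    by simp
qed

text \<open>If \<open>g \<circ> f \<simeq> id\<close> on the wedge, then composing with the inclusions \<open>i\<^sub>j\<close> and retractions \<open>r\<^sub>j\<close>
  of the two spheres gives \<open>deg (r\<^sub>j g) deg (f i\<^sub>k) = deg (r\<^sub>j i\<^sub>k)\<close>, the identity matrix,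
  which does not have rank one.\<close>

lemma double_sphere_not_equivalent_nsphere:
  "\<not> double_sphere d homotopy_equivalent_space nsphere e"
proof
  let ?W = "double_sphere d"
  assume "?W homotopy_equivalent_space nsphere e"
  then obtain f g where f: "continuous_map ?W (nsphere e) f"
    and g: "continuous_map (nsphere e) ?W g"
    and gf: "homotopic_with (\<lambda>x. True) ?W ?W (g \<circ> f) id"
    unfolding homotopy_equivalent_space_def by blast
  define i where "i b x = (if b then (x, sphere_basepoint) else (sphere_basepoint, x))"
    for b and x :: "nat \<Rightarrow> real"
  define r :: "bool \<Rightarrow> (nat \<Rightarrow> real) \<times> (nat \<Rightarrow> real) \<Rightarrow> nat \<Rightarrow> real" where "r b = (if b then fst else snd)" for b
  have i: "continuous_map (nsphere d) ?W (i b)" for b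
    unfolding i_def
    by (cases b) (auto intro!: continuous_map_into_wedge simp: sphere_basepoint_in_nsphere)
  have r: "continuous_map ?W (nsphere d) (r b)" for b
    by (cases b) (auto simp: r_def continuous_map_wedge_fst continuous_map_wedge_snd)
  have ri: "r b \<circ> i c = (if b = c then id else (\<lambda>x. sphere_basepoint))" for b c
    by (auto simp: r_def i_def fun_eq_iff)
  have hom: "homotopic_with (\<lambda>x. True) (nsphere d) (nsphere d) (r b \<circ> g \<circ> (f \<circ> i c)) (r b \<circ> i c)" for b c
  proof -
    have "homotopic_with (\<lambda>x. True) (nsphere d) (nsphere d) (r b \<circ> (g \<circ> f) \<circ> i c) (r b \<circ> id \<circ> i c)"
      by (intro homotopic_with_compose_continuous_map_right[OF _ i]
          homotopic_with_compose_continuous_map_left[OF gf r]) auto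
    then show ?thesis by (simp add: o_assoc)
  qed
  have deg: "Brouwer_degree2 d (r b \<circ> g \<circ> (f \<circ> i c)) = (if b = c then 1 else 0)" for b c
  proof (cases "b = c")
    case True
    then show ?thesis
      using Brouwer_degree2_homotopic[OF hom[of b c]] by (simp add: ri)
  next
    case False
    then show ?thesis
      using Brouwer_degree2_nullhomotopic hom[of b c] by (auto simp: ri)
  qed
  have rg: "continuous_map (nsphere e) (nsphere d) (r b \<circ> g)" for b
    using g r continuous_map_compose by blast
  have fi: "continuous_map (nsphere d) (nsphere e) (f \<circ> i c)" for c
    using f i continuous_map_compose by blast
  show False
  proof (cases "d = e")
    case True
    then have "Brouwer_degree2 d (r b \<circ> g \<circ> (f \<circ> i c))
        = Brouwer_degree2 d (r b \<circ> g) * Brouwer_degree2 d (f \<circ> i c)" for b c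
      using Brouwer_degree2_compose rg fi by blast
    with deg[of True True] deg[of True False] deg[of False False] show False
      by auto
  next
    \<comment> \<open>With different dimensions the two factors have no degrees of their own, but a
      single diagonal entry 1 is already impossible.\<close>
    case False
    with Brouwer_degree2_through_other_dim[OF fi rg] deg[of True True] show False
      by simp
  qed
qed

lemma exactly_one_homotopy_type:
  assumes "contractible_space X \<or> homotopy_sphere_type X \<or> homotopy_double_sphere_type X"
  shows "exactly_one_of (contractible_space X) (homotopy_sphere_type X) (homotopy_double_sphere_type X)"
  unfolding exactly_one_of_def homotopy_sphere_type_def homotopy_double_sphere_type_def
proof (intro conjI notI)
  assume "contractible_space X \<and> (\<exists>d. X homotopy_equivalent_space nsphere d)"
  then show False
    using homotopy_equivalent_space_contractibility non_contractible_space_nsphere by blast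
next
  assume "contractible_space X \<and> (\<exists>d. X homotopy_equivalent_space double_sphere d)"
  then show False
    using homotopy_equivalent_space_contractibility not_contractible_double_sphere by blast
next
  assume "(\<exists>d. X homotopy_equivalent_space nsphere d) \<and> (\<exists>d. X homotopy_equivalent_space double_sphere d)"
  then show False
    using homotopy_eqv_trans homotopy_equivalent_space_sym double_sphere_not_equivalent_nsphere by metis
qed (use assms in \<open>simp add: homotopy_sphere_type_def homotopy_double_sphere_type_def\<close>)

section \<open>Gluing two spaces along a contractible intersection\<close>

lemma wedge_homeomorphic:
  assumes f: "homeomorphic_maps X X' f f'" and g: "homeomorphic_maps Y Y' g g'"
    and "x0 \<in> topspace X" "y0 \<in> topspace Y"
  shows "wedge X x0 Y y0 homeomorphic_space wedge X' (f x0) Y' (g y0)"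
proof -
  let ?h = "\<lambda>(x, y). (f x, g y)" and ?h' = "\<lambda>(x, y). (f' x, g' y)"
  have "homeomorphic_maps (prod_topology X Y) (prod_topology X' Y') ?h ?h'"
    using f g homeomorphic_maps_prod by blast
  moreover have "f' (f x0) = x0" "g' (g y0) = y0"
    using assms by (auto simp: homeomorphic_maps_def)
  moreover have "f ` topspace X \<subseteq> topspace X'" "f' ` topspace X' \<subseteq> topspace X"
    "g ` topspace Y \<subseteq> topspace Y'" "g' ` topspace Y' \<subseteq> topspace Y"
    using f g by (auto simp: homeomorphic_maps_def continuous_map_def)
  ultimately have "homeomorphic_maps (wedge X x0 Y y0) (wedge X' (f x0) Y' (g y0)) ?h ?h'"
    unfolding wedge_def by (intro homeomorphic_maps_subtopologies_alt) auto
  then show ?thesis unfolding homeomorphic_space_def by blast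
qed

text \<open>At time 1 the intersection has been moved to \<open>q\<close>, so each part can be sent
  to its own axis of the wedge. The same \<open>H\<close> shows that both composites are homotopic
  to the identity: directly on the union, and componentwise on the wedge, where fixing
  \<open>q\<close> keeps the homotopy on the axes.\<close>

proposition union_equivalent_wedge:
  fixes A B :: "('a \<Rightarrow> real) set"
  assumes cl: "closedin (top_of_set (A \<union> B)) A" "closedin (top_of_set (A \<union> B)) B"
    and q: "q \<in> A \<inter> B"
    and cont: "continuous_on ({0..1::real} \<times> (A \<union> B)) (\<lambda>p. H (fst p) (snd p))"
    and HA: "\<And>t x. t \<in> {0..1} \<Longrightarrow> x \<in> A \<Longrightarrow> H t x \<in> A"
    and HB: "\<And>t x. t \<in> {0..1} \<Longrightarrow> x \<in> B \<Longrightarrow> H t x \<in> B"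
    and H0: "\<And>x. x \<in> A \<union> B \<Longrightarrow> H 0 x = x"
    and H1: "\<And>x. x \<in> A \<inter> B \<Longrightarrow> H 1 x = q"
    and Hq: "\<And>t. t \<in> {0..1} \<Longrightarrow> H t q = q"
  shows "top_of_set (A \<union> B) homotopy_equivalent_space wedge (top_of_set A) q (top_of_set B) q"
proof -
  let ?W = "A \<times> {q} \<union> {q} \<times> B"
  have W: "wedge (top_of_set A) q (top_of_set B) q = top_of_set ?W"
    using q by (auto simp: wedge_def prod_topology_subtopology_eu subtopology_subtopology
        intro!: arg_cong[of _ _ top_of_set])
  \<comment> \<open>On \<open>A \<inter> B\<close> both components equal \<open>q\<close> by
    \<open>H1\<close>. The branches of each component therefore agree where the closed parts meet,
    and pasting gives continuity.\<close>
  define \<phi> where "\<phi> x = (if x \<in> A then H 1 x else q, if x \<in> B then H 1 x else q)" for x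
  \<comment> \<open>One component of a point of the wedge is \<open>q\<close>, so this expression
    returns the other one without a case distinction.\<close>
  define \<psi> where "\<psi> p = (\<lambda>x. fst p x + snd p x - q x)" for p :: "('a \<Rightarrow> real) \<times> ('a \<Rightarrow> real)"
  have cH: "continuous_on S (\<lambda>p. H (T p) (F p))"
    if "continuous_on S T" "continuous_on S F" "\<And>p. p \<in> S \<Longrightarrow> T p \<in> {0..1}" "\<And>p. p \<in> S \<Longrightarrow> F p \<in> A \<union> B"
    for S :: "'c::topological_space set" and T F
    using continuous_on_compose2[OF cont continuous_on_Pair[OF that(1,2)]] that(3,4)
    by (simp add: image_subset_iff mem_Times_iff)
  have c1: "continuous_on S (H 1)" if "S \<subseteq> A \<union> B" for S
    using that by (intro cH[of S "\<lambda>_. 1" "\<lambda>x. x"] continuous_on_const continuous_on_id) auto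
  have "continuous_on (A \<union> B) (\<lambda>x. if x \<in> A then H 1 x else q)"
    by (rule continuous_on_cases_local[OF cl c1 continuous_on_const]) (use H1 in auto)
  moreover have "continuous_on (B \<union> A) (\<lambda>x. if x \<in> B then H 1 x else q)"
    using cl by (intro continuous_on_cases_local c1 continuous_on_const) (use H1 in \<open>auto simp: Un_commute\<close>)
  ultimately have c\<phi>: "continuous_on (A \<union> B) \<phi>"
    unfolding \<phi>_def by (intro continuous_on_Pair) (auto simp: Un_commute)
  have \<phi>W: "\<phi> x \<in> ?W" if "x \<in> A \<union> B" for x
    using that HA[of 1 x] HB[of 1 x] H1[of x] q by (auto simp: \<phi>_def)
  have c\<psi>: "continuous_on ?W \<psi>"
    unfolding \<psi>_def
    by (intro continuous_on_coordinatewise_then_product continuous_intros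
        continuous_on_product_then_coordinatewise[OF continuous_on_fst[OF continuous_on_id]]
        continuous_on_product_then_coordinatewise[OF continuous_on_snd[OF continuous_on_id]])
  have \<psi>: "\<psi> (x, q) = x" "\<psi> (q, x) = x" for x by (auto simp: \<psi>_def)
  have \<psi>X: "\<psi> p \<in> A \<union> B" if "p \<in> ?W" for p
    using that \<psi> by (cases p) auto
  have \<psi>\<phi>: "\<psi> (\<phi> x) = H 1 x" if "x \<in> A \<union> B" for x
    using that H1[of x] by (auto simp: \<phi>_def \<psi>)
  have \<phi>\<psi>: "\<phi> (\<psi> p) = (H 1 (fst p), H 1 (snd p))" if "p \<in> ?W" for p
    using that q H1 Hq[of 1] by (auto simp: \<phi>_def \<psi>)
  show ?thesis
    unfolding W homotopy_equivalent_space_def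
  proof (intro exI conjI)
    show "continuous_map (top_of_set (A \<union> B)) (top_of_set ?W) \<phi>"
      using c\<phi> \<phi>W by auto
    show "continuous_map (top_of_set ?W) (top_of_set (A \<union> B)) \<psi>"
      using c\<psi> \<psi>X by auto
    show "homotopic_with (\<lambda>x. True) (top_of_set (A \<union> B)) (top_of_set (A \<union> B)) (\<psi> \<circ> \<phi>) id"
      by (rule homotopic_with_symD, rule homotopic_with_top_of_set[where h = H])
        (use cont HA HB H0 \<psi>\<phi> in auto)
    have "continuous_on ({0..1} \<times> ?W) (\<lambda>p. (H (fst p) (fst (snd p)), H (fst p) (snd (snd p))))"
      using q by (intro continuous_on_Pair cH continuous_intros) auto
    then show "homotopic_with (\<lambda>x. True) (top_of_set ?W) (top_of_set ?W) (\<phi> \<circ> \<psi>) id"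
      by (intro homotopic_with_symD[OF homotopic_with_top_of_set[where h = "\<lambda>t p. (H t (fst p), H t (snd p))"]])
        (use q HA HB H0 Hq \<phi>\<psi> in auto)
  qed
qed

text \<open>The complex consists of three cones over the common base \<open>indep_complex U M\<close>. The homotopy pushes
  the base into the cone at \<open>q\<close> and contracts that cone to \<open>q\<close>, while stretching the other
  two. With \<open>s = f q - f p - f r\<close> it is \<open>s \<mapsto> s + t (1 - \<bar>s\<bar>)\<close>, and the coordinates on \<open>U\<close> are
  rescaled by the factor \<open>c\<close> that keeps the total mass equal to \<open>1\<close>.\<close>

proposition three_cones_equivalent_wedge:
  fixes U :: "'a set"
  assumes U: "finite U" "p \<notin> U" "q \<notin> U" "r \<notin> U" and ne: "p \<noteq> q" "p \<noteq> r" "q \<noteq> r"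
    and M: "\<And>e. e \<in> M \<Longrightarrow> e \<subseteq> U" "{} \<notin> M"
  defines "A \<equiv> realization_points (indep_complex ({p, q} \<union> U) (insert {p, q} M))"
    and "B \<equiv> realization_points (indep_complex ({r, q} \<union> U) (insert {r, q} M))"
    and "\<delta> \<equiv> \<lambda>x. of_bool (x = q)"
  shows "geometric_realization (indep_complex ({p, q, r} \<union> U) ({{p, q}, {q, r}, {p, r}} \<union> M))
    homotopy_equivalent_space wedge (top_of_set A) \<delta> (top_of_set B) \<delta>"
proof -
  \<comment> \<open>The apex \<open>p\<close> is an argument because \<open>A\<close> and
    \<open>B\<close> differ only in it; \<open>Q p\<close> and \<open>Q r\<close> are then treated
    by one computation.\<close>
  define Q where "Q p f \<longleftrightarrow> (\<forall>x. 0 \<le> f x) \<and> (\<forall>x. x \<notin> {p, q} \<union> U \<longrightarrow> f x = 0) \<and>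
      f p + f q + sum f U = 1 \<and> (f p = 0 \<or> f q = 0) \<and> (\<forall>e\<in>M. \<exists>x\<in>e. f x = (0::real))" for p f
  have A: "f \<in> A \<longleftrightarrow> Q p f" for f
    using U ne unfolding A_def Q_def by (subst realization_points_indep_complex) (auto simp: add.assoc)
  have B: "f \<in> B \<longleftrightarrow> Q r f" for f
    using U ne unfolding B_def Q_def by (subst realization_points_indep_complex) (auto simp: add.assoc)
  have AB: "realization_points (indep_complex ({p, q, r} \<union> U) ({{p, q}, {q, r}, {p, r}} \<union> M)) = A \<union> B"
  proof -
    have "f \<in> realization_points (indep_complex ({p, q, r} \<union> U) ({{p, q}, {q, r}, {p, r}} \<union> M))
        \<longleftrightarrow> Q p f \<or> Q r f" for f
    proof -
      have "sum f ({p, q, r} \<union> U) = f p + f q + f r + sum f U"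
        using U ne by (simp add: add.assoc)
      then have L: "f \<in> realization_points (indep_complex ({p, q, r} \<union> U) ({{p, q}, {q, r}, {p, r}} \<union> M))
          \<longleftrightarrow> (\<forall>x. 0 \<le> f x) \<and> (\<forall>x. x \<notin> {p, q, r} \<union> U \<longrightarrow> f x = 0) \<and> f p + f q + f r + sum f U = 1 \<and>
            (f p = 0 \<or> f q = 0) \<and> (f q = 0 \<or> f r = 0) \<and> (f p = 0 \<or> f r = 0) \<and> (\<forall>e\<in>M. \<exists>x\<in>e. f x = 0)"
        using U(1) by (subst realization_points_indep_complex) simp_all
      have "(\<forall>x. x \<notin> {p, q} \<union> U \<longrightarrow> f x = 0) \<longleftrightarrow> (\<forall>x. x \<notin> {p, q, r} \<union> U \<longrightarrow> f x = 0) \<and> f r = 0"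
        "(\<forall>x. x \<notin> {r, q} \<union> U \<longrightarrow> f x = 0) \<longleftrightarrow> (\<forall>x. x \<notin> {p, q, r} \<union> U \<longrightarrow> f x = 0) \<and> f p = 0"
        using U ne by auto
      then show ?thesis
        unfolding L Q_def by (simp only:) (metis add.commute add_0 add_0_right)
    qed
    then show ?thesis using A B by blast
  qed
  \<comment> \<open>\<open>1 - f p - f r\<close> is the mass on \<open>U\<close> if
    \<open>f q = 0\<close>, and it is 1 if \<open>f p = f r = 0\<close>. The arguments of
    \<open>min\<close> are the scaling factors for a nonpositive and a nonnegative new value of
    \<open>s\<close>, and the smaller one is the correct one. The bound 1/2 prevents a division by
    zero: for a smaller mass \<open>s\<close> is still negative at time 1, and \<open>min\<close>
    selects \<open>1 + t\<close> in any case.\<close>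
  define c where "c t f = min (1 + t) (2 / max (1 - f p - f r) (1 / 2) - 1 - t)" for t :: real and f :: "'a \<Rightarrow> real"
  \<comment> \<open>The mass on \<open>U\<close> is \<open>1 - \<bar>s\<bar>\<close>. The coordinate
    at \<open>q\<close> is the positive part of the new \<open>s\<close>; the negative part goes to
    whichever of \<open>p\<close> and \<open>r\<close> carried mass before, the other one staying at
    0.\<close>
  define H where "H t f = (\<lambda>x. if x = p then max 0 (f p - t * (1 - f p))
      else if x = r then max 0 (f r - t * (1 - f r))
      else if x = q then max 0 (f q - f p - f r + t * (1 - f p - f q - f r))
      else c t f * f x)" for t and f :: "'a \<Rightarrow> real"
  have sumH: "sum (H t f) U = c t f * sum f U" for t f
    unfolding sum_distrib_left by (intro sum.cong) (use U in \<open>auto simp: H_def\<close>)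
  have HM: "\<exists>x\<in>e. H t f x = 0" if "e \<in> M" "\<exists>x\<in>e. f x = 0" for e t f
    using that M(1)[OF that(1)] U by (auto simp: H_def)
  \<comment> \<open>\<open>o'\<close> is the apex, other than \<open>q\<close>, of the part that
    contains \<open>f\<close>, and \<open>o''\<close> is the remaining one, where \<open>f\<close>
    vanishes.\<close>
  have HQ: "Q o' (H t f)" if t: "t \<in> {0..1}" and f: "Q o' f" and o: "o' = p \<and> o'' = r \<or> o' = r \<and> o'' = p"
    for t f o' o''
  proof -
    have f0: "f o'' = 0" using f o U ne by (auto simp: Q_def)
    let ?\<rho> = "sum f U"
    have nn: "0 \<le> f x" for x using f by (simp add: Q_def)
    have \<rho>: "0 \<le> ?\<rho>" "f o' + f q + ?\<rho> = 1" using f by (auto simp: Q_def sum_nonneg)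
    have pr: "f p + f r = f o'" using f0 o by auto
    have pr': "1 - f p - f r = 1 - f o'" using pr by linarith
    have Ho': "H t f o' = max 0 (f o' - t * (1 - f o'))" using o ne by (auto simp: H_def)
    have Ho'': "H t f o'' = 0" using o ne f0 t by (auto simp: H_def)
    have Hq: "H t f q = max 0 (f q - f o' + t * ?\<rho>)"
    proof -
      have "f q - f p - f r = f q - f o'" "1 - f p - f q - f r = ?\<rho>" using pr \<rho>(2) by linarith+
      then show ?thesis using ne by (simp add: H_def)
    qed
    have main: "0 \<le> c t f \<and> H t f o' + H t f q + c t f * ?\<rho> = 1 \<and> (H t f o' = 0 \<or> H t f q = 0)"
    proof (cases "f o' = 0")
      case True
      then have "c t f = 1 - t" using t by (simp add: c_def pr')
      moreover have "H t f o' = 0" using True t by (simp add: Ho')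
      moreover have "H t f q = f q + t * ?\<rho>" using True t \<rho>(1) nn[of q] by (simp add: Hq)
      moreover have "f q + t * ?\<rho> + (1 - t) * ?\<rho> = f q + ?\<rho>" by (simp add: algebra_simps)
      ultimately show ?thesis using t \<rho>(2) True by simp
    next
      case False
      then have q0: "f q = 0" using f by (auto simp: Q_def)
      then have fo: "f o' = 1 - ?\<rho>" using \<rho>(2) by linarith
      then have ce: "c t f = min (1 + t) (2 / max ?\<rho> (1 / 2) - 1 - t)" by (simp add: c_def pr')
      have \<rho>1: "?\<rho> \<le> 1" using fo nn[of o'] by linarith
      \<comment> \<open>Here \<open>s\<close> starts at \<open>?\<rho> - 1\<close> and has become
        \<open>(1 + t) * ?\<rho> - 1\<close>; the cases are whether it has passed 0.\<close>
      show ?thesis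
      proof (cases "(1 + t) * ?\<rho> \<le> 1")
        case True
        have "(1 + t) * max ?\<rho> (1 / 2) \<le> 1" using True t by (auto simp: max_def)
        then have "1 + t \<le> 1 / max ?\<rho> (1 / 2)" by (simp add: pos_le_divide_eq)
        moreover have "2 / max ?\<rho> (1 / 2) = 2 * (1 / max ?\<rho> (1 / 2))" by simp
        ultimately have "c t f = 1 + t" unfolding ce by (intro min_absorb1) linarith
        moreover have "H t f q = 0" using True by (simp add: Hq q0 fo algebra_simps)
        moreover have "H t f o' = 1 - ?\<rho> - t * ?\<rho>" using True by (simp add: Ho' fo algebra_simps)
        ultimately show ?thesis using t by (simp add: algebra_simps)
      next
        case False
        have "(1 + t) * ?\<rho> \<le> 2 * ?\<rho>" using t \<rho>(1) by (intro mult_right_mono) auto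
        then have half: "?\<rho> > 1 / 2" using False by linarith
        have "1 / ?\<rho> < 1 + t" using False half by (simp add: pos_divide_less_eq)
        moreover have "2 / ?\<rho> = 2 * (1 / ?\<rho>)" by simp
        ultimately have c: "c t f = 2 / ?\<rho> - 1 - t"
          unfolding ce using half by (simp add: max_absorb1 min_absorb2)
        have "(1 + t) * ?\<rho> \<le> 2" using \<open>(1 + t) * ?\<rho> \<le> 2 * ?\<rho>\<close> \<rho>1 by linarith
        then have "1 + t \<le> 2 / ?\<rho>" using half by (simp add: pos_le_divide_eq)
        then have "0 \<le> c t f" by (simp add: c)
        moreover have "H t f o' = 0" using False by (simp add: Ho' fo algebra_simps)
        moreover have "H t f q = (1 + t) * ?\<rho> - 1" using False by (simp add: Hq q0 fo algebra_simps)
        moreover have "c t f * ?\<rho> = 2 - (1 + t) * ?\<rho>" using half by (simp add: c field_simps)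
        ultimately show ?thesis by simp
      qed
    qed
    have "0 \<le> H t f x" for x using main nn[of x] by (simp add: H_def)
    moreover have "H t f x = 0" if "x \<notin> {o', q} \<union> U" for x
    proof (cases "x = o''")
      case False
      then have "x \<noteq> p" "x \<noteq> r" "x \<noteq> q" "f x = 0" using that o f by (auto simp: Q_def)
      then show ?thesis by (simp add: H_def)
    qed (simp add: Ho'')
    moreover have "\<exists>x\<in>e. H t f x = 0" if "e \<in> M" for e
      using that HM[OF that] f by (simp add: Q_def)
    ultimately show ?thesis
      using main unfolding Q_def sumH by (intro conjI allI impI ballI) simp_all
  qed
  have "top_of_set (A \<union> B) homotopy_equivalent_space wedge (top_of_set A) \<delta> (top_of_set B) \<delta>"
  proof (rule union_equivalent_wedge[where H = H])
    have co: "continuous_on S (\<lambda>f. f x)" for S :: "('a \<Rightarrow> real) set" and x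
      by (rule continuous_on_product_then_coordinatewise) (rule continuous_on_id)
    have "A = (A \<union> B) \<inter> (\<lambda>f. f r) -` {0}" "B = (A \<union> B) \<inter> (\<lambda>f. f p) -` {0}"
      using U ne by (auto simp: A B Q_def)
    with co show "closedin (top_of_set (A \<union> B)) A" "closedin (top_of_set (A \<union> B)) B"
      by (metis closed_singleton continuous_closedin_preimage)+
    have "sum \<delta> U = 0" using U by (auto simp: \<delta>_def intro!: sum.neutral)
    moreover have "\<exists>x\<in>e. \<delta> x = 0" if "e \<in> M" for e
    proof -
      have "\<exists>x. x \<in> e" using that M(2) by (metis ex_in_conv)
      then show ?thesis using M(1)[OF that] U by (auto simp: \<delta>_def)
    qed
    ultimately show "\<delta> \<in> A \<inter> B"
      using U ne by (auto simp: A B Q_def \<delta>_def)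
    have cp: "continuous_on S (\<lambda>p. snd p x)" for S :: "(real \<times> ('a \<Rightarrow> real)) set" and x
      by (rule continuous_on_product_then_coordinatewise) (intro continuous_intros)
    have cif: "continuous_on S (\<lambda>z. if P then f z else g z)"
      if "continuous_on S f" "continuous_on S g" for S P and f g :: "real \<times> ('a \<Rightarrow> real) \<Rightarrow> real"
      using that by (cases P) simp_all
    show "continuous_on ({0..1} \<times> (A \<union> B)) (\<lambda>p. H (fst p) (snd p))"
      unfolding H_def
    proof (rule continuous_on_coordinatewise_then_product)
      show "continuous_on ({0..1} \<times> (A \<union> B)) (\<lambda>z. if x = p then max 0 (snd z p - fst z * (1 - snd z p))
      else if x = r then max 0 (snd z r - fst z * (1 - snd z r))
      else if x = q then max 0 (snd z q - snd z p - snd z r + fst z * (1 - snd z p - snd z q - snd z r))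
      else c (fst z) (snd z) * snd z x)" for x
        unfolding c_def by (intro cif continuous_intros cp) auto
    qed
    show "H t f \<in> A" if "t \<in> {0..1}" "f \<in> A" for t f using that HQ A by blast
    show "H t f \<in> B" if "t \<in> {0..1}" "f \<in> B" for t f using that HQ B by blast
    show "H 0 f = f" if fAB: "f \<in> A \<union> B" for f
    proof -
      have f: "\<forall>x. 0 \<le> f x" "f p = 0 \<or> f r = 0" "f p + f r > 0 \<Longrightarrow> f q = 0" "f p \<le> 1" "f r \<le> 1"
      proof -
        consider "Q p f" "f r = 0" | "Q r f" "f p = 0"
          using fAB U ne by (auto simp: A B Q_def)
        then have main: "(\<forall>x. 0 \<le> f x) \<and> (f p = 0 \<or> f r = 0) \<and> (f p + f r > 0 \<longrightarrow> f q = 0)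
            \<and> f p + f q + f r + sum f U = 1"
        proof cases
          case 1
          then have "f p = 0 \<or> f q = 0" "\<forall>x. 0 \<le> f x" "f p + f q + sum f U = 1" by (simp_all add: Q_def)
          with 1(2) show ?thesis by (elim disjE) simp_all
        next
          case 2
          then have "f r = 0 \<or> f q = 0" "\<forall>x. 0 \<le> f x" "f r + f q + sum f U = 1" by (simp_all add: Q_def)
          with 2(2) show ?thesis by (elim disjE) (simp_all add: add.commute)
        qed
        then have "0 \<le> sum f U" "0 \<le> f p" "0 \<le> f q" "0 \<le> f r" by (simp_all add: sum_nonneg)
        then have "f p \<le> 1" "f r \<le> 1" using main by linarith+
        with main show "\<forall>x. 0 \<le> f x" "f p = 0 \<or> f r = 0" "f p + f r > 0 \<Longrightarrow> f q = 0" "f p \<le> 1" "f r \<le> 1"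
          by simp_all
      qed
      have "max (1 - f p - f r) (1 / 2) \<le> 1" using f by auto
      then have "2 / max (1 - f p - f r) (1 / 2) \<ge> 2" by (simp add: pos_le_divide_eq)
      then have "c 0 f = 1" by (simp add: c_def)
      moreover have "max 0 (f q - f p - f r) = f q"
      proof -
        have "0 \<le> f p" "0 \<le> f q" "0 \<le> f r" using f(1) by simp_all
        then show ?thesis using f(3) by linarith
      qed
      ultimately show ?thesis using f(1) by (simp add: H_def fun_eq_iff max_def)
    qed
    show "H 1 f = \<delta>" if "f \<in> A \<inter> B" for f
    proof -
      have f: "f p = 0" "f r = 0" "0 \<le> f q" using that U ne by (auto simp: A B Q_def)
      then have "c 1 f = 0" by (simp add: c_def)
      with f ne show ?thesis by (auto simp: H_def \<delta>_def fun_eq_iff)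
    qed
    show "H t \<delta> = \<delta>" if "t \<in> {0..1}" for t
      using ne that by (auto simp: H_def \<delta>_def fun_eq_iff)
  qed
  then show ?thesis unfolding geometric_realization_eq AB .
qed

section \<open>Matchings, edge moves and folds\<close>

definition matching :: "'a set set \<Rightarrow> bool" where
  "matching M \<longleftrightarrow> finite M \<and> (\<forall>e\<in>M. card e = 2) \<and> pairwise disjnt M"

lemma matching_insert:
  "matching M \<Longrightarrow> a \<noteq> b \<Longrightarrow> a \<notin> \<Union>M \<Longrightarrow> b \<notin> \<Union>M \<Longrightarrow> matching (insert {a, b} M)"
  by (auto simp: matching_def pairwise_insert disjnt_def)

lemma finite_Union_matching: "matching M \<Longrightarrow> finite (\<Union>M)"
  unfolding matching_def by (intro finite_Union) (auto intro: card_ge_0_finite)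

text \<open>The edge \<open>{p, q}\<close> is separated from \<open>M\<close> because its vertex
  \<open>q\<close> has to land on the base point. There are \<open>card M + 1\<close> edges, one for
  each coordinate of the ambient space of the \<open>card M\<close>-sphere.\<close>

lemma matching_homeomorphic_nsphere_pointed:
  assumes M: "matching M" and pq: "p \<noteq> q" "p \<notin> \<Union>M" "q \<notin> \<Union>M"
  shows "\<exists>f g. homeomorphic_maps (geometric_realization (indep_complex ({p, q} \<union> \<Union>M) (insert {p, q} M)))
    (nsphere (card M)) f g \<and> f (\<lambda>x. of_bool (x = q)) = sphere_basepoint"
proof -
  let ?k = "card M" and ?M = "insert {p, q} M"
  obtain h where h: "bij_betw h {0..<?k} M"
    using M ex_bij_betw_nat_finite by (auto simp: matching_def)
  define e where "e i = (case i of 0 \<Rightarrow> {p, q} | Suc j \<Rightarrow> h j)" for i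
  have hM: "h j \<in> M" if "j < ?k" for j
    using h that by (auto simp: bij_betw_def)
  have eM: "e ` {..?k} = ?M"
  proof -
    have "{..?k} = insert 0 (Suc ` {..<?k})"
      by (metis lessThan_Suc_atMost lessThan_Suc_eq_insert_0)
    then have "e ` {..?k} = insert {p, q} (h ` {..<?k})"
      by (simp only: image_insert image_image) (simp add: e_def)
    then show ?thesis using h by (simp add: bij_betw_def atLeast0LessThan)
  qed
  have disj: "e i \<inter> e j = {}" if "i \<le> ?k" "j \<le> ?k" "i \<noteq> j" for i j
  proof -
    have "h i' \<inter> h j' = {}" if "i' < ?k" "j' < ?k" "i' \<noteq> j'" for i' j'
    proof -
      have "h i' \<noteq> h j'" using h that by (auto simp: bij_betw_def inj_on_def)
      with hM[OF that(1)] hM[OF that(2)] M show ?thesis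
        by (simp add: matching_def pairwise_def disjnt_def)
    qed
    then show ?thesis
      using that hM pq by (auto simp: e_def split: nat.splits)
  qed
  have "\<forall>i\<in>{..?k}. \<exists>x y. e i = {x, y} \<and> x \<noteq> y"
  proof
    fix i assume "i \<in> {..?k}"
    then have "e i \<in> ?M" using eM by blast
    then show "\<exists>x y. e i = {x, y} \<and> x \<noteq> y"
      using M pq by (auto simp: matching_def card_2_iff)
  qed
  then obtain a' b' where ab': "\<And>i. i \<le> ?k \<Longrightarrow> e i = {a' i, b' i} \<and> a' i \<noteq> b' i"
    by (metis atMost_iff)
  \<comment> \<open>The orientation of an edge is arbitrary except at index 0, where
    \<open>q\<close> has to be the positive unit vector.\<close>
  define a b where "a = a'(0 := q)" and "b = b'(0 := p)"
  have ab: "e i = {a i, b i}" "a i \<noteq> b i" if "i \<le> ?k" for i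
    using ab'[OF that] pq by (auto simp: a_def b_def e_def)
  have same: "i = j" if "i \<le> ?k" "j \<le> ?k" "x \<in> e i" "x \<in> e j" for i j x
    using disj[OF that(1,2)] that(3,4) by blast
  have "inj_on a {..?k}" "inj_on b {..?k}"
    by (auto intro!: inj_onI intro: same simp: ab)
  moreover have "a i \<noteq> b j" if "i \<le> ?k" "j \<le> ?k" for i j
    using same[OF that, of "a i"] ab that by auto
  ultimately obtain f g where
    "homeomorphic_maps (geometric_realization (indep_complex (a ` {..?k} \<union> b ` {..?k}) ((\<lambda>i. {a i, b i}) ` {..?k})))
      (nsphere ?k) f g" "f (\<lambda>x. of_bool (x = a 0)) = sphere_basepoint"
    using cross_polytope_homeomorphic_nsphere by blast
  moreover have "(\<lambda>i. {a i, b i}) ` {..?k} = ?M"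
    unfolding eM[symmetric] by (intro image_cong) (auto simp: ab)
  moreover have "a ` {..?k} \<union> b ` {..?k} = \<Union>?M"
    unfolding eM[symmetric] by (auto simp: ab)
  moreover have "a 0 = q" by (simp add: a_def)
  ultimately show ?thesis by auto
qed

text \<open>The empty matching has an empty realization, which is no sphere of dimension at least 0;
  nonemptiness must therefore be tracked through the stripping.\<close>

lemma matching_homotopy_sphere:
  assumes "matching M" "M \<noteq> {}"
  shows "homotopy_sphere_type (geometric_realization (indep_complex (\<Union>M) M))"
proof -
  obtain e where "e \<in> M" using assms by blast
  then obtain p q where pq: "{p, q} \<in> M" "p \<noteq> q"
    using assms(1) by (auto simp: matching_def card_2_iff)
  let ?N = "M - {{p, q}}"
  have "matching ?N" using assms(1) by (auto simp: matching_def pairwise_def)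
  moreover have "p \<notin> \<Union>?N" "q \<notin> \<Union>?N"
    using assms(1) pq(1) by (fastforce simp: matching_def pairwise_def disjnt_def)+
  ultimately obtain f g where
    "homeomorphic_maps (geometric_realization (indep_complex ({p, q} \<union> \<Union>?N) (insert {p, q} ?N))) (nsphere (card ?N)) f g"
    using matching_homeomorphic_nsphere_pointed[of ?N p q] pq(2) by blast
  moreover have "insert {p, q} ?N = M" "{p, q} \<union> \<Union>?N = \<Union>M" using pq(1) by auto
  ultimately show ?thesis
    unfolding homotopy_sphere_type_def
    using homeomorphic_imp_homotopy_equivalent_space homeomorphic_space_def by metis
qed

text \<open>The cones at \<open>p\<close> and \<open>q\<close> form the boundary of one cross
  polytope and those at \<open>r\<close> and \<open>q\<close> that of another; the two spheres meet
  in the contractible cone at \<open>q\<close>.\<close>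

lemma triangle_homotopy_double_sphere:
  assumes M: "matching M" and ne: "p \<noteq> q" "p \<noteq> r" "q \<noteq> r"
    and nM: "p \<notin> \<Union>M" "q \<notin> \<Union>M" "r \<notin> \<Union>M"
  shows "homotopy_double_sphere_type
    (geometric_realization (indep_complex ({p, q, r} \<union> \<Union>M) ({{p, q}, {q, r}, {p, r}} \<union> M)))"
proof -
  let ?A = "realization_points (indep_complex ({p, q} \<union> \<Union>M) (insert {p, q} M))"
  let ?B = "realization_points (indep_complex ({r, q} \<union> \<Union>M) (insert {r, q} M))"
  let ?d = "\<lambda>x. of_bool (x = q) :: real"
  have M0: "{} \<notin> M" using M by (auto simp: matching_def)
  have 1: "geometric_realization (indep_complex ({p, q, r} \<union> \<Union>M) ({{p, q}, {q, r}, {p, r}} \<union> M))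
      homotopy_equivalent_space wedge (top_of_set ?A) ?d (top_of_set ?B) ?d"
    using finite_Union_matching[OF M] nM ne M0 by (intro three_cones_equivalent_wedge) auto
  obtain f f' where f: "homeomorphic_maps (top_of_set ?A) (nsphere (card M)) f f'" "f ?d = sphere_basepoint"
    using matching_homeomorphic_nsphere_pointed[OF M ne(1) nM(1,2)]
    unfolding geometric_realization_eq by blast
  obtain g g' where g: "homeomorphic_maps (top_of_set ?B) (nsphere (card M)) g g'" "g ?d = sphere_basepoint"
    using matching_homeomorphic_nsphere_pointed[OF M ne(3)[symmetric] nM(3,2)]
    unfolding geometric_realization_eq by blast
  have d: "?d \<in> realization_points (indep_complex ({x, q} \<union> \<Union>M) (insert {x, q} M))" if "x \<noteq> q" for x
  proof -
    let ?W = "{x, q} \<union> \<Union>M"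
    have fin: "finite ?W" using finite_Union_matching[OF M] by simp
    have "\<exists>y\<in>e. ?d y = 0" if e: "e \<in> M" for e
    proof -
      obtain y where "y \<in> e" using e M0 by (metis ex_in_conv)
      moreover have "y \<noteq> q" using calculation e nM by blast
      ultimately show ?thesis by auto
    qed
    moreover have "sum ?d ?W = 1"
      using fin by (simp add: of_bool_def)
    ultimately show ?thesis
      unfolding realization_points_indep_complex[OF fin] using that by simp
  qed
  have "wedge (top_of_set ?A) ?d (top_of_set ?B) ?d homeomorphic_space double_sphere (card M)"
    using wedge_homeomorphic[OF f(1) g(1), of ?d ?d] d[OF ne(1)] d[OF ne(3)[symmetric]] f(2) g(2) by simp
  with 1 show ?thesis
    unfolding homotopy_double_sphere_type_def
    using homeomorphic_imp_homotopy_equivalent_space homotopy_eqv_trans by blast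
qed

text \<open>Both the addition of an edge and the deletion of a vertex \<open>v\<close> (take \<open>s = {v}\<close>) are instances.\<close>

lemma indep_complex_insert_equivalent:
  assumes "finite W" "s \<noteq> {}" "finite s" "w \<in> W" "w \<notin> s"
    and nbr: "\<And>e. e \<in> F \<Longrightarrow> w \<in> e \<Longrightarrow> \<exists>y\<in>e. y \<noteq> w \<and> (\<exists>e'\<in>F. e' \<subseteq> insert y s)"
  shows "geometric_realization (indep_complex W F) homotopy_equivalent_space
    geometric_realization (indep_complex W (insert s F))"
proof -
  have "indep_complex W (insert s F) = {A \<in> indep_complex W F. \<not> s \<subseteq> A}"
    by (auto simp: indep_complex_def)
  \<comment> \<open>By \<open>nbr\<close>, a face containing \<open>s\<close> contains no neighbour
    of \<open>w\<close> and can therefore be enlarged by \<open>w\<close>. This is the cone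
    condition of the collapse.\<close>
  moreover have "insert w A \<in> indep_complex W F" if A: "A \<in> indep_complex W F" "s \<subseteq> A" for A
  proof -
    have "\<not> e \<subseteq> insert w A" if e: "e \<in> F" for e
    proof
      assume sub: "e \<subseteq> insert w A"
      show False
      proof (cases "w \<in> e")
        case True
        then obtain y e' where y: "y \<in> e" "y \<noteq> w" "e' \<in> F" "e' \<subseteq> insert y s"
          using nbr e by blast
        then have "e' \<subseteq> A" using sub A(2) by blast
        with y(3) A(1) show False by (auto simp: indep_complex_def)
      next
        case False
        with sub e A(1) show False by (auto simp: indep_complex_def)
      qed
    qed
    then show ?thesis using A(1) assms(4) by (auto simp: indep_complex_def)
  qed
  moreover have "finite A" if "A \<in> indep_complex W F" for A
    using that assms(1) by (auto simp: indep_complex_def intro: finite_subset)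
  moreover have "B \<in> indep_complex W F" if "A \<in> indep_complex W F" "B \<subseteq> A" for A B
    using that unfolding indep_complex_def mem_Collect_eq by (meson order_trans)
  ultimately show ?thesis
    using collapse_homotopy_equivalent[of "indep_complex W F" s w] assms(2,3,5) by simp
qed

lemma indep_complex_delete_vertex:
  "indep_complex W (insert {v} F) = indep_complex (W - {v}) F"
  by (auto simp: indep_complex_def)

text \<open>The fold lemma: every neighbour of \<open>w\<close> is a neighbour of \<open>v\<close>,
  so a face through \<open>v\<close> can always take in \<open>w\<close>, and all faces through
  \<open>v\<close> collapse away.\<close>

lemma indep_complex_fold:
  assumes "finite W" "w \<in> W" "w \<noteq> v"
    and nbr: "\<And>e. e \<in> F \<Longrightarrow> w \<in> e \<Longrightarrow> \<exists>y\<in>e. y \<noteq> w \<and> {y, v} \<in> F"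
  shows "geometric_realization (indep_complex W F) homotopy_equivalent_space
    geometric_realization (indep_complex (W - {v}) F)"
proof -
  have "geometric_realization (indep_complex W F) homotopy_equivalent_space
      geometric_realization (indep_complex W (insert {v} F))"
    using assms by (intro indep_complex_insert_equivalent[where w = w]) (auto, blast)
  then show ?thesis by (simp only: indep_complex_delete_vertex)
qed

lemma indep_complex_contractible:
  assumes "finite W" "w \<in> W" "w \<notin> \<Union>F"
  shows "contractible_space (geometric_realization (indep_complex W F))"
proof (rule cone_contractible[where w = w])
  show "insert w A \<in> indep_complex W F" if A: "A \<in> indep_complex W F" for A
  proof -
    have "\<not> e \<subseteq> insert w A" if "e \<in> F" for e
    proof -
      have "w \<notin> e" "\<not> e \<subseteq> A" using that A assms(3) by (auto simp: indep_complex_def)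
      then show ?thesis by (simp add: subset_insert)
    qed
    then show ?thesis using A assms(2) by (simp add: indep_complex_def)
  qed
  show "finite A" if "A \<in> indep_complex W F" for A
    using that assms(1) by (auto simp: indep_complex_def intro: finite_subset)
  show "B \<in> indep_complex W F" if "A \<in> indep_complex W F" "B \<subseteq> A" for A B
    using that unfolding indep_complex_def mem_Collect_eq by (meson order_trans)
qed

lemma indep_complex_cong:
  assumes "\<And>e. e \<subseteq> W \<Longrightarrow> e \<in> F \<longleftrightarrow> e \<in> F'"
  shows "indep_complex W F = indep_complex W F'"
  using assms unfolding indep_complex_def by (intro Collect_cong) (metis order_trans)

section \<open>Cycles\<close>

fun path_edges :: "'a list \<Rightarrow> 'a set set" where
  "path_edges (x # y # zs) = insert {x, y} (path_edges (y # zs))"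
| "path_edges _ = {}"

text \<open>For two vertices the closing edge coincides with the path edge. This degenerate cycle is
  the single edge into which a 5-cycle is shortened.\<close>

definition cycle_edges :: "'a list \<Rightarrow> 'a set set" where
  "cycle_edges vs = insert {last vs, hd vs} (path_edges vs)"

lemma path_edges_subset: "e \<in> path_edges vs \<Longrightarrow> e \<subseteq> set vs"
  by (induction vs rule: path_edges.induct) auto

lemma indep_complex_insert_irrelevant:
  "\<not> s \<subseteq> W \<Longrightarrow> indep_complex W (insert s F) = indep_complex W F"
  unfolding indep_complex_def by (intro Collect_cong) (metis insert_iff order_trans)

text \<open>Let \<open>a\<close>, \<open>b\<close>, \<open>c\<close>, \<open>d\<close>, \<open>e\<close> be consecutive on the cycle. Adding \<open>ae\<close>, deleting \<open>ab\<close> and \<open>de\<close> and folding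
  \<open>d\<close> onto \<open>b\<close> separates the edge \<open>bc\<close> from a cycle that is shorter by three.\<close>

lemma cycle_shorten:
  assumes dist: "distinct (b # c # d # us)" and len: "length us \<ge> 2"
    and N: "matching N" "set (b # c # d # us) \<inter> \<Union>N = {}"
  shows "geometric_realization (indep_complex (set (b # c # d # us) \<union> \<Union>N) (cycle_edges (b # c # d # us) \<union> N))
    homotopy_equivalent_space
    geometric_realization (indep_complex (set us \<union> \<Union>(insert {b, c} N)) (cycle_edges us \<union> insert {b, c} N))"
proof -
  let ?W = "set (b # c # d # us) \<union> \<Union>N"
  let ?R = "\<lambda>F. geometric_realization (indep_complex ?W F)"
  obtain e u vs where us: "us = e # u # vs"
    using len by (metis (no_types, lifting) One_nat_def Suc_1 Suc_le_length_iff)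
  define a where "a = last us"
  have a: "a \<in> set us" "a \<noteq> e" and e: "e \<in> set us"
    using dist us by (auto simp: a_def)
  define P where "P = path_edges us \<union> N"
  have notP: "x \<notin> g" if "g \<in> P" "x \<in> {b, c, d}" for g x
    using that path_edges_subset[of g us] N(2) dist unfolding P_def by fastforce
  have fin: "finite ?W" using N(1) by (simp add: finite_Union_matching)
  define F1 where "F1 = {{b, c}, {c, d}, {a, e}} \<union> P"
  have ne: "b \<noteq> c" "b \<noteq> d" "c \<noteq> d" "a \<noteq> b" "a \<noteq> c" "a \<noteq> d" "e \<noteq> b" "e \<noteq> c" "e \<noteq> d"
    using dist a e by auto
  have F0: "cycle_edges (b # c # d # us) \<union> N = {{b, c}, {c, d}, {d, e}, {a, b}} \<union> P"
    using us by (auto simp: cycle_edges_def P_def a_def)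
  \<comment> \<open>The neighbours \<open>b\<close> and \<open>d\<close> of \<open>c\<close> are
    excluded by \<open>a\<close> and \<open>e\<close>, through the edges \<open>ab\<close> and
    \<open>de\<close>.\<close>
  have 1: "?R ({{b, c}, {c, d}, {d, e}, {a, b}} \<union> P)
      homotopy_equivalent_space ?R (insert {a, e} ({{b, c}, {c, d}, {d, e}, {a, b}} \<union> P))"
  proof (rule indep_complex_insert_equivalent[where w = c])
    fix g assume g: "g \<in> {{b, c}, {c, d}, {d, e}, {a, b}} \<union> P" "c \<in> g"
    then consider "g = {b, c}" | "g = {c, d}" using notP ne by blast
    then show "\<exists>y\<in>g. y \<noteq> c \<and> (\<exists>e'\<in>{{b, c}, {c, d}, {d, e}, {a, b}} \<union> P. e' \<subseteq> insert y {a, e})"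
      using ne by cases auto
  qed (use fin ne in auto)
  \<comment> \<open>A deletion is proved as an addition read backwards. The neighbours of
    \<open>d\<close> are \<open>c\<close>, excluded by \<open>b\<close>, and \<open>e\<close>,
    excluded by \<open>a\<close> only because \<open>ae\<close> is now present.\<close>
  have 2: "?R (insert {d, e} F1) homotopy_equivalent_space ?R (insert {a, b} (insert {d, e} F1))"
  proof (rule indep_complex_insert_equivalent[where w = d])
    fix g assume g: "g \<in> insert {d, e} F1" "d \<in> g"
    then consider "g = {c, d}" | "g = {d, e}" using notP ne by (auto simp: F1_def)
    then show "\<exists>y\<in>g. y \<noteq> d \<and> (\<exists>e'\<in>insert {d, e} F1. e' \<subseteq> insert y {a, b})"
      using ne by cases (auto simp: F1_def)
  qed (use fin ne in auto)
  \<comment> \<open>Without \<open>ab\<close> the only neighbour of \<open>b\<close> is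
    \<open>c\<close>, which \<open>d\<close> excludes.\<close>
  have 3: "?R F1 homotopy_equivalent_space ?R (insert {d, e} F1)"
  proof (rule indep_complex_insert_equivalent[where w = b])
    fix g assume g: "g \<in> F1" "b \<in> g"
    then have "g = {b, c}" using notP ne by (auto simp: F1_def)
    then show "\<exists>y\<in>g. y \<noteq> b \<and> (\<exists>e'\<in>F1. e' \<subseteq> insert y {d, e})"
      using ne by (auto simp: F1_def)
  qed (use fin ne in auto)
  have 4: "?R F1 homotopy_equivalent_space geometric_realization (indep_complex (?W - {d}) F1)"
  proof (rule indep_complex_fold[where w = b])
    fix g assume g: "g \<in> F1" "b \<in> g"
    then have "g = {b, c}" using notP ne by (auto simp: F1_def)
    then show "\<exists>y\<in>g. y \<noteq> b \<and> {y, d} \<in> F1"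
      using ne by (auto simp: F1_def)
  qed (use fin ne in auto)
  have W': "indep_complex (?W - {d}) F1 = indep_complex (?W - {d}) (cycle_edges us \<union> insert {b, c} N)"
  proof -
    have "F1 = insert {c, d} (cycle_edges us \<union> insert {b, c} N)"
      using us unfolding F1_def P_def cycle_edges_def a_def by (simp add: insert_commute Un_assoc)
    then show ?thesis by (simp add: indep_complex_insert_irrelevant)
  qed
  have "?W - {d} = set us \<union> \<Union>(insert {b, c} N)"
    using dist N(2) by auto
  with W' have W: "indep_complex (?W - {d}) F1
      = indep_complex (set us \<union> \<Union>(insert {b, c} N)) (cycle_edges us \<union> insert {b, c} N)"
    by simp
  have eq: "insert {a, e} ({{b, c}, {c, d}, {d, e}, {a, b}} \<union> P) = insert {a, b} (insert {d, e} F1)"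
    by (auto simp: F1_def)
  show ?thesis
    unfolding F0 W[symmetric]
    using 1 2 3 4 unfolding eq
    by (meson homotopy_equivalent_space_sym homotopy_eqv_trans)
qed

text \<open>In \<open>cycle_shorten\<close> the vertices \<open>a\<close> and \<open>e\<close> would
  coincide. Instead \<open>d\<close> is folded onto the opposite vertex \<open>b\<close>, which has
  the same neighbours; then \<open>c\<close> and \<open>e\<close> are both leaves at
  \<open>b\<close>, and \<open>e\<close> is folded onto \<open>c\<close>.\<close>

lemma four_cycle_equivalent:
  assumes dist: "distinct [b, c, d, e]" and N: "matching N" "{b, c, d, e} \<inter> \<Union>N = {}"
  shows "geometric_realization (indep_complex ({b, c, d, e} \<union> \<Union>N) (cycle_edges [b, c, d, e] \<union> N))
    homotopy_equivalent_space
    geometric_realization (indep_complex (\<Union>(insert {b, c} N)) (insert {b, c} N))"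
proof -
  let ?W = "{b, c, d, e} \<union> \<Union>N" and ?F = "cycle_edges [b, c, d, e] \<union> N"
  have F: "?F = {{b, c}, {c, d}, {d, e}, {e, b}} \<union> N"
    by (auto simp: cycle_edges_def)
  have notN: "x \<notin> g" if "g \<in> N" "x \<in> {b, c, d, e}" for g x
    using that N(2) by blast
  have fin: "finite ?W" using N(1) by (simp add: finite_Union_matching)
  have 1: "geometric_realization (indep_complex ?W ?F) homotopy_equivalent_space
      geometric_realization (indep_complex (?W - {d}) ?F)"
    unfolding F
  proof (rule indep_complex_fold[where w = b])
    fix g assume g: "g \<in> {{b, c}, {c, d}, {d, e}, {e, b}} \<union> N" "b \<in> g"
    then consider "g = {b, c}" | "g = {e, b}" using notN dist by auto
    then show "\<exists>y\<in>g. y \<noteq> b \<and> {y, d} \<in> {{b, c}, {c, d}, {d, e}, {e, b}} \<union> N"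
      using dist by cases (auto simp: insert_commute)
  qed (use fin dist in auto)
  have 2: "indep_complex (?W - {d}) ?F = indep_complex (?W - {d}) ({{b, c}, {e, b}} \<union> N)"
    unfolding F by (intro indep_complex_cong) auto
  have 3: "geometric_realization (indep_complex (?W - {d}) ({{b, c}, {e, b}} \<union> N)) homotopy_equivalent_space
      geometric_realization (indep_complex (?W - {d} - {e}) ({{b, c}, {e, b}} \<union> N))"
  proof (rule indep_complex_fold[where w = c])
    fix g assume g: "g \<in> {{b, c}, {e, b}} \<union> N" "c \<in> g"
    then have "g = {b, c}" using notN dist by auto
    then show "\<exists>y\<in>g. y \<noteq> c \<and> {y, e} \<in> {{b, c}, {e, b}} \<union> N"
      using dist by (auto simp: insert_commute)
  qed (use fin dist in auto)
  have 4: "indep_complex (?W - {d} - {e}) ({{b, c}, {e, b}} \<union> N) = indep_complex (?W - {d} - {e}) (insert {b, c} N)"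
    by (intro indep_complex_cong) auto
  have 5: "?W - {d} - {e} = \<Union>(insert {b, c} N)"
    using dist N(2) by auto
  show ?thesis using homotopy_eqv_trans[OF 1[unfolded 2] 3] unfolding 4 unfolding 5 .
qed

lemma homotopy_sphere_type_equivalent:
  "X homotopy_equivalent_space Y \<Longrightarrow> homotopy_sphere_type Y \<Longrightarrow> homotopy_sphere_type X"
  unfolding homotopy_sphere_type_def using homotopy_eqv_trans by blast

lemma homotopy_double_sphere_type_equivalent:
  "X homotopy_equivalent_space Y \<Longrightarrow> homotopy_double_sphere_type Y \<Longrightarrow> homotopy_double_sphere_type X"
  unfolding homotopy_double_sphere_type_def using homotopy_eqv_trans by blast

text \<open>Shortening preserves the residue modulo 3. The base cases are the triangle, the 4-cycle
  and the 5-cycle, of which the last two end in a matching and hence in a sphere. \<open>N\<close>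
  is arbitrary because every shortening adds an edge to it.\<close>

proposition cycle_homotopy_type:
  assumes "distinct vs" "3 \<le> length vs" "matching N" "set vs \<inter> \<Union>N = {}"
  defines "X \<equiv> geometric_realization (indep_complex (set vs \<union> \<Union>N) (cycle_edges vs \<union> N))"
  shows "if length vs mod 3 = 0 then homotopy_double_sphere_type X else homotopy_sphere_type X"
  using assms(1-4) unfolding X_def
proof (induction "length vs" arbitrary: vs N rule: less_induct)
  case less
  obtain b c d us where vs: "vs = b # c # d # us"
    using less.prems(2) by (metis Suc_le_length_iff numeral_3_eq_3)
  have M: "matching (insert {b, c} N)"
    using less.prems vs by (intro matching_insert) auto
  consider "us = []" | e where "us = [e]" | e a where "us = [e, a]" | "length us \<ge> 3"
  proof -
    have "length us = 0 \<or> length us = 1 \<or> length us = 2 \<or> length us \<ge> 3" by linarith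
    then show ?thesis
      using that by (auto simp: length_Suc_conv numeral_2_eq_2)
  qed
  then show ?case
  proof cases
    case 1
    have "cycle_edges vs = {{b, c}, {c, d}, {b, d}}" "set vs = {b, c, d}"
      using 1 vs by (auto simp: cycle_edges_def)
    then show ?thesis
      using triangle_homotopy_double_sphere[OF less.prems(3), of b c d] less.prems vs 1 by simp
  next
    case (2 e)
    have "homotopy_sphere_type (geometric_realization (indep_complex (\<Union>(insert {b, c} N)) (insert {b, c} N)))"
      using M by (intro matching_homotopy_sphere) auto
    then show ?thesis
      using homotopy_sphere_type_equivalent[OF four_cycle_equivalent[of b c d e N]] less.prems vs 2 by simp
  next
    case (3 e a)
    have M2: "matching (insert {e, a} (insert {b, c} N))"
      using less.prems vs 3 by (intro matching_insert[OF M]) auto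
    have "set us \<union> \<Union>(insert {b, c} N) = \<Union>(insert {e, a} (insert {b, c} N))"
      "cycle_edges us \<union> insert {b, c} N = insert {e, a} (insert {b, c} N)"
      using 3 by (auto simp: cycle_edges_def)
    then have "homotopy_sphere_type
        (geometric_realization (indep_complex (set us \<union> \<Union>(insert {b, c} N)) (cycle_edges us \<union> insert {b, c} N)))"
      using matching_homotopy_sphere[OF M2] by simp
    moreover have "length vs mod 3 \<noteq> 0" using vs 3 by simp
    ultimately show ?thesis
      using homotopy_sphere_type_equivalent[OF cycle_shorten[of b c d us N]] less.prems vs 3 by simp
  next
    case 4
    let ?Y = "geometric_realization (indep_complex (set us \<union> \<Union>(insert {b, c} N)) (cycle_edges us \<union> insert {b, c} N))"
    have "set us \<inter> \<Union>(insert {b, c} N) = {}" using less.prems vs by auto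
    then have IH: "if length us mod 3 = 0 then homotopy_double_sphere_type ?Y else homotopy_sphere_type ?Y"
      using 4 M less.prems vs by (intro less.hyps) auto
    have eqv: "geometric_realization (indep_complex (set vs \<union> \<Union>N) (cycle_edges vs \<union> N)) homotopy_equivalent_space ?Y"
      using cycle_shorten[of b c d us N] less.prems vs 4 by simp
    have "length vs mod 3 = length us mod 3" using vs by simp
    then show ?thesis
      using IH homotopy_sphere_type_equivalent[OF eqv] homotopy_double_sphere_type_equivalent[OF eqv] by presburger
  qed
qed

section \<open>First Betti number and cycles of a graph\<close>

abbreviation adjacency :: "'a set set \<Rightarrow> ('a \<times> 'a) set" where
  "adjacency E \<equiv> {(x, y). {x, y} \<in> E}"

lemma sym_reachable: "(x, y) \<in> (adjacency E)\<^sup>* \<Longrightarrow> (y, x) \<in> (adjacency E)\<^sup>*"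
  by (rule symD[OF sym_rtrancl]) (auto simp: sym_def insert_commute)

lemma reachable_mono: "E \<subseteq> E' \<Longrightarrow> (adjacency E)\<^sup>* \<subseteq> (adjacency E')\<^sup>*"
  by (rule rtrancl_mono) auto

lemma component_of_eq_iff:
  "u \<in> V \<Longrightarrow> v \<in> V \<Longrightarrow> component_of V E u = component_of V E v \<longleftrightarrow> (u, v) \<in> (adjacency E)\<^sup>*"
proof
  assume uv: "u \<in> V" "v \<in> V" and "component_of V E u = component_of V E v"
  moreover have "v \<in> component_of V E v" using uv by (simp add: component_of_def)
  ultimately have "v \<in> component_of V E u" by simp
  then show "(u, v) \<in> (adjacency E)\<^sup>*" by (simp add: component_of_def)
next
  assume uv: "(u, v) \<in> (adjacency E)\<^sup>*"
  then have "(u, x) \<in> (adjacency E)\<^sup>* \<longleftrightarrow> (v, x) \<in> (adjacency E)\<^sup>*" for x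
    using sym_reachable[OF uv] by (meson rtrancl_trans)
  then show "component_of V E u = component_of V E v" by (simp add: component_of_def)
qed

lemma reachable_insert:
  "(x, y) \<in> (adjacency (insert {u, v} E))\<^sup>* \<longleftrightarrow> (x, y) \<in> (adjacency E)\<^sup>* \<or>
    (x, u) \<in> (adjacency E)\<^sup>* \<and> (v, y) \<in> (adjacency E)\<^sup>* \<or>
    (x, v) \<in> (adjacency E)\<^sup>* \<and> (u, y) \<in> (adjacency E)\<^sup>*"
proof -
  have "adjacency (insert {u, v} E) = insert (u, v) (insert (v, u) (adjacency E))"
    by (auto simp: doubleton_eq_iff)
  then show ?thesis
    by (simp add: rtrancl_insert) (meson rtrancl_trans sym_reachable)
qed

lemma component_of_insert:
  assumes "x \<in> V"
  shows "component_of V (insert {u, v} E) x =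
    (if (x, u) \<in> (adjacency E)\<^sup>* \<or> (x, v) \<in> (adjacency E)\<^sup>*
     then component_of V E u \<union> component_of V E v else component_of V E x)"
  unfolding component_of_def reachable_insert
  by (auto intro: rtrancl_trans sym_reachable)

lemma card_components_insert:
  assumes V: "finite V" "u \<in> V" "v \<in> V"
  shows "card (components V E) =
    card (components V (insert {u, v} E)) + (if (u, v) \<in> (adjacency E)\<^sup>* then 0 else 1)"
proof (cases "(u, v) \<in> (adjacency E)\<^sup>*")
  case True
  have "component_of V (insert {u, v} E) x = component_of V E x" if "x \<in> V" for x
  proof -
    have "component_of V E u = component_of V E v" using True component_of_eq_iff[OF V(2,3)] by simp
    moreover have "(x, u) \<in> (adjacency E)\<^sup>* \<longleftrightarrow> component_of V E x = component_of V E u"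
      "(x, v) \<in> (adjacency E)\<^sup>* \<longleftrightarrow> component_of V E x = component_of V E v"
      using component_of_eq_iff[OF that V(2)] component_of_eq_iff[OF that V(3)] by simp_all
    ultimately show ?thesis using that by (simp add: component_of_insert)
  qed
  then have "components V (insert {u, v} E) = components V E" by (simp add: components_def)
  with True show ?thesis by simp
next
  case False
  let ?c = "component_of V E"
  have ne: "?c u \<noteq> ?c v" using False component_of_eq_iff[OF V(2,3)] by simp
  have uin: "x \<in> ?c x" if "x \<in> V" for x using that by (simp add: component_of_def)
  have eq: "components V (insert {u, v} E) = insert (?c u \<union> ?c v) (components V E - {?c u, ?c v})"
  proof (intro subset_antisym subsetI)
    fix D assume "D \<in> components V (insert {u, v} E)"
    then obtain x where x: "x \<in> V" "D = component_of V (insert {u, v} E) x"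
      by (auto simp: components_def)
    then show "D \<in> insert (?c u \<union> ?c v) (components V E - {?c u, ?c v})"
      using component_of_eq_iff[OF x(1)] V by (auto simp: component_of_insert components_def)
  next
    fix D assume "D \<in> insert (?c u \<union> ?c v) (components V E - {?c u, ?c v})"
    then consider "D = ?c u \<union> ?c v" | x where "x \<in> V" "D = ?c x" "?c x \<noteq> ?c u" "?c x \<noteq> ?c v"
      by (auto simp: components_def)
    then show "D \<in> components V (insert {u, v} E)"
    proof cases
      case 1
      then have "D = component_of V (insert {u, v} E) u" using V by (simp add: component_of_insert)
      with V show ?thesis by (simp add: components_def)
    next
      case 2
      then have D: "D = component_of V (insert {u, v} E) x"
        using component_of_eq_iff[OF 2(1)] V by (simp add: component_of_insert)
      show ?thesis unfolding components_def D using 2(1) by (rule imageI)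
    qed
  qed
  have fin: "finite (components V E)" using V by (simp add: components_def)
  have "?c u \<union> ?c v \<notin> components V E"
  proof
    assume "?c u \<union> ?c v \<in> components V E"
    then obtain x where x: "x \<in> V" "?c u \<union> ?c v = ?c x" by (auto simp: components_def)
    then have "u \<in> ?c x" "v \<in> ?c x" using uin[OF V(2)] uin[OF V(3)] by (simp_all flip: x(2))
    then have xu: "(x, u) \<in> (adjacency E)\<^sup>*" and xv: "(x, v) \<in> (adjacency E)\<^sup>*"
      by (simp_all add: component_of_def)
    from rtrancl_trans[OF sym_reachable[OF xu] xv] False show False by simp
  qed
  moreover have "card (components V E - {?c u, ?c v}) = card (components V E) - 2"
    using ne V by (subst card_Diff_subset) (auto simp: components_def)
  \<comment> \<open>This makes the truncated subtraction of 2 exact.\<close>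
  moreover have "card {?c u, ?c v} \<le> card (components V E)"
    using V fin by (intro card_mono) (auto simp: components_def)
  ultimately show ?thesis
    using False ne fin unfolding eq by simp
qed

lemma h1_insert:
  assumes "finite V" "u \<in> V" "v \<in> V" "finite E" "{u, v} \<notin> E"
  shows "h1 V (insert {u, v} E) = h1 V E + (if (u, v) \<in> (adjacency E)\<^sup>* then 1 else 0)"
  using card_components_insert[OF assms(1-3), of E] assms(4,5) by (simp add: h1_def)

lemma h1_empty: "finite V \<Longrightarrow> h1 V {} = 0"
proof -
  assume "finite V"
  have "component_of V {} x = {x}" if "x \<in> V" for x
    using that by (auto simp: component_of_def)
  then have "components V {} = (\<lambda>x. {x}) ` V" by (simp add: components_def)
  then have "card (components V {}) = card V" by (simp add: card_image)
  then show ?thesis by (simp add: h1_def)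
qed

lemma finite_simple_graphD:
  assumes "finite_simple_graph V E"
  shows "finite V" "finite E" "\<And>e. e \<in> E \<Longrightarrow> e \<subseteq> V" "\<And>e. e \<in> E \<Longrightarrow> card e = 2"
proof -
  show 1: "finite V" "\<And>e. e \<in> E \<Longrightarrow> e \<subseteq> V" "\<And>e. e \<in> E \<Longrightarrow> card e = 2"
    using assms by (auto simp: finite_simple_graph_def)
  have "E \<subseteq> Pow V" using 1 by blast
  then show "finite E" using 1(1) finite_subset by blast
qed

lemma finite_simple_graph_subset:
  "finite_simple_graph V E \<Longrightarrow> E' \<subseteq> E \<Longrightarrow> finite_simple_graph V E'"
  by (auto simp: finite_simple_graph_def)

lemma finite_simple_graph_edge:
  assumes "finite_simple_graph V E" "e \<in> E"
  obtains u v where "e = {u, v}" "u \<noteq> v" "u \<in> V" "v \<in> V"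
proof -
  have "card e = 2" "e \<subseteq> V" using assms by (auto simp: finite_simple_graph_def)
  then show thesis using that by (auto simp: card_2_iff)
qed

lemma h1_remove:
  assumes "finite_simple_graph V E" "{u, v} \<in> E"
  shows "h1 V E = h1 V (E - {{u, v}}) + (if (u, v) \<in> (adjacency (E - {{u, v}}))\<^sup>* then 1 else 0)"
proof -
  have "{u, v} \<subseteq> V" using finite_simple_graphD(3)[OF assms] .
  then show ?thesis
    using h1_insert[of V u v "E - {{u, v}}"] finite_simple_graphD(1,2)[OF assms(1)] assms(2)
    by (simp add: insert_absorb)
qed

lemma h1_nonneg: "finite_simple_graph V E \<Longrightarrow> 0 \<le> h1 V E"
proof (induction "card E" arbitrary: E)
  case 0
  then have "E = {}" using finite_simple_graphD(2) by fastforce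
  then show ?case using h1_empty[OF finite_simple_graphD(1)[OF 0(2)]] by simp
next
  case (Suc n)
  then obtain e where e: "e \<in> E" by fastforce
  then obtain u v where uv: "e = {u, v}" using finite_simple_graph_edge Suc by metis
  have "0 \<le> h1 V (E - {e})"
    using Suc e finite_simple_graph_subset[of V E "E - {e}"] by (intro Suc.hyps) (auto simp: card_Diff_singleton)
  then show ?case using h1_remove[OF Suc.prems] e uv by auto
qed

section \<open>Paths and cycles as lists of vertices\<close>

lemma path_edges_Cons_subset: "path_edges zs \<subseteq> path_edges (x # zs)"
  by (cases zs) auto

lemma path_edges_append_subset: "path_edges zs \<subseteq> path_edges (xs @ zs)" "path_edges xs \<subseteq> path_edges (xs @ zs)"
proof -
  show "path_edges zs \<subseteq> path_edges (xs @ zs)"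
    by (induction xs) (use path_edges_Cons_subset in fastforce)+
  show "path_edges xs \<subseteq> path_edges (xs @ zs)"
    by (induction xs rule: path_edges.induct) auto
qed

lemma reachable_path_edges:
  assumes "x \<in> set vs" "y \<in> set vs"
  shows "(x, y) \<in> (adjacency (path_edges vs))\<^sup>*"
proof -
  have hd: "(hd vs, y) \<in> (adjacency (path_edges vs))\<^sup>*" if "y \<in> set vs" for y
    using that
  proof (induction vs rule: path_edges.induct)
    case (1 a b zs)
    show ?case
    proof (cases "y = a")
      case False
      then have "(b, y) \<in> (adjacency (path_edges (b # zs)))\<^sup>*" using 1 by simp
      then have "(b, y) \<in> (adjacency (path_edges (a # b # zs)))\<^sup>*"
        using reachable_mono[OF path_edges_Cons_subset[of "b # zs" a]] by blast
      moreover have "(a, b) \<in> adjacency (path_edges (a # b # zs))" by simp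
      ultimately have "(a, y) \<in> (adjacency (path_edges (a # b # zs)))\<^sup>*"
        by (rule converse_rtrancl_into_rtrancl[rotated])
      then show ?thesis by simp
    qed simp
  qed auto
  from rtrancl_trans[OF sym_reachable[OF hd[OF assms(1)]] hd[OF assms(2)]] show ?thesis .
qed

lemma reachable_distinct_path:
  assumes "(u, v) \<in> (adjacency E)\<^sup>*"
  shows "\<exists>vs. vs \<noteq> [] \<and> hd vs = u \<and> last vs = v \<and> distinct vs \<and> path_edges vs \<subseteq> E"
  using assms
proof (induction rule: converse_rtrancl_induct)
  case base
  show ?case by (rule exI[of _ "[v]"]) simp
next
  case (step x y)
  then obtain vs where vs: "vs \<noteq> []" "hd vs = y" "last vs = v" "distinct vs" "path_edges vs \<subseteq> E"
    by blast
  show ?case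
  proof (cases "x \<in> set vs")
    case True
    then obtain as bs where ab: "vs = as @ x # bs" by (meson split_list)
    then have "path_edges (x # bs) \<subseteq> E" using vs(5) path_edges_append_subset(1)[of "x # bs" as] by auto
    then show ?thesis using vs ab by (intro exI[of _ "x # bs"]) auto
  next
    case False
    obtain zs where "vs = y # zs" using vs by (cases vs) auto
    then show ?thesis using vs False step(1) by (intro exI[of _ "x # vs"]) auto
  qed
qed

lemma finite_path_edges: "finite (path_edges vs)"
  by (induction vs rule: path_edges.induct) auto

lemma path_edges_nth: "path_edges vs = {{vs ! i, vs ! Suc i} | i. Suc i < length vs}"
proof (induction vs rule: path_edges.induct)
  case (1 x y zs)
  have "{{(x # y # zs) ! i, (x # y # zs) ! Suc i} | i. Suc i < length (x # y # zs)}
      = insert {x, y} {{(y # zs) ! i, (y # zs) ! Suc i} | i. Suc i < length (y # zs)}" (is "?L = ?R")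
  proof (intro subset_antisym subsetI)
    fix e assume "e \<in> ?L"
    then obtain i where "e = {(x # y # zs) ! i, (x # y # zs) ! Suc i}" "Suc i < length (x # y # zs)" by blast
    then show "e \<in> ?R" by (cases i) auto
  next
    fix e assume "e \<in> ?R"
    then consider "e = {x, y}" | i where "e = {(y # zs) ! i, (y # zs) ! Suc i}" "Suc i < length (y # zs)" by blast
    then show "e \<in> ?L"
    proof cases
      case 1 then show ?thesis by (auto intro!: exI[of _ 0])
    next
      case (2 i) then show ?thesis by (auto intro!: exI[of _ "Suc i"])
    qed
  qed
  with 1 show ?case by simp
qed auto

lemma cycle_edges_nth:
  assumes "vs \<noteq> []"
  shows "cycle_edges vs = {{vs ! i, vs ! (Suc i mod length vs)} | i. i < length vs}"
proof -
  let ?n = "length vs" and ?g = "\<lambda>i. {vs ! i, vs ! (Suc i mod length vs)}"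
  \<comment> \<open>The last index is split off because it is the only one at which
    \<open>mod\<close> wraps around; it gives the closing edge.\<close>
  have "{..<?n} = insert (?n - 1) {..<?n - 1}" using assms by (auto simp: neq_Nil_conv)
  then have "?g ` {..<?n} = insert (?g (?n - 1)) (?g ` {..<?n - 1})" by simp
  also have "?g (?n - 1) = {last vs, hd vs}"
    using assms by (simp add: last_conv_nth hd_conv_nth)
  also have "?g ` {..<?n - 1} = {{vs ! i, vs ! Suc i} | i. Suc i < length vs}"
    by (auto simp: less_diff_conv)
  finally have "?g ` {..<?n} = cycle_edges vs" by (simp add: cycle_edges_def path_edges_nth)
  then show ?thesis by (simp add: image_def lessThan_def Bex_def conj_commute)
qed

lemma cycle_edges_rotate:
  assumes "vs \<noteq> []"
  shows "cycle_edges (rotate m vs) = cycle_edges vs"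
proof (induction m)
  case (Suc m)
  define ws where "ws = rotate m vs"
  have "cycle_edges (rotate1 ws) = cycle_edges ws"
  proof (cases ws rule: path_edges.cases)
    case (1 x y zs)
    have snoc: "path_edges (us @ [z]) = (if us = [] then {} else insert {last us, z} (path_edges us))" for us and z :: 'a
      by (induction us rule: path_edges.induct) auto
    show ?thesis unfolding 1 by (auto simp: cycle_edges_def snoc simp flip: append_Cons)
  qed auto
  then show ?case using Suc by (simp add: ws_def)
qed simp

lemma is_cycle_iff:
  "is_cycle E C \<longleftrightarrow> C \<subseteq> E \<and> (\<exists>vs. distinct vs \<and> 3 \<le> length vs \<and> C = cycle_edges vs)"
  unfolding is_cycle_def
  by (intro conj_cong refl ex_cong1) (subst cycle_edges_nth, auto)

lemma Union_path_edges: "length vs \<ge> 2 \<Longrightarrow> \<Union>(path_edges vs) = set vs"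
proof (induction vs rule: path_edges.induct)
  case (1 x y zs)
  then show ?case by (cases zs) auto
qed auto

lemma Union_cycle_edges: "length vs \<ge> 2 \<Longrightarrow> \<Union>(cycle_edges vs) = set vs"
  unfolding cycle_edges_def using Union_path_edges[of vs] by (auto intro: hd_in_set last_in_set)

lemma is_cycle_at_vertex:
  assumes "is_cycle E C" "x \<in> \<Union>C"
  obtains vs where "distinct vs" "3 \<le> length vs" "C = cycle_edges vs" "hd vs = x"
proof -
  obtain vs where vs: "distinct vs" "3 \<le> length vs" "C = cycle_edges vs"
    using assms(1) by (auto simp: is_cycle_iff)
  then have "x \<in> set vs" using assms(2) Union_cycle_edges[of vs] by simp
  then obtain i where "i < length vs" "vs ! i = x" by (meson in_set_conv_nth)
  moreover have "vs \<noteq> []" using vs by auto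
  ultimately show thesis
    using vs that[of "rotate i vs"] cycle_edges_rotate by (auto simp: hd_rotate_conv_nth)
qed

lemma is_cycle_at_edge:
  assumes "is_cycle E C" "e \<in> C"
  obtains vs where "distinct vs" "3 \<le> length vs" "C = cycle_edges vs" "e = {last vs, hd vs}"
proof -
  obtain vs where vs: "distinct vs" "3 \<le> length vs" "C = cycle_edges vs"
    using assms(1) by (auto simp: is_cycle_iff)
  have ne: "vs \<noteq> []" using vs by auto
  then obtain i where i: "i < length vs" "e = {vs ! i, vs ! (Suc i mod length vs)}"
    using vs assms(2) by (auto simp: cycle_edges_nth)
  \<comment> \<open>Rotation by \<open>Suc i\<close> puts the first end of the edge last and its
    successor first, so that the given edge becomes the closing one.\<close>
  have "last (rotate (Suc i) vs) = vs ! i"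
    using ne i by (simp add: last_conv_nth nth_rotate del: rotate_Suc)
  moreover have "hd (rotate (Suc i) vs) = vs ! (Suc i mod length vs)"
    using ne by (simp add: hd_rotate_conv_nth del: rotate_Suc)
  ultimately show thesis
    using vs that[of "rotate (Suc i) vs"] cycle_edges_rotate[OF ne, of "Suc i"] i by (simp del: rotate_Suc)
qed

text \<open>The first vertex occurs in only one path edge, the one to the second vertex, and with
  three or more vertices the second is not the last.\<close>

lemma closing_edge_notin_path:
  assumes "distinct vs" "3 \<le> length vs"
  shows "{last vs, hd vs} \<notin> path_edges vs"
proof
  assume h: "{last vs, hd vs} \<in> path_edges vs"
  obtain x y z zs where vs: "vs = x # y # z # zs"
    using assms(2) by (metis Suc_le_length_iff numeral_3_eq_3)
  have "x \<notin> e" if "e \<in> path_edges (y # z # zs)" for e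
    using path_edges_subset[OF that] assms(1) vs by auto
  then have "{last vs, x} \<notin> path_edges (y # z # zs)" by blast
  then have "{last vs, x} = {x, y}" using h unfolding vs by simp
  then have "last (z # zs) = y" using assms(1) vs by (auto simp: doubleton_eq_iff split: if_splits)
  moreover have "last (z # zs) \<in> set (z # zs)" by (rule last_in_set) simp
  ultimately show False using assms(1) vs by simp
qed

lemma card_path_edges: "distinct vs \<Longrightarrow> vs \<noteq> [] \<Longrightarrow> card (path_edges vs) = length vs - 1"
proof (induction vs rule: path_edges.induct)
  case (1 x y zs)
  have "{x, y} \<notin> path_edges (y # zs)"
    using 1 path_edges_subset[of "{x, y}" "y # zs"] by auto
  then show ?case using 1 finite_path_edges[of "y # zs"] by simp
qed auto

lemma card_cycle_edges:
  assumes "distinct vs" "3 \<le> length vs"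
  shows "card (cycle_edges vs) = length vs"
proof -
  have "finite (path_edges vs)" by (rule finite_path_edges)
  then show ?thesis
    using assms closing_edge_notin_path[OF assms] card_path_edges[of vs]
    by (cases vs) (simp_all add: cycle_edges_def)
qed

text \<open>Rotate the cycle until the edge is the closing one; the other edges then form a path
  between its ends.\<close>

lemma cycle_edge_reachable:
  assumes "is_cycle E C" "{u, v} \<in> C"
  shows "(u, v) \<in> (adjacency (E - {{u, v}}))\<^sup>*"
proof -
  obtain vs where vs: "distinct vs" "3 \<le> length vs" "C = cycle_edges vs" "{u, v} = {last vs, hd vs}"
    using is_cycle_at_edge[OF assms] by metis
  have "path_edges vs \<subseteq> E - {{u, v}}"
    using closing_edge_notin_path[OF vs(1,2)] vs(3,4) assms(1) by (auto simp: is_cycle_def cycle_edges_def)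
  note sub = reachable_mono[OF this]
  have "vs \<noteq> []" using vs by auto
  then have "u \<in> set vs" "v \<in> set vs" using vs(4) by (auto simp: doubleton_eq_iff)
  then show ?thesis using sub reachable_path_edges[of u vs v] by blast
qed

lemma reachable_imp_cycle:
  assumes "{u, v} \<notin> E" "u \<noteq> v" "(u, v) \<in> (adjacency E)\<^sup>*"
  shows "\<exists>C. is_cycle (insert {u, v} E) C"
proof -
  obtain vs where vs: "vs \<noteq> []" "hd vs = u" "last vs = v" "distinct vs" "path_edges vs \<subseteq> E"
    using reachable_distinct_path[OF assms(3)] by blast
  \<comment> \<open>A path with just two vertices would be the edge \<open>{u, v}\<close> itself,
    which is not in \<open>E\<close>.\<close>
  have "3 \<le> length vs"
  proof (cases vs rule: path_edges.cases)
    case (1 x y zs)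
    then show ?thesis using vs assms by (cases zs) auto
  qed (use vs assms in auto)
  then have "is_cycle (insert {u, v} E) (cycle_edges vs)"
    unfolding is_cycle_iff using vs by (auto simp: cycle_edges_def insert_commute)
  then show ?thesis by blast
qed

section \<open>Betti number and uniqueness of the cycle\<close>

lemma h1_remove_cycle_edge:
  assumes "finite_simple_graph V E" "is_cycle E C" "e \<in> C"
  shows "h1 V E = h1 V (E - {e}) + 1"
proof -
  have "e \<in> E" using assms by (auto simp: is_cycle_def)
  then obtain u v where "e = {u, v}" using assms(1) finite_simple_graph_edge by metis
  then show ?thesis using h1_remove[OF assms(1)] cycle_edge_reachable[OF assms(2)] assms(3) \<open>e \<in> E\<close> by auto
qed

lemma is_cycle_nonempty: "is_cycle E C \<Longrightarrow> \<exists>e. e \<in> C"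
  by (auto simp: is_cycle_iff cycle_edges_def)

lemma is_cycle_mono: "is_cycle E C \<Longrightarrow> E \<subseteq> E' \<Longrightarrow> is_cycle E' C"
  unfolding is_cycle_iff by blast

lemma h1_pos_if_cycle:
  assumes "finite_simple_graph V E" "is_cycle E C"
  shows "1 \<le> h1 V E"
proof -
  obtain e where "e \<in> C" using is_cycle_nonempty assms(2) by blast
  then show ?thesis
    using h1_remove_cycle_edge[OF assms] h1_nonneg finite_simple_graph_subset[OF assms(1), of "E - {e}"] by fastforce
qed

lemma h1_zero_if_acyclic:
  assumes "finite_simple_graph V E" "\<nexists>C. is_cycle E C"
  shows "h1 V E = 0"
  using assms
proof (induction "card E" arbitrary: E)
  case 0
  then have "E = {}" using finite_simple_graphD(2) by fastforce
  then show ?case using h1_empty[OF finite_simple_graphD(1)[OF 0(2)]] by simp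
next
  case (Suc n)
  then obtain e where e: "e \<in> E" by fastforce
  then obtain u v where uv: "e = {u, v}" "u \<noteq> v" using finite_simple_graph_edge Suc by metis
  have "\<nexists>C. is_cycle (E - {e}) C" using Suc.prems(2) is_cycle_mono by (metis Diff_subset)
  then have "h1 V (E - {e}) = 0"
    using Suc e finite_simple_graph_subset[of V E "E - {e}"] by (intro Suc.hyps) (auto simp: card_Diff_singleton)
  moreover have "(u, v) \<notin> (adjacency (E - {{u, v}}))\<^sup>*"
    using reachable_imp_cycle[of u v "E - {{u, v}}"] Suc.prems(2) uv e by (auto simp: insert_absorb)
  ultimately show ?case using h1_remove[OF Suc.prems(1)] e uv by auto
qed

text \<open>Removing an edge of one cycle that another cycle misses would lower \<open>h1\<close> to
  0 although a cycle survives.\<close>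

lemma unique_cycle:
  assumes G: "finite_simple_graph V E" and h: "h1 V E = 1"
  shows "is_cycle E (the_cycle E)" and "is_cycle E C \<Longrightarrow> C = the_cycle E"
proof -
  have uniq: "C \<subseteq> D" if "is_cycle E C" "is_cycle E D" for C D
  proof
    fix e assume e: "e \<in> C"
    show "e \<in> D"
    proof (rule ccontr)
      assume "e \<notin> D"
      then have "is_cycle (E - {e}) D" using that(2) unfolding is_cycle_iff by blast
      then have "1 \<le> h1 V (E - {e})"
        using h1_pos_if_cycle finite_simple_graph_subset[OF G] by (metis Diff_subset)
      with h1_remove_cycle_edge[OF G that(1) e] h show False by simp
    qed
  qed
  obtain D where D: "is_cycle E D" using h1_zero_if_acyclic[OF G] h by auto
  have "the_cycle E = D" unfolding the_cycle_def using D uniq by (intro the_equality) auto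
  with D uniq show "is_cycle E (the_cycle E)" "is_cycle E C \<Longrightarrow> C = the_cycle E" by auto
qed

section \<open>Stripping leaves\<close>

text \<open>A connection of two cycle vertices outside the cycle would allow two cycle edges to be
  removed in turn, each removal lowering \<open>h1\<close>, which would reach -1.\<close>

lemma cycle_components_separate:
  assumes G: "finite_simple_graph V E" and h: "h1 V E = 1" and C: "is_cycle E C"
    and uv: "v \<in> \<Union>C" "u \<in> \<Union>C" "(v, u) \<in> (adjacency (E - C))\<^sup>*"
  shows "u = v"
proof (rule ccontr)
  assume ne: "u \<noteq> v"
  obtain vs where vs: "distinct vs" "3 \<le> length vs" "C = cycle_edges vs" "hd vs = v"
    using is_cycle_at_vertex[OF C uv(1)] .
  have "u \<in> set vs" using uv(2) vs Union_cycle_edges[of vs] by simp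
  then obtain ps qs where split: "vs = ps @ u # qs" by (meson split_list)
  have ps: "ps \<noteq> []" using ne vs(4) split by auto
  \<comment> \<open>\<open>x\<close> precedes \<open>u\<close> on the cycle traversed from
    \<open>v\<close>. After the removal of the closing edge and of \<open>xu\<close>, the path back
    from \<open>x\<close> to \<open>v\<close> followed by the outside connection from
    \<open>v\<close> to \<open>u\<close> still joins \<open>x\<close> to \<open>u\<close>.\<close>
  define x where "x = last ps"
  let ?e = "{last vs, v}"
  have eC: "?e \<in> C" using vs by (simp add: cycle_edges_def)
  have notin: "?e \<notin> path_edges vs" using closing_edge_notin_path[OF vs(1,2)] vs(4) by simp
  have pE: "path_edges vs \<subseteq> E - {?e}"
    using notin C vs(3) by (auto simp: is_cycle_def cycle_edges_def)
  have "ps = butlast ps @ [x]" using ps by (simp add: x_def)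
  then have vs': "vs = butlast ps @ (x # u # qs)" using split by (metis append.assoc append_Cons append_Nil)
  have xu: "{x, u} \<in> path_edges vs"
    using path_edges_append_subset(1)[of "x # u # qs" "butlast ps"] vs' by auto
  let ?E = "E - {?e}"
  have "path_edges ps \<subseteq> ?E - {{x, u}}"
  proof
    fix g assume g: "g \<in> path_edges ps"
    have "u \<notin> g" using path_edges_subset[OF g] split vs(1) by auto
    moreover have "g \<in> path_edges vs" using g path_edges_append_subset(2)[of ps "u # qs"] split by auto
    ultimately show "g \<in> ?E - {{x, u}}" using pE by auto
  qed
  note path = reachable_mono[OF this]
  have "x \<in> set ps" "v \<in> set ps" using ps vs(4) split by (auto simp: x_def)
  then have xv: "(x, v) \<in> (adjacency (?E - {{x, u}}))\<^sup>*"
    using path reachable_path_edges[of x ps v] by blast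
  have "{x, u} \<in> C" using xu vs(3) by (simp add: cycle_edges_def)
  then have "E - C \<subseteq> ?E - {{x, u}}" using eC by auto
  from reachable_mono[OF this] have "(v, u) \<in> (adjacency (?E - {{x, u}}))\<^sup>*" using uv(3) by (rule subsetD)
  with xv have "(x, u) \<in> (adjacency (?E - {{x, u}}))\<^sup>*" by (rule rtrancl_trans)
  moreover have "finite_simple_graph V ?E" using finite_simple_graph_subset[OF G] by blast
  moreover have "{x, u} \<in> ?E" using xu pE by blast
  ultimately have "h1 V ?E = h1 V (?E - {{x, u}}) + 1"
    using h1_remove[of V ?E x u] by simp
  moreover have "finite_simple_graph V (?E - {{x, u}})"
    by (rule finite_simple_graph_subset[OF G]) blast
  then have "0 \<le> h1 V (?E - {{x, u}})" by (rule h1_nonneg)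
  ultimately show False using h1_remove_cycle_edge[OF G C eC] h by simp
qed

section \<open>Degrees, stripping sequences and tentacles\<close>

definition neighbours :: "'a set set \<Rightarrow> 'a set \<Rightarrow> 'a \<Rightarrow> 'a set" where
  "neighbours E U a = {x \<in> U. {a, x} \<in> E}"

lemma sum_card_neighbours:
  assumes "finite_simple_graph U E"
  shows "(\<Sum>a\<in>U. card (neighbours E U a)) = 2 * card E"
proof -
  let ?P = "\<lambda>E. {(x, y). {x, y} \<in> E}"
  have fin: "finite U" "finite E" using finite_simple_graphD[OF assms] by auto
  have sub: "?P E' \<subseteq> U \<times> U" if "E' \<subseteq> E" for E'
    using that finite_simple_graphD(3)[OF assms] by fastforce
  have "(\<Sum>a\<in>U. card (neighbours E U a)) = card (Sigma U (neighbours E U))"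
    using fin by (simp add: neighbours_def)
  also have "Sigma U (neighbours E U) = ?P E"
    using sub[of E] by (auto simp: neighbours_def)
  also have "card (?P E') = 2 * card E'" if "E' \<subseteq> E" for E'
    using finite_subset[OF that fin(2)] that
  proof (induction E' rule: finite_induct)
    case (insert e E')
    then have "e \<in> E" by simp
    then obtain u v where uv: "e = {u, v}" "u \<noteq> v" using finite_simple_graph_edge[OF assms] by metis
    have "?P (insert e E') = insert (u, v) (insert (v, u) (?P E'))"
      unfolding uv(1) by (auto simp: doubleton_eq_iff)
    moreover have "finite (?P E')" using sub[of E'] insert fin by (meson finite_SigmaI finite_subset insert_subset)
    moreover have "(u, v) \<notin> ?P E'" "(v, u) \<notin> ?P E'" using insert uv by (auto simp: insert_commute)
    ultimately show ?case using insert uv by simp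
  qed simp
  from this[of E] have "card (?P E) = 2 * card E" by simp
  finally show ?thesis .
qed

lemma induced_edges_subset: "induced_edges E U \<subseteq> E"
  by (auto simp: induced_edges_def)

lemma finite_simple_graph_induced:
  "finite_simple_graph V E \<Longrightarrow> U \<subseteq> V \<Longrightarrow> finite_simple_graph U (induced_edges E U)"
  by (auto simp: finite_simple_graph_def induced_edges_def intro: finite_subset)

lemma neighbours_induced: "a \<in> U \<Longrightarrow> neighbours (induced_edges E U) U a = neighbours E U a"
  by (auto simp: neighbours_def induced_edges_def)

text \<open>By the degree sum the induced graph has at least as many edges as vertices, so it
  contains a cycle, necessarily the unique one. Without one edge of it the induced graph is acyclic,
  hence its \<open>h1\<close> is 1. This forces equality in the count: the graph is connected and
  all degrees are exactly two, so no edge leads off the cycle.\<close>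

proposition min_degree_two_is_cycle:
  assumes G: "finite_simple_graph V E" and h: "h1 V E = 1"
    and U: "U \<subseteq> V" "U \<noteq> {}" and deg: "\<And>a. a \<in> U \<Longrightarrow> 2 \<le> card (neighbours E U a)"
  shows "U = \<Union>(the_cycle E)" and "induced_edges E U = the_cycle E"
proof -
  let ?E = "induced_edges E U" and ?C = "the_cycle E"
  have G': "finite_simple_graph U ?E" using finite_simple_graph_induced[OF G U(1)] .
  have fin: "finite U" "finite ?E" using finite_simple_graphD[OF G'] by auto
  have sum: "(\<Sum>a\<in>U. card (neighbours E U a)) = 2 * card ?E"
    using sum_card_neighbours[OF G'] by (simp add: neighbours_induced)
  have "(\<Sum>a\<in>U. 2) \<le> (\<Sum>a\<in>U. card (neighbours E U a))" using deg by (rule sum_mono)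
  then have le: "card U \<le> card ?E" using sum by simp
  have "components U ?E \<noteq> {}" "finite (components U ?E)" using U fin by (auto simp: components_def)
  then have comp: "1 \<le> card (components U ?E)" by (simp add: Suc_leI card_gt_0_iff)
  have "\<exists>C. is_cycle ?E C"
    using h1_zero_if_acyclic[OF G'] le comp by (auto simp: h1_def)
  then obtain C where C': "is_cycle ?E C" by blast
  then have "is_cycle E C" using is_cycle_mono induced_edges_subset by metis
  then have "C = ?C" using unique_cycle(2)[OF G h] by blast
  with C' have C: "is_cycle ?E ?C" by simp
  then have CE: "?C \<subseteq> ?E" by (simp add: is_cycle_def)
  obtain e where e: "e \<in> ?C" using is_cycle_nonempty C by blast
  have "\<nexists>D. is_cycle (?E - {e}) D"
  proof
    assume "\<exists>D. is_cycle (?E - {e}) D"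
    then obtain D where D: "is_cycle (?E - {e}) D" by blast
    then have "is_cycle E D" using is_cycle_mono induced_edges_subset by (metis Diff_subset order_trans)
    then have "D = ?C" using unique_cycle(2)[OF G h] by blast
    with D e show False by (auto simp: is_cycle_def)
  qed
  then have "h1 U (?E - {e}) = 0"
    using h1_zero_if_acyclic finite_simple_graph_subset[OF G', of "?E - {e}"] by blast
  then have "h1 U ?E = 1" using h1_remove_cycle_edge[OF G' C e] by simp
  then have one: "card (components U ?E) = 1" and eq: "card ?E = card U"
    using le comp by (auto simp: h1_def)
  have "(\<Sum>a\<in>U. card (neighbours E U a)) = (\<Sum>a\<in>U. 2)" using sum eq by simp
  then have deg2: "card (neighbours E U a) = 2" if "a \<in> U" for a
    using sum_mono_inv[of "\<lambda>_. 2" U "\<lambda>a. card (neighbours E U a)"] deg that fin by metis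
  \<comment> \<open>The two neighbours of \<open>x\<close> on the cycle are distinct and use up its
    degree.\<close>
  have inC: "{x, y} \<in> ?C" if x: "x \<in> \<Union>?C" and xy: "{x, y} \<in> ?E" for x y
  proof -
    obtain vs where vs: "distinct vs" "3 \<le> length vs" "?C = cycle_edges vs" "hd vs = x"
      using is_cycle_at_vertex[OF C x] .
    then obtain y1 y2 zs where l: "vs = x # y1 # y2 # zs"
      by (metis Suc_le_length_iff list.sel(1) numeral_3_eq_3)
    let ?l = "last vs"
    have lC: "{x, ?l} \<in> ?C" "{x, y1} \<in> ?C" using vs l by (auto simp: cycle_edges_def insert_commute)
    have "?l \<in> set (y2 # zs)" unfolding l by simp
    then have ne: "?l \<noteq> y1" using vs(1) l by auto
    have "{?l, y1} \<subseteq> neighbours E U x"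
      using lC CE by (auto simp: neighbours_def induced_edges_def)
    moreover have "x \<in> U" using xy by (auto simp: induced_edges_def)
    ultimately have "{?l, y1} = neighbours E U x"
      using deg2 ne fin by (intro card_subset_eq) (auto simp: neighbours_def)
    moreover have "y \<in> neighbours E U x" using xy by (auto simp: neighbours_def induced_edges_def)
    ultimately have "y = ?l \<or> y = y1" by blast
    then show ?thesis using lC by blast
  qed
  have CU: "\<Union>?C \<subseteq> U" using CE by (auto simp: induced_edges_def)
  obtain x0 where x0: "x0 \<in> \<Union>?C" using e finite_simple_graph_edge[OF G'] CE by (metis Union_iff insertCI subsetD)
  have "U \<subseteq> \<Union>?C"
  proof
    fix y assume y: "y \<in> U"
    obtain K where "components U ?E = {K}" using one by (meson card_1_singletonE)
    then have "component_of U ?E z = K" if "z \<in> U" for z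
      using imageI[OF that, of "component_of U ?E"] by (simp add: components_def)
    then have "component_of U ?E x0 = component_of U ?E y"
      using y x0 CU by blast
    then have "(x0, y) \<in> (adjacency ?E)\<^sup>*" using component_of_eq_iff[OF _ y] x0 CU by blast
    then show "y \<in> \<Union>?C"
    proof (induction rule: rtrancl_induct)
      case base show ?case by (rule x0)
    next
      case (step y z)
      then have "{y, z} \<in> ?C" by (intro inC) auto
      then show ?case by blast
    qed
  qed
  with CU show UC: "U = \<Union>?C" by blast
  show "?E = ?C"
  proof (intro subset_antisym CE subsetI)
    fix g assume g: "g \<in> ?E"
    then obtain x y where "g = {x, y}" "x \<in> U" using finite_simple_graph_edge[OF G'] by metis
    then show "g \<in> ?C" using inC UC g by auto
  qed
qed

text \<open>\<open>b\<close> is a leaf of the graph induced by \<open>U\<close>, and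
  \<open>a\<close> is its neighbour; in the ideal of that graph \<open>a\<close> dominates
  \<open>b\<close>. Only \<open>a\<close> is recorded, because the list becomes the sequence of a
  resolution. The edge set stays fixed and only the remaining vertices vary.\<close>

inductive strip :: "'a set set \<Rightarrow> 'a set \<Rightarrow> 'a list \<Rightarrow> 'a set \<Rightarrow> bool" for E where
  strip_Nil: "strip E U [] U"
| strip_Cons: "a \<in> U \<Longrightarrow> b \<in> U \<Longrightarrow> a \<noteq> b \<Longrightarrow> neighbours E U b = {a} \<Longrightarrow>
    strip E (U - insert a (neighbours E U a)) as U' \<Longrightarrow> strip E U (a # as) U'"

lemma strip_subset: "strip E U as U' \<Longrightarrow> U' \<subseteq> U"
  by (induction rule: strip.induct) auto

lemma strip_exists:
  assumes "finite U"
  shows "\<exists>as U'. strip E U as U' \<and> (\<forall>a\<in>U'. \<forall>b\<in>U'. a \<noteq> b \<longrightarrow> neighbours E U' b \<noteq> {a})"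
  using assms
proof (induction "card U" arbitrary: U rule: less_induct)
  case less
  show ?case
  proof (cases "\<exists>a\<in>U. \<exists>b\<in>U. a \<noteq> b \<and> neighbours E U b = {a}")
    case True
    then obtain a b where ab: "a \<in> U" "b \<in> U" "a \<noteq> b" "neighbours E U b = {a}" by blast
    let ?U = "U - insert a (neighbours E U a)"
    have "card ?U < card U" using less.prems ab(1) by (intro psubset_card_mono) auto
    then obtain as U' where "strip E ?U as U'" "\<forall>a\<in>U'. \<forall>b\<in>U'. a \<noteq> b \<longrightarrow> neighbours E U' b \<noteq> {a}"
      using less.hyps[of ?U] less.prems by auto
    with strip_Cons[OF ab] show ?thesis by blast
  next
    case False
    then show ?thesis using strip_Nil[of E U] by blast
  qed
qed

text \<open>Stripping commutes with restriction to \<open>insert v K\<close> because the surviving vertex \<open>v\<close> separates \<open>K\<close>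
  from the rest.\<close>

lemma strip_restrict:
  assumes "strip E U as U'" "v \<in> U'" "v \<notin> K"
    and nbr: "\<And>x y. x \<in> K \<Longrightarrow> {x, y} \<in> E \<Longrightarrow> y \<in> insert v K"
  shows "strip (induced_edges E (insert v K)) (U \<inter> insert v K) (filter (\<lambda>a. a \<in> K) as) (U' \<inter> insert v K)"
  using assms(1,2)
proof (induction rule: strip.induct)
  case (strip_Nil U)
  show ?case by (simp add: strip.strip_Nil)
next
  case (strip_Cons a U b as U')
  let ?T = "insert v K"
  let ?E = "induced_edges E ?T"
  let ?U = "U - insert a (neighbours E U a)"
  have v: "v \<in> ?U" using strip_subset[OF strip_Cons(5)] strip_Cons(7) by blast
  have IH: "strip ?E (?U \<inter> ?T) (filter (\<lambda>a. a \<in> K) as) (U' \<inter> ?T)" using strip_Cons by blast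
  have ba: "{b, a} \<in> E" using strip_Cons(4) by (auto simp: neighbours_def)
  have N: "neighbours ?E (U \<inter> ?T) x = neighbours E U x \<inter> ?T" if "x \<in> ?T" for x
    using that by (auto simp: neighbours_def induced_edges_def)
  show ?case
  proof (cases "a \<in> K")
    case True
    then have "b \<in> ?T" using nbr[of a b] ba by (simp add: insert_commute)
    \<comment> \<open>\<open>b\<close> is removed as a neighbour of \<open>a\<close>, whereas
      \<open>v\<close> survives.\<close>
    moreover have "b \<noteq> v" using v ba strip_Cons(2) by (auto simp: neighbours_def insert_commute)
    moreover have "?U \<inter> ?T = U \<inter> ?T - insert a (neighbours ?E (U \<inter> ?T) a)"
      using True N[of a] by auto
    moreover have "neighbours ?E (U \<inter> ?T) b = {a}"
      using N[of b] calculation True strip_Cons(4) by simp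
    ultimately show ?thesis
      using True IH strip_Cons(1-3) strip.strip_Cons[of a "U \<inter> ?T" b ?E] by simp
  next
    case False
    \<comment> \<open>A neighbour of \<open>a\<close> in \<open>K\<close> would put \<open>a\<close>
      into \<open>insert v K\<close>, and \<open>v\<close> is not a neighbour of \<open>a\<close>
      because it survives. The step thus does not touch the restricted graph.\<close>
    have "x \<notin> ?T" if x: "x \<in> neighbours E U a" for x
    proof
      assume "x \<in> ?T"
      moreover have "x \<noteq> v" using v x by auto
      ultimately have "x \<in> K" "{x, a} \<in> E" using x by (auto simp: neighbours_def insert_commute)
      then have "a \<in> ?T" using nbr by blast
      with False v show False by auto
    qed
    moreover have "a \<notin> ?T" using False v by auto
    ultimately have "?U \<inter> ?T = U \<inter> ?T" by auto
    then show ?thesis using IH False by simp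
  qed
qed

text \<open>\<open>K\<close> is disjoint from the cycle by \<open>cycle_components_separate\<close>,
  and its edges stay in \<open>insert v K\<close>. A stripping that leaves exactly the cycle
  therefore restricts to one of the tentacle that leaves exactly \<open>v\<close>.\<close>

proposition strip_tentacle:
  assumes G: "finite_simple_graph V E" and h: "h1 V E = 1"
    and strip: "strip E V as (\<Union>(the_cycle E))"
    and T: "(V\<^sub>T, E\<^sub>T) \<in> tree_tentacles V E"
  shows "\<exists>as v. strip E\<^sub>T V\<^sub>T as {v} \<and> finite V\<^sub>T \<and> (\<forall>e\<in>E\<^sub>T. e \<subseteq> V\<^sub>T \<and> card e = 2)"
proof -
  let ?C = "the_cycle E"
  let ?F = "E - ?C"
  have C: "is_cycle E ?C" using unique_cycle(1)[OF G h] .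
  obtain v K where v: "v \<in> \<Union>?C" and
    K: "K \<in> components (component_of V ?F v - {v}) (induced_edges ?F (component_of V ?F v - {v}))"
    and VT: "V\<^sub>T = insert v K" and ET: "E\<^sub>T = induced_edges ?F (insert v K)"
    using T by (auto simp: tree_tentacles_def tentacles_at_def Let_def)
  let ?H = "component_of V ?F v"
  let ?I = "induced_edges ?F (?H - {v})"
  obtain k where k: "k \<in> ?H - {v}" "K = component_of (?H - {v}) ?I k"
    using K by (auto simp: components_def)
  have KH: "K \<subseteq> ?H - {v}" using k by (auto simp: component_of_def)
  have KC: "K \<inter> \<Union>?C = {}"
    using KH cycle_components_separate[OF G h C v] by (auto simp: component_of_def)
  have nbr: "y \<in> insert v K" if x: "x \<in> K" and xy: "{x, y} \<in> E" for x y
  proof (cases "y = v")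
    case False
    have "{x, y} \<notin> ?C" using x KC by auto
    then have F: "{x, y} \<in> ?F" using xy by simp
    have "y \<in> V" using finite_simple_graphD(3)[OF G xy] by simp
    moreover have "(v, x) \<in> (adjacency ?F)\<^sup>*" using x KH by (auto simp: component_of_def)
    then have "(v, y) \<in> (adjacency ?F)\<^sup>*" using F by (simp add: rtrancl.rtrancl_into_rtrancl)
    ultimately have y: "y \<in> ?H - {v}" using False by (simp add: component_of_def)
    have "{x, y} \<in> ?I" using F y x KH by (auto simp: induced_edges_def)
    moreover have "(k, x) \<in> (adjacency ?I)\<^sup>*" using x k by (simp add: component_of_def)
    ultimately have "(k, y) \<in> (adjacency ?I)\<^sup>*" by (simp add: rtrancl.rtrancl_into_rtrancl)
    then show ?thesis using y k by (simp add: component_of_def)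
  qed simp
  \<comment> \<open>The tentacle is induced from the edges off the cycle. Inducing from
    \<open>E\<close> gives the same graph, since \<open>v\<close> is its only vertex on the cycle
    and a cycle edge has two.\<close>
  have ET': "E\<^sub>T = induced_edges E (insert v K)"
  proof -
    have "e \<notin> ?C" if "e \<in> E" "e \<subseteq> insert v K" for e
    proof
      assume "e \<in> ?C"
      then have "e \<subseteq> {v}" using that(2) KC by auto
      then have "card e \<le> 1" using card_mono[of "{v}" e] by simp
      with finite_simple_graphD(4)[OF G that(1)] show False by simp
    qed
    then show ?thesis unfolding ET by (auto simp: induced_edges_def)
  qed
  have "v \<in> V" using v C finite_simple_graphD(3)[OF G] by (auto simp: is_cycle_def)
  moreover have "K \<subseteq> V" using KH by (auto simp: component_of_def)
  ultimately have sub: "insert v K \<subseteq> V" by simp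
  have "strip (induced_edges E (insert v K)) (V \<inter> insert v K) (filter (\<lambda>a. a \<in> K) as) (\<Union>?C \<inter> insert v K)"
  proof (rule strip_restrict[OF strip v _ nbr])
    show "v \<notin> K" using KH by blast
  qed
  moreover have "V \<inter> insert v K = V\<^sub>T" "\<Union>?C \<inter> insert v K = {v}" using sub VT v KC by auto
  ultimately have "strip E\<^sub>T V\<^sub>T (filter (\<lambda>a. a \<in> K) as) {v}" using ET' by simp
  moreover have "finite V\<^sub>T" using finite_subset[OF sub] VT finite_simple_graphD(1)[OF G] by simp
  moreover have "\<forall>e\<in>E\<^sub>T. e \<subseteq> V\<^sub>T \<and> card e = 2"
    using finite_simple_graphD(4)[OF G] by (auto simp: ET' VT induced_edges_def)
  ultimately show ?thesis by blast
qed

section \<open>Homotopy type along a stripping sequence\<close>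

lemma indep_complex_fold_set:
  assumes "finite W" "b \<in> W" "finite S" "b \<notin> S" "a \<noteq> b"
    and b: "\<And>e. e \<in> F \<Longrightarrow> b \<in> e \<Longrightarrow> e = {a, b}"
    and S: "\<And>v. v \<in> S \<Longrightarrow> {a, v} \<in> F"
  shows "geometric_realization (indep_complex W F) homotopy_equivalent_space
    geometric_realization (indep_complex (W - S) F)"
  using assms(3,4,7)
proof (induction S rule: finite_induct)
  case empty
  show ?case by (simp add: homotopy_equivalent_space_refl)
next
  \<comment> \<open>The conditions on \<open>a\<close> and \<open>b\<close> concern \<open>F\<close>
    alone, so they persist while the vertex set shrinks.\<close>
  case (insert v S)
  have "geometric_realization (indep_complex (W - S) F) homotopy_equivalent_space
      geometric_realization (indep_complex (W - S - {v}) F)"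
  proof (rule indep_complex_fold[where w = b])
    fix e assume "e \<in> F" "b \<in> e"
    then have "e = {a, b}" by (rule b)
    moreover have "{a, v} \<in> F" using insert.prems(2) by simp
    ultimately show "\<exists>y\<in>e. y \<noteq> b \<and> {y, v} \<in> F" using assms(5) by blast
  qed (use assms(1,2) insert.prems(1) in auto)
  moreover have "geometric_realization (indep_complex W F) homotopy_equivalent_space
      geometric_realization (indep_complex (W - S) F)"
    using insert by auto
  moreover have "W - S - {v} = W - insert v S" by auto
  ultimately show ?case using homotopy_eqv_trans by metis
qed

text \<open>\<open>N\<close> holds the isolated edges split off so far. The clause on
  \<open>N'\<close> being nonempty matters when every vertex is stripped, since only a nonempty
  matching gives a sphere.\<close>

proposition strip_homotopy_equivalent:
  assumes "strip E U as U'" "finite U" "\<And>e. e \<in> E \<Longrightarrow> card e = 2"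
    and "matching N" "U \<inter> \<Union>N = {}"
  shows "\<exists>N'. matching N' \<and> U' \<inter> \<Union>N' = {} \<and> (as \<noteq> [] \<or> N \<noteq> {} \<longrightarrow> N' \<noteq> {}) \<and>
    geometric_realization (indep_complex (U \<union> \<Union>N) (induced_edges E U \<union> N)) homotopy_equivalent_space
    geometric_realization (indep_complex (U' \<union> \<Union>N') (induced_edges E U' \<union> N'))"
  using assms(1,2,4,5)
proof (induction arbitrary: N rule: strip.induct)
  case (strip_Nil U)
  then show ?case by (metis homotopy_equivalent_space_refl)
next
  case (strip_Cons a U b as U')
  let ?U = "U - insert a (neighbours E U a)"
  let ?N = "insert {a, b} N"
  let ?F = "induced_edges E U \<union> N"
  define S where "S = neighbours E U a - {b}"
  have abE: "{a, b} \<in> E" "{b, a} \<in> E" using strip_Cons(4) by (auto simp: neighbours_def insert_commute)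
  have notN: "x \<notin> e" if "e \<in> N" "x \<in> U" for e x using that strip_Cons.prems(3) by blast
  have noloop: "{x} \<notin> E" for x using assms(3)[of "{x}"] by auto
  have edge: "\<exists>y. e = {x, y} \<and> y \<noteq> x" if "e \<in> E" "x \<in> e" for e x
    using assms(3)[OF that(1)] that(2) by (auto simp: card_2_iff)
  have SU: "S \<subseteq> U" by (auto simp: S_def neighbours_def)
  have bedge: "e = {a, b}" if e: "e \<in> ?F" "b \<in> e" for e
  proof -
    have eE: "e \<in> E" "e \<subseteq> U" using e notN strip_Cons(2) by (auto simp: induced_edges_def)
    then obtain y where y: "e = {b, y}" using edge e(2) by blast
    then have "y \<in> neighbours E U b" using eE by (simp add: neighbours_def)
    then show ?thesis using y strip_Cons(4) by auto
  qed
  have fold: "geometric_realization (indep_complex (U \<union> \<Union>N) ?F) homotopy_equivalent_space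
      geometric_realization (indep_complex (U \<union> \<Union>N - S) ?F)"
  proof (rule indep_complex_fold_set)
    show "finite (U \<union> \<Union>N)" using strip_Cons.prems finite_Union_matching by blast
    show "finite S" using strip_Cons.prems(1) SU finite_subset by blast
    show "e = {a, b}" if "e \<in> ?F" "b \<in> e" for e using bedge that .
    show "{a, v} \<in> ?F" if "v \<in> S" for v
      using that strip_Cons(1) by (auto simp: S_def neighbours_def induced_edges_def)
  qed (use strip_Cons(2,3) in \<open>auto simp: S_def\<close>)
  have W: "U \<union> \<Union>N - S = ?U \<union> \<Union>?N"
  proof -
    have "S \<inter> \<Union>N = {}" using SU strip_Cons.prems(3) by blast
    moreover have "insert a (neighbours E U a) = S \<union> {a, b}"
      using abE strip_Cons(2) by (auto simp: S_def neighbours_def)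
    moreover have "a \<notin> S" using noloop by (auto simp: S_def neighbours_def)
    ultimately show ?thesis using strip_Cons(1,2) SU by (auto simp: S_def)
  qed
  \<comment> \<open>Once \<open>S\<close> is gone, \<open>ab\<close> is the only edge left at
    \<open>a\<close> or \<open>b\<close>, so it belongs to the matching and the other edges lie in
    \<open>?U\<close>.\<close>
  have cong: "indep_complex (U \<union> \<Union>N - S) ?F = indep_complex (U \<union> \<Union>N - S) (induced_edges E ?U \<union> ?N)"
  proof (rule indep_complex_cong)
    fix e assume eW: "e \<subseteq> U \<union> \<Union>N - S"
    show "e \<in> ?F \<longleftrightarrow> e \<in> induced_edges E ?U \<union> ?N"
    proof
      assume e: "e \<in> ?F"
      show "e \<in> induced_edges E ?U \<union> ?N"
      proof (cases "e \<in> N \<or> e = {a, b}")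
        case False
        then have eE: "e \<in> E" "e \<subseteq> U" using e by (auto simp: induced_edges_def)
        have "b \<notin> e" using bedge[OF e] False by blast
        moreover have "a \<notin> e"
        proof
          assume "a \<in> e"
          then obtain y where y: "e = {a, y}" using edge eE by blast
          then have "y \<in> neighbours E U a" using eE by (simp add: neighbours_def)
          moreover have "y \<notin> S" using eW y by auto
          ultimately have "y = b" by (simp add: S_def)
          with y False show False by simp
        qed
        moreover have "e \<inter> S = {}" using eW by auto
        ultimately have "e \<subseteq> ?U" using eE by (auto simp: S_def)
        then show ?thesis using eE by (simp add: induced_edges_def)
      qed auto
    next
      assume "e \<in> induced_edges E ?U \<union> ?N"
      then show "e \<in> ?F" using abE strip_Cons(1,2) by (auto simp: induced_edges_def)
    qed
  qed
  have M: "matching ?N"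
    using strip_Cons.prems strip_Cons(1-3) by (intro matching_insert) auto
  have disj: "?U \<inter> \<Union>?N = {}"
    using strip_Cons.prems(3) abE strip_Cons(2) by (auto simp: neighbours_def)
  have "finite ?U" using strip_Cons.prems(1) by simp
  from strip_Cons.IH[OF this M disj] obtain N' where N': "matching N'" "U' \<inter> \<Union>N' = {}" "N' \<noteq> {}"
    "geometric_realization (indep_complex (?U \<union> \<Union>?N) (induced_edges E ?U \<union> ?N)) homotopy_equivalent_space
      geometric_realization (indep_complex (U' \<union> \<Union>N') (induced_edges E U' \<union> N'))"
    by blast
  have "geometric_realization (indep_complex (U \<union> \<Union>N) ?F) homotopy_equivalent_space
      geometric_realization (indep_complex (U' \<union> \<Union>N') (induced_edges E U' \<union> N'))"
    using homotopy_eqv_trans[OF fold[unfolded cong, unfolded W] N'(4)] .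
  with N' show ?case by blast
qed

text \<open>The third alternative also returns the stripping, known to end in the vertices of the
  cycle; the resolutions of the tentacles are cut out of it.\<close>

proposition indep_complex_trichotomy:
  assumes G: "finite_simple_graph V E" and h: "h1 V E = 1"
  defines "X \<equiv> geometric_realization (indep_complex V E)"
  obtains "contractible_space X" | "homotopy_sphere_type X"
  | as where "homotopy_double_sphere_type X" "card (the_cycle E) mod 3 = 0" "strip E V as (\<Union>(the_cycle E))"
proof -
  have fin: "finite V" and card2: "\<And>e. e \<in> E \<Longrightarrow> card e = 2" using finite_simple_graphD[OF G] by auto
  obtain as U where strip: "strip E V as U"
    and noleaf: "\<And>a b. a \<in> U \<Longrightarrow> b \<in> U \<Longrightarrow> a \<noteq> b \<Longrightarrow> neighbours E U b \<noteq> {a}"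
    using strip_exists[OF fin, of E] by blast
  have UV: "U \<subseteq> V" using strip_subset[OF strip] .
  have V: "V \<union> \<Union>{} = V" "induced_edges E V \<union> {} = E"
    using finite_simple_graphD(3)[OF G] by (auto simp: induced_edges_def)
  have M0: "matching {}" by (simp add: matching_def)
  obtain N where N: "matching N" "U \<inter> \<Union>N = {}" "as \<noteq> [] \<longrightarrow> N \<noteq> {}"
    and eqv: "X homotopy_equivalent_space geometric_realization (indep_complex (U \<union> \<Union>N) (induced_edges E U \<union> N))"
    using strip_homotopy_equivalent[OF strip fin card2 M0] unfolding V X_def by auto
  have C: "is_cycle E (the_cycle E)" using unique_cycle(1)[OF G h] .
  consider "U = {}" | b where "b \<in> U" "neighbours E U b = {}"
    | "U \<noteq> {}" "\<forall>b\<in>U. neighbours E U b \<noteq> {}" by blast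
  then show thesis
  proof cases
    case 1
    \<comment> \<open>The cycle makes \<open>V\<close> nonempty, so at least one step was made and
      the matching is nonempty.\<close>
    obtain e where "e \<in> the_cycle E" using is_cycle_nonempty[OF C] by blast
    then have "e \<in> E" using C by (auto simp: is_cycle_iff)
    then have "V \<noteq> {}" using finite_simple_graphD(3)[OF G] card2 by fastforce
    then have "as \<noteq> []" using strip 1 by (auto elim: strip.cases)
    then have "N \<noteq> {}" using N by blast
    moreover have "induced_edges E U = {}" using 1 card2[of "{}"] by (auto simp: induced_edges_def)
    ultimately have "homotopy_sphere_type X"
      using matching_homotopy_sphere[OF N(1)] homotopy_sphere_type_equivalent eqv 1 by simp
    then show thesis by (rule that)
  next
    case (2 b)
    have "b \<notin> \<Union>(induced_edges E U \<union> N)"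
    proof
      assume "b \<in> \<Union>(induced_edges E U \<union> N)"
      then obtain e where e: "e \<in> E" "e \<subseteq> U" "b \<in> e" using N(2) 2(1) by (auto simp: induced_edges_def)
      then obtain y where "e = {b, y}" using card2[OF e(1)] by (auto simp: card_2_iff)
      with e 2(2) show False by (auto simp: neighbours_def)
    qed
    moreover have "finite (U \<union> \<Union>N)" using finite_subset[OF UV fin] finite_Union_matching[OF N(1)] by simp
    ultimately have "contractible_space X"
      using indep_complex_contractible[of "U \<union> \<Union>N" b] 2(1)
        homotopy_equivalent_space_contractibility[OF eqv] by blast
    then show thesis by (rule that)
  next
    case 3
    have "2 \<le> card (neighbours E U b)" if b: "b \<in> U" for b
    proof -
      have "b \<notin> neighbours E U b" using card2[of "{b}"] by (auto simp: neighbours_def)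
      have "card (neighbours E U b) \<noteq> 1"
      proof
        assume "card (neighbours E U b) = 1"
        then obtain x where x: "neighbours E U b = {x}" by (rule card_1_singletonE)
        then have "x \<in> U" by (auto simp: neighbours_def)
        moreover have "x \<noteq> b" using x \<open>b \<notin> neighbours E U b\<close> by simp
        ultimately show False using noleaf[OF _ b] x by blast
      qed
      moreover have "finite (neighbours E U b)" using finite_subset[OF UV fin] by (simp add: neighbours_def)
      then have "card (neighbours E U b) \<noteq> 0" using 3(2) b by simp
      ultimately show ?thesis by linarith
    qed
    from min_degree_two_is_cycle[OF G h UV 3(1) this]
    have U: "U = \<Union>(the_cycle E)" "induced_edges E U = the_cycle E" by blast+
    obtain vs where vs: "distinct vs" "3 \<le> length vs" "the_cycle E = cycle_edges vs"
      using C by (auto simp: is_cycle_iff)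
    have "\<Union>(the_cycle E) = set vs" using vs Union_cycle_edges[of vs] by simp
    then have Us: "U = set vs" "induced_edges E U = cycle_edges vs" using U vs by simp_all
    have n: "card (the_cycle E) = length vs" using card_cycle_edges vs by metis
    have type: "if length vs mod 3 = 0
        then homotopy_double_sphere_type (geometric_realization (indep_complex (U \<union> \<Union>N) (induced_edges E U \<union> N)))
        else homotopy_sphere_type (geometric_realization (indep_complex (U \<union> \<Union>N) (induced_edges E U \<union> N)))"
    proof -
      have "set vs \<inter> \<Union>N = {}" using N(2) Us(1) by simp
      from cycle_homotopy_type[OF vs(1,2) N(1) this] show ?thesis unfolding Us(2) unfolding Us(1) .
    qed
    show thesis
    proof (cases "length vs mod 3 = 0")
      case True
      have "homotopy_double_sphere_type X"
        using homotopy_double_sphere_type_equivalent[OF eqv type[unfolded if_P[OF True]]] .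
      then show thesis using that(3)[OF _ _ strip[unfolded U(1)]] True n by simp
    next
      case False
      have "homotopy_sphere_type X"
        using homotopy_sphere_type_equivalent[OF eqv type[unfolded if_not_P[OF False]]] .
      then show thesis by (rule that)
    qed
  qed
qed

section \<open>Monomial ideals and resolutions\<close>

text \<open>Membership is tested term by term, so equalities between ideals reduce to equalities
  between sets of monomials. It is an ideal if \<open>S\<close> is closed under multiplication by
  monomials.\<close>

definition monomial_ideal :: "'a set \<Rightarrow> ('a \<Rightarrow>\<^sub>0 nat) set \<Rightarrow> 'a zpoly set" where
  "monomial_ideal X S = {p. \<forall>m\<in>Poly_Mapping.keys p. Poly_Mapping.keys m \<subseteq> X \<and> m \<in> S}"

lemma zpoly_ring_simps [simp]:
  "x \<oplus>\<^bsub>zpoly_ring X\<^esub> y = x + y" "x \<otimes>\<^bsub>zpoly_ring X\<^esub> y = x * y"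
  "\<zero>\<^bsub>zpoly_ring X\<^esub> = 0" "\<one>\<^bsub>zpoly_ring X\<^esub> = 1"
  by (simp_all add: zpoly_ring_def)

lemma carrier_zpoly_ring: "p \<in> carrier (zpoly_ring X) \<longleftrightarrow> (\<forall>m\<in>Poly_Mapping.keys p. Poly_Mapping.keys m \<subseteq> X)"
  by (simp add: zpoly_ring_def)

lemma keys_monomial [simp]: "Poly_Mapping.keys (monomial m) = {m}"
  by (simp add: monomial_def)

lemma monomial_mult: "monomial m * monomial k = monomial (m + k)"
  by (simp add: monomial_def mult_single)

lemma keys_add_nat: "Poly_Mapping.keys (m + k :: 'a \<Rightarrow>\<^sub>0 nat) = Poly_Mapping.keys m \<union> Poly_Mapping.keys k"
  by (auto simp: in_keys_iff lookup_add)

lemma monomial_in_monomial_ideal [simp]: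
  "monomial m \<in> monomial_ideal X S \<longleftrightarrow> Poly_Mapping.keys m \<subseteq> X \<and> m \<in> S"
  by (simp add: monomial_ideal_def)

lemma ideal_monomial_ideal:
  assumes up: "\<And>m k. m \<in> S \<Longrightarrow> m + k \<in> S"
  shows "ideal (monomial_ideal X S) (zpoly_ring X)"
proof (rule idealI)
  interpret cring "zpoly_ring X" by (rule cring_zpoly_ring)
  show "ring (zpoly_ring X)" by (rule ring_axioms)
  have add: "p + q \<in> monomial_ideal X S" if "p \<in> monomial_ideal X S" "q \<in> monomial_ideal X S" for p q
    using that keys_add[of p q] unfolding monomial_ideal_def by blast
  show "subgroup (monomial_ideal X S) (add_monoid (zpoly_ring X))"
  proof (rule add.subgroupI)
    show "monomial_ideal X S \<subseteq> carrier (zpoly_ring X)"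
      by (auto simp: monomial_ideal_def carrier_zpoly_ring)
    show "monomial_ideal X S \<noteq> {}"
    proof -
      have "0 \<in> monomial_ideal X S" by (simp add: monomial_ideal_def)
      then show ?thesis by blast
    qed
    show "\<ominus>\<^bsub>zpoly_ring X\<^esub> p \<in> monomial_ideal X S" if p: "p \<in> monomial_ideal X S" for p
    proof -
      have "- p \<in> carrier (zpoly_ring X)" "p \<in> carrier (zpoly_ring X)"
        using p by (auto simp: monomial_ideal_def carrier_zpoly_ring)
      then have "\<ominus>\<^bsub>zpoly_ring X\<^esub> p = - p" by (intro minus_equality) simp_all
      then show ?thesis using p by (simp add: monomial_ideal_def)
    qed
    show "p \<oplus>\<^bsub>zpoly_ring X\<^esub> q \<in> monomial_ideal X S"
      if "p \<in> monomial_ideal X S" "q \<in> monomial_ideal X S" for p q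
      using add[OF that] by simp
  qed
  have mult: "q * p \<in> monomial_ideal X S" if p: "p \<in> monomial_ideal X S" and q: "q \<in> carrier (zpoly_ring X)" for p q
    unfolding monomial_ideal_def
  proof (rule CollectI, rule ballI)
    fix m assume "m \<in> Poly_Mapping.keys (q * p)"
    then obtain a b where ab: "m = a + b" "a \<in> Poly_Mapping.keys q" "b \<in> Poly_Mapping.keys p"
      using keys_mult[of q p] by blast
    then have "Poly_Mapping.keys a \<subseteq> X" "Poly_Mapping.keys b \<subseteq> X" "b \<in> S"
      using p q by (auto simp: monomial_ideal_def carrier_zpoly_ring)
    then show "Poly_Mapping.keys m \<subseteq> X \<and> m \<in> S"
      using up[of b a] by (simp add: ab(1) keys_add_nat add.commute)
  qed
  show "q \<otimes>\<^bsub>zpoly_ring X\<^esub> p \<in> monomial_ideal X S" "p \<otimes>\<^bsub>zpoly_ring X\<^esub> q \<in> monomial_ideal X S"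
    if "p \<in> monomial_ideal X S" "q \<in> carrier (zpoly_ring X)" for p q
    using mult[OF that] by (simp_all add: mult.commute)
qed

lemma sum_single_lookup:
  fixes p :: "'b \<Rightarrow>\<^sub>0 'c::comm_monoid_add"
  shows "(\<Sum>m\<in>Poly_Mapping.keys p. Poly_Mapping.single m (Poly_Mapping.lookup p m)) = p"
  by (intro poly_mapping_eqI) (simp add: lookup_sum lookup_single when_def in_keys_iff)

lemma monomial_ideal_subset_ideal:
  assumes I: "ideal I (zpoly_ring X)"
    and S: "\<And>m. Poly_Mapping.keys m \<subseteq> X \<Longrightarrow> m \<in> S \<Longrightarrow> monomial m \<in> I"
  shows "monomial_ideal X S \<subseteq> I"
proof
  interpret ideal I "zpoly_ring X" by (rule I)
  fix p assume "p \<in> monomial_ideal X S"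
  then have keys: "Poly_Mapping.keys m \<subseteq> X \<and> m \<in> S" if "m \<in> Poly_Mapping.keys p" for m
    using that by (auto simp: monomial_ideal_def)
  have sum: "(\<Sum>m\<in>A. Poly_Mapping.single m (Poly_Mapping.lookup p m)) \<in> I"
    if "finite A" "A \<subseteq> Poly_Mapping.keys p" for A
    using that
  proof (induction A rule: finite_induct)
    case empty
    then show ?case using additive_subgroup.zero_closed[OF ideal.axioms(1)[OF I]] by simp
  next
    case (insert m A)
    let ?c = "Poly_Mapping.single 0 (Poly_Mapping.lookup p m)"
    have "?c \<in> carrier (zpoly_ring X)" by (simp add: carrier_zpoly_ring)
    moreover have "monomial m \<in> I" using keys[of m] S insert.prems by simp
    ultimately have "?c * monomial m \<in> I" using I_l_closed[of "monomial m" ?c] by simp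
    then have "Poly_Mapping.single m (Poly_Mapping.lookup p m) \<in> I"
      by (simp add: monomial_def mult_single)
    then show ?case using insert additive_subgroup.a_closed[OF ideal.axioms(1)[OF I]] by simp
  qed
  show "p \<in> I" using sum[of "Poly_Mapping.keys p"] sum_single_lookup[of p] by simp
qed

lemma genideal_monomials:
  assumes up: "\<And>m k. m \<in> S \<Longrightarrow> m + k \<in> S"
    and gens: "A \<subseteq> monomial_ideal X S"
    and gen: "\<And>m. Poly_Mapping.keys m \<subseteq> X \<Longrightarrow> m \<in> S \<Longrightarrow>
      \<exists>k l. m = k + l \<and> Poly_Mapping.keys k \<subseteq> X \<and> monomial l \<in> A"
  shows "genideal (zpoly_ring X) A = monomial_ideal X S"
proof
  interpret cring "zpoly_ring X" by (rule cring_zpoly_ring)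
  have I: "ideal (monomial_ideal X S) (zpoly_ring X)" using up by (rule ideal_monomial_ideal)
  show "genideal (zpoly_ring X) A \<subseteq> monomial_ideal X S"
    using genideal_minimal[OF I gens] .
  have A: "A \<subseteq> carrier (zpoly_ring X)"
    using gens by (auto simp: monomial_ideal_def carrier_zpoly_ring)
  have G: "ideal (genideal (zpoly_ring X) A) (zpoly_ring X)" using genideal_ideal[OF A] .
  show "monomial_ideal X S \<subseteq> genideal (zpoly_ring X) A"
  proof (rule monomial_ideal_subset_ideal[OF G])
    fix m assume "Poly_Mapping.keys m \<subseteq> X" "m \<in> S"
    then obtain k l where kl: "m = k + l" "Poly_Mapping.keys k \<subseteq> X" "monomial l \<in> A" using gen by blast
    then have "monomial l \<in> genideal (zpoly_ring X) A" using genideal_self[OF A] by blast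
    moreover have "monomial k \<in> carrier (zpoly_ring X)" using kl by (simp add: carrier_zpoly_ring)
    ultimately have "monomial k * monomial l \<in> genideal (zpoly_ring X) A"
      using ideal.I_l_closed[OF G, of "monomial l" "monomial k"] by simp
    then show "monomial m \<in> genideal (zpoly_ring X) A" using kl(1) by (simp add: monomial_mult)
  qed
qed

text \<open>Multiplication by a monomial shifts exponents injectively, so no terms cancel and the
  quotient can be computed on each term separately.\<close>

lemma ideal_colon_monomial_ideal:
  assumes "Poly_Mapping.keys k \<subseteq> X"
  shows "ideal_colon X (monomial_ideal X S) (monomial k) = monomial_ideal X {m. k + m \<in> S}"
proof -
  have keys: "Poly_Mapping.keys (monomial k * q) = (\<lambda>m. k + m) ` Poly_Mapping.keys q" for q :: "'a zpoly"
  proof -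
    have "monomial k * q = (\<Sum>x\<in>Poly_Mapping.keys q. Poly_Mapping.single (k + x) (Poly_Mapping.lookup q x))"
      by (subst sum_single_lookup[of q, symmetric]) (simp add: sum_distrib_left monomial_def mult_single)
    then have lookup: "Poly_Mapping.lookup (monomial k * q) (k + m) = Poly_Mapping.lookup q m" for m
      by (simp add: lookup_sum lookup_single when_def in_keys_iff)
    have "Poly_Mapping.keys (monomial k * q) \<subseteq> (\<lambda>m. k + m) ` Poly_Mapping.keys q"
      using keys_mult[of "monomial k" q] by auto
    with lookup show ?thesis by (auto simp: in_keys_iff)
  qed
  show ?thesis
    using assms unfolding ideal_colon_def monomial_ideal_def mem_Collect_eq keys carrier_zpoly_ring
    by (auto simp: keys_add_nat)
qed

text \<open>\<open>graph_nonface E U\<close> consists of the monomials that are not faces of the independence complex of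
  the subgraph induced by \<open>U\<close>; it describes \<open>(I : a\<^sub>1 \<cdots> a\<^sub>i)\<close> when \<open>U\<close> is what remains after deleting
  the closed neighbourhoods of \<open>a\<^sub>1, \<dots>, a\<^sub>i\<close>.\<close>

definition graph_nonface :: "'a set set \<Rightarrow> 'a set \<Rightarrow> ('a \<Rightarrow>\<^sub>0 nat) set" where
  "graph_nonface E U = {m. \<not> Poly_Mapping.keys m \<subseteq> U \<or> (\<exists>v. 2 \<le> Poly_Mapping.lookup m v) \<or>
    (\<exists>e\<in>E. e \<subseteq> Poly_Mapping.keys m)}"

abbreviation vertex_ideal :: "'a set \<Rightarrow> 'a set set \<Rightarrow> 'a set \<Rightarrow> 'a zpoly set" where
  "vertex_ideal X E U \<equiv> monomial_ideal X (graph_nonface E U)"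

lemma graph_nonface_up: "m \<in> graph_nonface E U \<Longrightarrow> m + k \<in> graph_nonface E U"
  unfolding graph_nonface_def by (auto simp: keys_add_nat lookup_add intro: trans_le_add1)

lemma minus_add_cancel_lookup: "(\<And>v. Poly_Mapping.lookup l v \<le> Poly_Mapping.lookup m v) \<Longrightarrow> (m - l) + l = (m :: 'a \<Rightarrow>\<^sub>0 nat)"
  by (intro poly_mapping_eqI) (simp add: lookup_add lookup_minus)

lemma keys_minus_subset: "Poly_Mapping.keys (m - l) \<subseteq> Poly_Mapping.keys (m :: 'a \<Rightarrow>\<^sub>0 nat)"
  by (auto simp: in_keys_iff lookup_minus)

lemma graph_ideal_eq:
  assumes E: "\<And>e. e \<in> E \<Longrightarrow> e \<subseteq> V \<and> card e = 2"
  shows "graph_ideal V E = vertex_ideal V E V"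
  unfolding graph_ideal_def
proof (rule genideal_monomials)
  let ?s = "\<lambda>v::'a. Poly_Mapping.single v (1::nat)"
  have sq: "(var v)\<^sup>2 = monomial (?s v + ?s v)" for v
    by (simp add: var_def monomial_mult power2_eq_square)
  have ed: "var u * var v = monomial (?s u + ?s v)" for u v
    by (simp add: var_def monomial_mult)
  show "{(var v)\<^sup>2 | v. v \<in> V} \<union> {var u * var v | u v. {u, v} \<in> E} \<subseteq> vertex_ideal V E V"
  proof
    fix p assume "p \<in> {(var v)\<^sup>2 | v. v \<in> V} \<union> {var u * var v | u v. {u, v} \<in> E}"
    then consider v where "v \<in> V" "p = monomial (?s v + ?s v)"
      | u w where "{u, w} \<in> E" "p = monomial (?s u + ?s w)"
      by (auto simp: sq ed)
    then show "p \<in> vertex_ideal V E V"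
    proof cases
      case (1 v)
      have "2 \<le> Poly_Mapping.lookup (?s v + ?s v) v" by (simp add: lookup_add)
      then have "?s v + ?s v \<in> graph_nonface E V" unfolding graph_nonface_def by blast
      then show ?thesis using 1 by (simp add: keys_add_nat)
    next
      case (2 u w)
      have k: "Poly_Mapping.keys (?s u + ?s w) = {u, w}" by (auto simp: keys_add_nat)
      then have "?s u + ?s w \<in> graph_nonface E V" using 2(1) unfolding graph_nonface_def by blast
      then show ?thesis using 2 E[OF 2(1)] by (simp add: keys_add_nat)
    qed
  qed
  fix m :: "'a \<Rightarrow>\<^sub>0 nat" assume m: "Poly_Mapping.keys m \<subseteq> V" "m \<in> graph_nonface E V"
  have ex: "\<exists>k l. m = k + l \<and> Poly_Mapping.keys k \<subseteq> V \<and>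
      monomial l \<in> {(var v)\<^sup>2 | v. v \<in> V} \<union> {var u * var v | u v. {u, v} \<in> E}"
    if "\<And>v. Poly_Mapping.lookup l v \<le> Poly_Mapping.lookup m v"
      "monomial l \<in> {(var v)\<^sup>2 | v. v \<in> V} \<union> {var u * var v | u v. {u, v} \<in> E}" for l
    using that minus_add_cancel_lookup[OF that(1)] keys_minus_subset[of m l] m(1)
    by (intro exI[of _ "m - l"] exI[of _ l]) auto
  from m consider v where "2 \<le> Poly_Mapping.lookup m v" | e where "e \<in> E" "e \<subseteq> Poly_Mapping.keys m"
    by (auto simp: graph_nonface_def)
  then show "\<exists>k l. m = k + l \<and> Poly_Mapping.keys k \<subseteq> V \<and>
      monomial l \<in> {(var v)\<^sup>2 | v. v \<in> V} \<union> {var u * var v | u v. {u, v} \<in> E}"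
  proof cases
    case (1 v)
    have "v \<in> V" using 1 m(1) by (auto simp: in_keys_iff subset_iff)
    then have "monomial (?s v + ?s v) \<in> {(var v)\<^sup>2 | v. v \<in> V}" by (auto simp: sq)
    then show ?thesis using 1 by (intro ex[of "?s v + ?s v"]) (auto simp: lookup_add lookup_single when_def)
  next
    case (2 e)
    then obtain u w where uw: "e = {u, w}" "u \<noteq> w" using E by (meson card_2_iff)
    then have "monomial (?s u + ?s w) \<in> {var u * var v | u v. {u, v} \<in> E}" using 2 by (auto simp: ed)
    moreover have "1 \<le> Poly_Mapping.lookup m u" "1 \<le> Poly_Mapping.lookup m w"
      using 2 uw by (auto simp: in_keys_iff)
    ultimately show ?thesis using uw(2)
      by (intro ex[of "?s u + ?s w"]) (auto simp: lookup_add lookup_single when_def)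
  qed
qed (use graph_nonface_up in auto)

section \<open>Colon ideals, cone points and domination on graphs\<close>

lemma ideal_plus_vertex_ideal:
  assumes "a \<in> X"
  shows "ideal_plus X (vertex_ideal X E U) a = vertex_ideal X E (U - {a})"
  unfolding ideal_plus_def
proof (rule genideal_monomials)
  show "insert (var a) (vertex_ideal X E U) \<subseteq> vertex_ideal X E (U - {a})"
    using assms by (auto simp: var_def monomial_ideal_def graph_nonface_def)
  fix m assume m: "Poly_Mapping.keys m \<subseteq> X" "m \<in> graph_nonface E (U - {a})"
  show "\<exists>k l. m = k + l \<and> Poly_Mapping.keys k \<subseteq> X \<and> monomial l \<in> insert (var a) (vertex_ideal X E U)"
  proof (cases "a \<in> Poly_Mapping.keys m")
    case True
    let ?l = "Poly_Mapping.single a (1::nat)"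
    have "m = (m - ?l) + ?l"
      using True by (intro minus_add_cancel_lookup[symmetric]) (auto simp: lookup_single when_def in_keys_iff)
    then show ?thesis using keys_minus_subset[of m ?l] m(1) unfolding var_def by blast
  next
    case False
    then have "m \<in> graph_nonface E U" using m(2) by (auto simp: graph_nonface_def)
    then show ?thesis using m(1) by (intro exI[of _ 0] exI[of _ m]) simp
  qed
qed (use graph_nonface_up in auto)

text \<open>Multiplying by \<open>a\<close> turns a face into a nonface in two ways: a square arises
  if the face contains \<open>a\<close>, an edge if it contains a neighbour of
  \<open>a\<close>.\<close>

lemma ideal_colon_vertex_ideal:
  assumes E: "\<And>e. e \<in> E \<Longrightarrow> card e = 2" and a: "a \<in> U" "U \<subseteq> X"
  shows "ideal_colon X (vertex_ideal X E U) (var a) = vertex_ideal X E (U - insert a (neighbours E U a))"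
proof -
  let ?s = "Poly_Mapping.single a (1::nat)"
  have "?s + m \<in> graph_nonface E U \<longleftrightarrow> m \<in> graph_nonface E (U - insert a (neighbours E U a))" for m
  proof -
    have keys: "Poly_Mapping.keys (?s + m) = insert a (Poly_Mapping.keys m)" by (simp add: keys_add_nat)
    show ?thesis
    proof (cases "Poly_Mapping.keys m \<subseteq> U \<and> a \<notin> Poly_Mapping.keys m")
      case False
      then consider "\<not> Poly_Mapping.keys m \<subseteq> U" | "a \<in> Poly_Mapping.keys m" by blast
      then show ?thesis
      proof cases
        case 1
        then show ?thesis using keys by (auto simp: graph_nonface_def)
      next
        case 2
        then have "2 \<le> Poly_Mapping.lookup (?s + m) a" by (simp add: lookup_add in_keys_iff)
        then have "?s + m \<in> graph_nonface E U" unfolding graph_nonface_def by blast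
        moreover have "m \<in> graph_nonface E (U - insert a (neighbours E U a))"
          using 2 by (auto simp: graph_nonface_def)
        ultimately show ?thesis by simp
      qed
    next
      case True
      then have m: "Poly_Mapping.keys m \<subseteq> U" "a \<notin> Poly_Mapping.keys m" by auto
      have sq: "(\<exists>v. 2 \<le> Poly_Mapping.lookup (?s + m) v) \<longleftrightarrow> (\<exists>v. 2 \<le> Poly_Mapping.lookup m v)"
      proof -
        have "2 \<le> Poly_Mapping.lookup (?s + m) v \<longleftrightarrow> 2 \<le> Poly_Mapping.lookup m v" for v
          using m(2) by (cases "v = a") (auto simp: lookup_add lookup_single in_keys_iff)
        then show ?thesis by simp
      qed
      have "(\<exists>e\<in>E. e \<subseteq> insert a (Poly_Mapping.keys m)) \<longleftrightarrow>
          (\<exists>e\<in>E. e \<subseteq> Poly_Mapping.keys m) \<or> Poly_Mapping.keys m \<inter> neighbours E U a \<noteq> {}"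
      proof
        assume "\<exists>e\<in>E. e \<subseteq> insert a (Poly_Mapping.keys m)"
        then obtain e where e: "e \<in> E" "e \<subseteq> insert a (Poly_Mapping.keys m)" by blast
        show "(\<exists>e\<in>E. e \<subseteq> Poly_Mapping.keys m) \<or> Poly_Mapping.keys m \<inter> neighbours E U a \<noteq> {}"
        proof (cases "a \<in> e")
          case True
          then obtain y where y: "e = {a, y}" "y \<noteq> a" using E[OF e(1)] by (auto simp: card_2_iff)
          then have "y \<in> Poly_Mapping.keys m" using e(2) by auto
          then have "y \<in> Poly_Mapping.keys m \<inter> neighbours E U a"
            using y e(1) m(1) by (auto simp: neighbours_def)
          then show ?thesis by blast
        qed (use e in blast)
      next
        assume "(\<exists>e\<in>E. e \<subseteq> Poly_Mapping.keys m) \<or> Poly_Mapping.keys m \<inter> neighbours E U a \<noteq> {}"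
        then show "\<exists>e\<in>E. e \<subseteq> insert a (Poly_Mapping.keys m)"
        proof
          assume "Poly_Mapping.keys m \<inter> neighbours E U a \<noteq> {}"
          then obtain y where "y \<in> Poly_Mapping.keys m" "{a, y} \<in> E" by (auto simp: neighbours_def)
          then show ?thesis by (intro bexI[of _ "{a, y}"]) auto
        qed blast
      qed
      then show ?thesis
        unfolding graph_nonface_def mem_Collect_eq keys sq using m a(1) by auto
    qed
  qed
  moreover have "Poly_Mapping.keys ?s \<subseteq> X" using a by auto
  ultimately show ?thesis
    unfolding var_def by (subst ideal_colon_monomial_ideal) simp_all
qed

text \<open>\<open>(I : b)\<close> deletes the closed neighbourhood of \<open>b\<close> and
  \<open>(I, b)\<close> deletes \<open>b\<close> alone. If there is a neighbour, its variable lies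
  in only one of the two ideals.\<close>

lemma is_cone_apex_vertex_ideal:
  assumes "\<And>e. e \<in> E \<Longrightarrow> card e = 2" "b \<in> U" "U \<subseteq> X"
  shows "is_cone_apex X (vertex_ideal X E U) b \<longleftrightarrow> neighbours E U b = {}"
proof -
  have b: "b \<in> X" using assms by blast
  have *: "vertex_ideal X E (U - insert b (neighbours E U b)) = vertex_ideal X E (U - {b}) \<longleftrightarrow> neighbours E U b = {}"
  proof
    assume eq: "vertex_ideal X E (U - insert b (neighbours E U b)) = vertex_ideal X E (U - {b})"
    show "neighbours E U b = {}"
    proof (rule ccontr)
      assume "neighbours E U b \<noteq> {}"
      then obtain x where x: "x \<in> neighbours E U b" by blast
      let ?m = "Poly_Mapping.single x (1::nat)"
      have xU: "x \<in> U" "x \<noteq> b" using x assms(1)[of "{b, x}"] by (auto simp: neighbours_def)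
      have nl: "{x} \<notin> E" "{} \<notin> E" using assms(1)[of "{x}"] assms(1)[of "{}"] by auto
      have "monomial ?m \<in> vertex_ideal X E (U - insert b (neighbours E U b))"
        using x xU assms(3) by (auto simp: graph_nonface_def)
      moreover have "monomial ?m \<notin> vertex_ideal X E (U - {b})"
        using xU nl by (auto simp: graph_nonface_def lookup_single when_def subset_singleton_iff split: if_splits)
      ultimately show False using eq by blast
    qed
  qed auto
  show ?thesis
    unfolding is_cone_apex_def ideal_plus_vertex_ideal[OF b]
    using ideal_colon_vertex_ideal[OF assms(1) assms(2,3)] * by simp
qed

section \<open>Resolutions obtained from stripping sequences\<close>

lemma ideal_colon_prod_list_append:
  assumes "set as \<subseteq> X" "a \<in> X"
  shows "ideal_colon X I (prod_list (map var (as @ [a])))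
    = ideal_colon X (ideal_colon X I (prod_list (map var as))) (var a)"
proof -
  interpret cring "zpoly_ring X" by (rule cring_zpoly_ring)
  have "var a \<in> carrier (zpoly_ring X)" using assms by (simp add: var_def carrier_zpoly_ring)
  then have "var a * q \<in> carrier (zpoly_ring X)" if "q \<in> carrier (zpoly_ring X)" for q
    using m_closed[of "var a" q] that by simp
  then show ?thesis unfolding ideal_colon_def by (auto simp: mult.assoc)
qed

text \<open>\<open>pre\<close> collects the variables already divided out. It grows during the
  induction, while the ring and the ideal \<open>I\<close> remain those of the start.\<close>

lemma strip_steps:
  assumes "strip E U as U'" "\<And>e. e \<in> E \<Longrightarrow> card e = 2" "U \<subseteq> X" "set pre \<subseteq> X"
    and "ideal_colon X I (prod_list (map var pre)) = vertex_ideal X E U"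
  shows "set as \<subseteq> X" "ideal_colon X I (prod_list (map var (pre @ as))) = vertex_ideal X E U'"
    "\<And>i. i < length as \<Longrightarrow> var (as ! i) \<notin> ideal_colon X I (prod_list (map var (pre @ take i as))) \<and>
      (\<exists>b\<in>X. dominates X (ideal_colon X I (prod_list (map var (pre @ take i as)))) (as ! i) b)"
proof -
  have "set as \<subseteq> X \<and> ideal_colon X I (prod_list (map var (pre @ as))) = vertex_ideal X E U' \<and>
    (\<forall>i < length as. var (as ! i) \<notin> ideal_colon X I (prod_list (map var (pre @ take i as))) \<and>
      (\<exists>b\<in>X. dominates X (ideal_colon X I (prod_list (map var (pre @ take i as)))) (as ! i) b))"
    using assms(1,3-5)
  proof (induction arbitrary: pre rule: strip.induct)
    case (strip_Nil U)
    then show ?case by simp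
  next
    case (strip_Cons a U b as U')
    let ?U = "U - insert a (neighbours E U a)"
    have aX: "a \<in> X" "b \<in> X" using strip_Cons by auto
    have "ideal_colon X I (prod_list (map var (pre @ [a]))) = vertex_ideal X E ?U"
      using ideal_colon_prod_list_append[of pre X a I] strip_Cons.prems aX
        ideal_colon_vertex_ideal[OF assms(2) strip_Cons(1)] by simp
    then have IH: "set as \<subseteq> X \<and> ideal_colon X I (prod_list (map var ((pre @ [a]) @ as))) = vertex_ideal X E U' \<and>
        (\<forall>i < length as. var (as ! i) \<notin> ideal_colon X I (prod_list (map var ((pre @ [a]) @ take i as))) \<and>
          (\<exists>b\<in>X. dominates X (ideal_colon X I (prod_list (map var ((pre @ [a]) @ take i as)))) (as ! i) b))"
      using strip_Cons.prems aX by (intro strip_Cons.IH) auto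
    have nl: "{a} \<notin> E" "{} \<notin> E" using assms(2)[of "{a}"] assms(2)[of "{}"] by auto
    have "var a \<notin> vertex_ideal X E U"
      using strip_Cons(1) nl unfolding var_def
      by (auto simp: graph_nonface_def lookup_single when_def subset_singleton_iff split: if_splits)
    moreover have "dominates X (vertex_ideal X E U) a b"
    proof -
      have "\<not> is_cone_apex X (vertex_ideal X E U) b"
        using is_cone_apex_vertex_ideal[OF assms(2) strip_Cons(2) strip_Cons.prems(1)] strip_Cons(4) by simp
      \<comment> \<open>\<open>a\<close> is the only neighbour of \<open>b\<close>, so adjoining it
        to the ideal isolates \<open>b\<close>; this is what domination asks for.\<close>
      moreover have "neighbours E (U - {a}) b = {}" using strip_Cons(4) by (auto simp: neighbours_def)
      then have "is_cone_apex X (vertex_ideal X E (U - {a})) b"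
        using strip_Cons.prems(1) strip_Cons(2,3) by (subst is_cone_apex_vertex_ideal[OF assms(2)]) auto
      ultimately show ?thesis unfolding dominates_def ideal_plus_vertex_ideal[OF aX(1)] by blast
    qed
    ultimately have first: "var a \<notin> ideal_colon X I (prod_list (map var pre)) \<and>
        (\<exists>b\<in>X. dominates X (ideal_colon X I (prod_list (map var pre))) a b)"
      using strip_Cons.prems(3) aX by auto
    show ?case
    proof (intro conjI allI impI)
      fix i assume i: "i < length (a # as)"
      show "var ((a # as) ! i) \<notin> ideal_colon X I (prod_list (map var (pre @ take i (a # as))))"
        "\<exists>b\<in>X. dominates X (ideal_colon X I (prod_list (map var (pre @ take i (a # as))))) ((a # as) ! i) b"
        using first IH i by (cases i; simp)+
    qed (use IH aX in auto)
  qed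
  then show "set as \<subseteq> X" "ideal_colon X I (prod_list (map var (pre @ as))) = vertex_ideal X E U'"
    "\<And>i. i < length as \<Longrightarrow> var (as ! i) \<notin> ideal_colon X I (prod_list (map var (pre @ take i as))) \<and>
      (\<exists>b\<in>X. dominates X (ideal_colon X I (prod_list (map var (pre @ take i as)))) (as ! i) b)"
    by blast+
qed

text \<open>All stripping steps are dominations. At the end only the isolated vertex
  \<open>v\<close> is left, which is a cone apex; appending it to the list gives a resolution that
  is not spherical.\<close>

proposition strip_conical:
  assumes strip: "strip E X as {v}" and E: "\<And>e. e \<in> E \<Longrightarrow> e \<subseteq> X \<and> card e = 2"
  shows "conical X (graph_ideal X E)"
proof -
  let ?I = "graph_ideal X E"
  have card2: "card e = 2" if "e \<in> E" for e using E that by blast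
  have v: "v \<in> X" using strip_subset[OF strip] by simp
  have "ideal_colon X ?I (prod_list (map var [])) = vertex_ideal X E X"
  proof -
    have "graph_ideal X E = vertex_ideal X E X" using E by (rule graph_ideal_eq)
    then show ?thesis by (auto simp: ideal_colon_def monomial_ideal_def carrier_zpoly_ring)
  qed
  note steps = strip_steps[OF strip card2 subset_refl _ this, simplified]
  have v': "neighbours E {v} v = {}" using card2[of "{v}"] by (auto simp: neighbours_def)
  have nl: "{v} \<notin> E" "{} \<notin> E" using card2[of "{v}"] card2[of "{}"] by auto
  have apex: "is_cone_apex X (vertex_ideal X E {v}) v"
    using is_cone_apex_vertex_ideal[OF card2, where b = v and U = "{v}" and X = X] v v' by simp
  have vn: "var v \<notin> vertex_ideal X E {v}"
    using nl unfolding var_def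
    by (auto simp: graph_nonface_def lookup_single when_def subset_singleton_iff split: if_splits)
  have si: "step_ideal X ?I (as @ [v]) i = ideal_colon X ?I (prod_list (map var (take i as)))" if "i < length as" for i
    using that by (simp add: step_ideal_def)
  have sl: "step_ideal X ?I (as @ [v]) (length as) = vertex_ideal X E {v}"
    using steps(2) by (simp add: step_ideal_def)
  have "is_resolution X ?I (as @ [v])"
    unfolding is_resolution_def
  proof (intro conjI allI impI)
    show "set (as @ [v]) \<subseteq> X" using steps(1) v by simp
    fix i assume "i < length (as @ [v])"
    then consider "i < length as" | "i = length as" by force
    then have "var ((as @ [v]) ! i) \<notin> step_ideal X ?I (as @ [v]) i \<and>
      (is_cone_apex X (step_ideal X ?I (as @ [v]) i) ((as @ [v]) ! i) \<or>
         (\<exists>b\<in>X. dominates X (step_ideal X ?I (as @ [v]) i) ((as @ [v]) ! i) b))"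
    proof cases
      case 1
      then show ?thesis using steps(3)[OF 1] si[OF 1] by (simp add: nth_append)
    next
      case 2
      then show ?thesis using apex vn sl by simp
    qed
    then show "var ((as @ [v]) ! i) \<notin> step_ideal X ?I (as @ [v]) i"
      "is_cone_apex X (step_ideal X ?I (as @ [v]) i) ((as @ [v]) ! i) \<or>
         (\<exists>b\<in>X. dominates X (step_ideal X ?I (as @ [v]) i) ((as @ [v]) ! i) b)" by blast+
  qed
  moreover have "\<not> is_spherical X ?I (as @ [v])"
    unfolding is_spherical_def using apex sl by (auto intro!: exI[of _ "length as"])
  ultimately show ?thesis unfolding conical_def by blast
qed

section \<open>From the graph ideal back to the independence complex\<close>

lemma R_complex_graph_ideal:
  assumes "finite V" and E: "\<And>e. e \<in> E \<Longrightarrow> e \<subseteq> V \<and> card e = 2"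
  shows "R_complex V (graph_ideal V E) = indep_complex V E"
proof -
  have GI: "graph_ideal V E = vertex_ideal V E V" using E by (rule graph_ideal_eq)
  show ?thesis
  proof (intro subset_antisym subsetI)
    fix A assume "A \<in> R_complex V (graph_ideal V E)"
    then show "A \<in> indep_complex V E"
      unfolding R_complex_def GI by (auto simp: indep_complex_def graph_nonface_def)
  next
    fix A assume A: "A \<in> indep_complex V E"
    then have "finite A" using assms(1) by (auto simp: indep_complex_def intro: finite_subset)
    define m where "m = (\<Sum>x\<in>A. Poly_Mapping.single x (1::nat))"
    have l: "Poly_Mapping.lookup m x = (if x \<in> A then 1 else 0)" for x
      using \<open>finite A\<close> by (simp add: m_def lookup_sum lookup_single when_def)
    then have "Poly_Mapping.keys m = A" by (auto simp: in_keys_iff split: if_splits)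
    then show "A \<in> R_complex V (graph_ideal V E)"
      using A l unfolding R_complex_def GI
      by (intro CollectI exI[of _ m]) (auto simp: indep_complex_def graph_nonface_def)
  qed
qed

theorem theorem7p5:
  fixes V :: "'a set" and E :: "'a set set" and n :: nat and S :: "('a \<Rightarrow> real) topology"
  assumes "finite_simple_graph V E"
    and "h1 V E = 1"
  defines "n \<equiv> card (the_cycle E)"
    and "S \<equiv> geometric_realization (R_complex V (graph_ideal V E))"
  shows "exactly_one_of
           (contractible_space S)
           (homotopy_sphere_type S)
           (homotopy_double_sphere_type S) \<and>
         (homotopy_double_sphere_type S \<longrightarrow>
           (\<forall>(V\<^sub>T, E\<^sub>T) \<in> tree_tentacles V E. conical V\<^sub>T (graph_ideal V\<^sub>T E\<^sub>T)) \<and>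
           n mod 3 = 0)"
proof -
  have "\<And>e. e \<in> E \<Longrightarrow> e \<subseteq> V \<and> card e = 2" using finite_simple_graphD[OF assms(1)] by blast
  then have S: "S = geometric_realization (indep_complex V E)"
    unfolding S_def using R_complex_graph_ideal[OF finite_simple_graphD(1)[OF assms(1)]] by simp
  have "contractible_space S \<or> homotopy_sphere_type S \<or>
    homotopy_double_sphere_type S \<and> n mod 3 = 0 \<and> (\<exists>as. strip E V as (\<Union>(the_cycle E)))"
    unfolding S n_def using indep_complex_trichotomy[OF assms(1,2)] by metis
  moreover from this
  have one: "exactly_one_of (contractible_space S) (homotopy_sphere_type S) (homotopy_double_sphere_type S)"
    by (intro exactly_one_homotopy_type) blast
  \<comment> \<open>The trichotomy is only a disjunction. That a wedge of two spheres always comes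
    with the divisibility and the stripping follows from the exclusivity \<open>one\<close>.\<close>
  ultimately have double: "n mod 3 = 0" "\<exists>as. strip E V as (\<Union>(the_cycle E))"
    if "homotopy_double_sphere_type S"
    using that by (auto simp: exactly_one_of_def)
  have "conical V\<^sub>T (graph_ideal V\<^sub>T E\<^sub>T)"
    if "homotopy_double_sphere_type S" "(V\<^sub>T, E\<^sub>T) \<in> tree_tentacles V E" for V\<^sub>T E\<^sub>T
    using double(2)[OF that(1)] strip_tentacle[OF assms(1,2) _ that(2)] strip_conical by metis
  with one double(1) show ?thesis by blast
qed

end
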